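(* Let $\ell\ge1$ and $m=2$, and let $B$, $\overline{R}$, $\overline{V}$, $\overline{h}$, $U_2(B)$ be as in the context, with $\ell=2f$ or $\ell=2f-1$ according to whether $\ell$ is even or odd. Let $u\in\overline{V}$ be a primitive vector, let $t=\overline{h}(u,u)$, and let $S_u$ be the stabilizer of $u$ in $U_2(B)$. (a) If $\overline{h}$ is non-isotropic, then $t$ must be a unit and $[U_2(B):S_u]=q^{2\ell-f-1}(q+1)$. (b) If $\overline{h}$ is isotropic, then $[U_2(B):S_u]=q^{2\ell-f-1}(q-1)$ if $t$ is a unit, and $[U_2(B):S_u]=2q^{2\ell-f-1}(q-1)$ if $t$ is not a unit.
   Context: $K$ is a non-archimedean local field with ring of integers $\mathcal{O}$, maximal ideal $\mathfrak{p}$ and residue field $F_q$ of odd characteristic; $F$ is a ramified quadratic extension of $K$ with ring of integers $\mathcal{R}=\mathcal{O}[\rho]$, where $\rho^2=\pi$ is a prime element of $\mathcal{O}$, and maximal ideal $\mathcal{P}=(\rho)$; $\mathcal{R}$ has the involution fixing $\mathcal{O}$ elementwise with $\rho\mapsto-\rho$. Put $A=\mathcal{R}/\mathcal{P}^{2\ell}$ with inherited involution $*$ and maximal ideal $\mathfrak{r}$, and $B=A/\mathfrak{r}^\ell\cong\mathcal{R}/\mathcal{P}^\ell$ with inherited involution $\circ$. Let $\overline{R}$ be the fixed ring of $\circ$ in $B$; $|\overline{R}|=q^f$. $V$ is a free $A$-module of rank $2$ with a non-degenerate $*$-hermitian form $h$ (biadditive, $A$-linear in the second variable, $h(v,u)=h(u,v)^*$,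 with $u\mapsto h(u,-)$ a bijection from $V$ onto $\mathrm{Hom}_A(V,A)$). $\overline{V}=V/V\mathfrak{r}^\ell$ is the free $B$-module of rank $2$ with the non-degenerate hermitian form $\overline{h}(v+V\mathfrak{r}^\ell,w+V\mathfrak{r}^\ell)=h(v,w)+\mathfrak{r}^\ell$. $U_2(B)$ is the group of $B$-linear automorphisms of $\overline{V}$ preserving $\overline{h}$. A vector of $\overline{V}$ is primitive if it belongs to a basis of $\overline{V}$; $\overline{h}$ is isotropic if there is a primitive vector $v$ with $\overline{h}(v,v)=0$. *)

theory Defs
  imports "HOL-Algebra.Algebra"
begin

text \<open>A non-archimedean local field is a field that is complete for a normalised discrete
  valuation with finite residue field.  The value of \<open>v\<close> at zero (morally infinite) is irrelevant.\<close>

definition val_ring :: "('a, 'm) ring_scheme \<Rightarrow> ('a \<Rightarrow> int) \<Rightarrow> 'a set" where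
  "val_ring K v = {x \<in> carrier K. x = \<zero>\<^bsub>K\<^esub> \<or> v x \<ge> 0}"

definition val_ideal :: "('a, 'm) ring_scheme \<Rightarrow> ('a \<Rightarrow> int) \<Rightarrow> 'a set" where
  "val_ideal K v = {x \<in> carrier K. x = \<zero>\<^bsub>K\<^esub> \<or> v x > 0}"

locale nonarch_local_field = field K for K :: "('a, 'm) ring_scheme" (structure) +
  fixes v :: "'a \<Rightarrow> int"
  assumes val_mult: "\<lbrakk>x \<in> carrier K - {\<zero>}; y \<in> carrier K - {\<zero>}\<rbrakk> \<Longrightarrow> v (x \<otimes> y) = v x + v y"
    and val_add: "\<lbrakk>x \<in> carrier K - {\<zero>}; y \<in> carrier K - {\<zero>}; x \<oplus> y \<noteq> \<zero>\<rbrakk>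
           \<Longrightarrow> v (x \<oplus> y) \<ge> min (v x) (v y)"
    and val_surj: "v ` (carrier K - {\<zero>}) = UNIV"
    and complete: "\<And>s :: nat \<Rightarrow> 'a. \<lbrakk>\<And>n. s n \<in> carrier K;
             \<And>N. \<exists>n0. \<forall>m\<ge>n0. \<forall>n\<ge>n0. s m \<ominus> s n = \<zero> \<or> v (s m \<ominus> s n) \<ge> N\<rbrakk>
           \<Longrightarrow> \<exists>x\<in>carrier K. \<forall>N. \<exists>n0. \<forall>n\<ge>n0. s n \<ominus> x = \<zero> \<or> v (s n \<ominus> x) \<ge> N"
    and finite_residue: "finite (carrier (K\<lparr>carrier := val_ring K v\<rparr> Quot val_ideal K v))"

definition ring_char :: "('a, 'm) ring_scheme \<Rightarrow> nat" where
  "ring_char R = group.ord (add_monoid R) \<one>\<^bsub>R\<^esub>"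

definition integral_closure_in :: "('a, 'm) ring_scheme \<Rightarrow> 'a set \<Rightarrow> 'a set" where
  "integral_closure_in F S = {x \<in> carrier F. \<exists>p. p \<noteq> [] \<and> polynomial\<^bsub>F\<^esub> S p \<and>
      lead_coeff p = \<one>\<^bsub>F\<^esub> \<and> ring.eval F p x = \<zero>\<^bsub>F\<^esub>}"

abbreviation ideal_power :: "('a, 'm) ring_scheme \<Rightarrow> 'a set \<Rightarrow> nat \<Rightarrow> 'a set" where
  "ideal_power R I n \<equiv> I [^]\<^bsub>ideals_set R\<^esub> n"

text \<open>Bases are finite by definition; over a nonzero commutative ring every basis of a module of
  finite rank is finite, so this loses nothing for the modules considered.\<close>

definition finite_basis ::
    "('a, 'm) ring_scheme \<Rightarrow> ('a, 'v, 'n) module_scheme \<Rightarrow> 'v set \<Rightarrow> bool" where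
  "finite_basis R M S \<longleftrightarrow> finite S \<and> S \<subseteq> carrier M \<and>
     (\<forall>x\<in>carrier M. \<exists>!c. c \<in> S \<rightarrow>\<^sub>E carrier R \<and> x = (\<Oplus>\<^bsub>M\<^esub> s\<in>S. c s \<odot>\<^bsub>M\<^esub> s))"

definition free_of_rank ::
    "('a, 'm) ring_scheme \<Rightarrow> ('a, 'v, 'n) module_scheme \<Rightarrow> nat \<Rightarrow> bool" where
  "free_of_rank R M n \<longleftrightarrow> (\<exists>S. finite_basis R M S \<and> card S = n)"

definition primitive ::
    "('a, 'm) ring_scheme \<Rightarrow> ('a, 'v, 'n) module_scheme \<Rightarrow> 'v \<Rightarrow> bool" where
  "primitive R M x \<longleftrightarrow> (\<exists>S. finite_basis R M S \<and> x \<in> S)"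

text \<open>Linear maps are extensional, i.e. \<open>undefined\<close> off the carrier, so that equality of maps is
  equality on the carrier (the convention of \<^const>\<open>Bij\<close>).\<close>

definition linear_maps :: "('a, 'm) ring_scheme \<Rightarrow> ('a, 'v, 'n) module_scheme
    \<Rightarrow> ('a, 'w, 'k) module_scheme \<Rightarrow> ('v \<Rightarrow> 'w) set" where
  "linear_maps R M N = {g \<in> carrier M \<rightarrow>\<^sub>E carrier N.
     (\<forall>x\<in>carrier M. \<forall>y\<in>carrier M. g (x \<oplus>\<^bsub>M\<^esub> y) = g x \<oplus>\<^bsub>N\<^esub> g y) \<and>
     (\<forall>a\<in>carrier R. \<forall>x\<in>carrier M. g (a \<odot>\<^bsub>M\<^esub> x) = a \<odot>\<^bsub>N\<^esub> g x)}"

definition regular_module :: "('a, 'm) ring_scheme \<Rightarrow> ('a, 'a) module" where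
  "regular_module R = \<lparr>carrier = carrier R, monoid.mult = monoid.mult R, monoid.one = monoid.one R,
     ring.zero = ring.zero R, ring.add = ring.add R, smult = monoid.mult R\<rparr>"

text \<open>The additive subgroup generated by all products; for an ideal \<open>I\<close> it is a submodule.\<close>

definition ideal_smult ::
    "'a set \<Rightarrow> ('a, 'v, 'n) module_scheme \<Rightarrow> 'v set" where
  "ideal_smult I M = generate (add_monoid M) {a \<odot>\<^bsub>M\<^esub> x | a x. a \<in> I \<and> x \<in> carrier M}"

text \<open>The quotient \<open>M/IM\<close> as a module over \<open>R/I\<close>, in the style of \<^const>\<open>FactRing\<close>: every set in the
  union is one and the same coset.  The \<open>mult\<close> and \<open>one\<close> fields of the module record play no role.\<close>

definition quot_module ::
    "('a, 'v, 'n) module_scheme \<Rightarrow> 'a set \<Rightarrow> ('a set, 'v set) module" where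
  "quot_module M I = \<lparr>carrier = a_rcosets\<^bsub>M\<^esub> (ideal_smult I M),
     monoid.mult = undefined, monoid.one = undefined,
     ring.zero = ideal_smult I M, ring.add = set_add M,
     smult = (\<lambda>C D. \<Union>a\<in>C. \<Union>y\<in>D. ideal_smult I M +>\<^bsub>M\<^esub> (a \<odot>\<^bsub>M\<^esub> y))\<rparr>"

locale hermitian_form = module R M for R :: "('a, 'm) ring_scheme" (structure)
    and M :: "('a, 'v, 'n) module_scheme" (structure) +
  fixes star :: "'a \<Rightarrow> 'a" and h :: "'v \<Rightarrow> 'v \<Rightarrow> 'a"
  assumes form_closed: "\<lbrakk>x \<in> carrier M; y \<in> carrier M\<rbrakk> \<Longrightarrow> h x y \<in> carrier R"
    and form_add_left: "\<lbrakk>x \<in> carrier M; y \<in> carrier M; z \<in> carrier M\<rbrakk>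
           \<Longrightarrow> h (x \<oplus>\<^bsub>M\<^esub> y) z = h x z \<oplus> h y z"
    and form_add_right: "\<lbrakk>x \<in> carrier M; y \<in> carrier M; z \<in> carrier M\<rbrakk>
           \<Longrightarrow> h x (y \<oplus>\<^bsub>M\<^esub> z) = h x y \<oplus> h x z"
    and form_smult_right: "\<lbrakk>a \<in> carrier R; x \<in> carrier M; y \<in> carrier M\<rbrakk>
           \<Longrightarrow> h x (a \<odot>\<^bsub>M\<^esub> y) = a \<otimes> h x y"
    and form_hermitian: "\<lbrakk>x \<in> carrier M; y \<in> carrier M\<rbrakk> \<Longrightarrow> h y x = star (h x y)"

definition nondegenerate :: "('a, 'm) ring_scheme \<Rightarrow> ('a, 'v, 'n) module_scheme
    \<Rightarrow> ('v \<Rightarrow> 'v \<Rightarrow> 'a) \<Rightarrow> bool" where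
  "nondegenerate R M h \<longleftrightarrow> bij_betw (\<lambda>x. \<lambda>y\<in>carrier M. h x y)
     (carrier M) (linear_maps R M (regular_module R))"

definition isotropic :: "('a, 'm) ring_scheme \<Rightarrow> ('a, 'v, 'n) module_scheme
    \<Rightarrow> ('v \<Rightarrow> 'v \<Rightarrow> 'a) \<Rightarrow> bool" where
  "isotropic R M h \<longleftrightarrow> (\<exists>x. primitive R M x \<and> h x x = \<zero>\<^bsub>R\<^esub>)"

text \<open>The form induced on \<open>M/IM\<close> with values in \<open>R/I\<close>: again a union of copies of a single coset.\<close>

definition quot_form :: "('a, 'm) ring_scheme \<Rightarrow> 'a set \<Rightarrow> ('v \<Rightarrow> 'v \<Rightarrow> 'a)
    \<Rightarrow> 'v set \<Rightarrow> 'v set \<Rightarrow> 'a set" where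
  "quot_form R I h = (\<lambda>C D. \<Union>x\<in>C. \<Union>y\<in>D. I +>\<^bsub>R\<^esub> h x y)"

definition unitary_group :: "('a, 'm) ring_scheme \<Rightarrow> ('a, 'v, 'n) module_scheme
    \<Rightarrow> ('v \<Rightarrow> 'v \<Rightarrow> 'a) \<Rightarrow> ('v \<Rightarrow> 'v) monoid" where
  "unitary_group R M h = (BijGroup (carrier M))
     \<lparr>carrier := {g \<in> Bij (carrier M) \<inter> linear_maps R M M.
        \<forall>x\<in>carrier M. \<forall>y\<in>carrier M. h (g x) (g y) = h x y}\<rparr>"

text \<open>An involution \<open>s\<close> of a ring that preserves an ideal \<open>I\<close> maps the coset of \<open>x\<close> onto the coset
  of \<open>s x\<close>, so the involution inherited by the quotient is the direct image.\<close>

abbreviation quot_involution :: "('a \<Rightarrow> 'a) \<Rightarrow> 'a set \<Rightarrow> 'a set" where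
  "quot_involution s \<equiv> (\<lambda>C. s ` C)"

definition fixed_ring :: "('a, 'm) ring_scheme \<Rightarrow> ('a \<Rightarrow> 'a) \<Rightarrow> 'a set" where
  "fixed_ring R s = {x \<in> carrier R. s x = x}"

end

theory Submission
  imports Defs
begin

text \<open>
By the orbit-stabilizer theorem the index is the length of the orbit of \<open>u\<close>.  A vector of the
free module \<open>V'\<close> is primitive exactly when it is unimodular, that is, when it pairs to \<open>1\<close> with
some vector, and the orbit of \<open>u\<close> turns out to be the whole ``sphere'' of unimodular vectors \<open>w\<close>
with \<open>h' w w = h' u u\<close>.  So the proof has two halves: transitivity on spheres, and counting spheres.

Both halves take place over \<open>B\<close>, a finite local ring of odd residue characteristic with an
involution that is trivial on the residue field, and use the cardinalities \<open>|B| = q ^ l\<close>,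
\<open>|\<mm>| = q ^ (l - 1)\<close> for the maximal ideal \<open>\<mm>\<close> and \<open>|B\<^sup>\<circ>| = q ^ f\<close> for the fixed ring.  Since \<open>2\<close>
is a unit, \<open>B\<close> is the direct sum of the fixed ring and of the skew elements, and the skew elements
lie in \<open>\<mm>\<close>; hence there are \<open>q ^ (l - f)\<close> of them and \<open>q ^ (f - 1) * (q - 1)\<close> fixed units.

Transitivity.  Two pairs of vectors with the same Gram matrix of unit determinant are conjugate
(\<open>equal_gram_conjugate\<close>), so it suffices to complete \<open>u\<close> to a pair whose Gram matrix depends on
\<open>t = h' u u\<close> alone.  If \<open>t\<close> is a unit, the explicit orthogonal vector of \<open>orthogonal_partner\<close>
gives the Gram matrix \<open>diag (t, t d)\<close> with \<open>d\<close> the discriminant of the plane.  If \<open>t\<close> is not a unit, a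
quadratic equation over the fixed ring produces \<open>w\<close> with \<open>h' u w = 1\<close> and \<open>h' w w = 0\<close>
(\<open>hyperbolic_partner\<close>).  The second construction also shows that a plane is isotropic as soon as
some unimodular vector has nonunit norm.

Counting.  In an isotropic plane choose a hyperbolic pair; the norm of \<open>(x, y)\<close> is then the trace of
\<open>x\<^sup>\<circ> y\<close>.  For a unit \<open>x\<close> the equation \<open>tr (x\<^sup>\<circ> y) = t\<close> has as many solutions \<open>y\<close> as there are skew
elements.  When \<open>t\<close> is a unit both coordinates are units, when it is not exactly one of them is,
which accounts for the factor \<open>2\<close> (\<open>card_sphere_isotropic\<close>).  In an anisotropic plane all
unimodular vectors have unit norm, and in an orthogonal basis the norm is a multiple of
\<open>x\<^sup>\<circ> x + d y\<^sup>\<circ> y\<close>, the reduced norm of a quaternion algebra.  This form is multiplicative, so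
its fibres over the values that it takes have equal size; it takes all fixed units as values,
because it takes a nonsquare one and the squares have index two.  Hence every sphere has
\<open>(|B|\<^sup>2 - |\<mm>|\<^sup>2) / |fixed units|\<close> elements (\<open>card_sphere_anisotropic\<close>).

The remaining sections connect this with the local field: \<open>\<R>\<close> is a domain whose prime element
\<open>\<rho>\<close> has \<open>\<R> / (\<rho>)\<close> of size \<open>q\<close>, the ring \<open>B\<close> is \<open>\<R> / (\<rho> ^ l)\<close>, and the form reduced modulo
\<open>\<rr> ^ l\<close> is again a hermitian form with unit Gram determinant.
\<close>

section \<open>Finite local rings with an involution\<close>

text \<open>Locality is the closure of the nonunits under addition, and \<open>circ_residue\<close> says that the
involution induces the identity on the residue field, as it does for a ramified extension.  The
element \<open>socle\<close> detects vectors all of whose coordinates are nonunits: it annihilates them, so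
they cannot belong to a basis.\<close>

locale involutive_local_ring = R?: cring R for R (structure) +
  fixes circ :: "'a \<Rightarrow> 'a"
  assumes finite_carrier: "finite (carrier R)"
    and one_not_zero: "\<one> \<noteq> \<zero>"
    and two_unit: "\<one> \<oplus> \<one> \<in> Units R"
    and nonunits_add: "\<lbrakk>x \<in> carrier R - Units R; y \<in> carrier R - Units R\<rbrakk> \<Longrightarrow> x \<oplus> y \<notin> Units R"
    and socle: "\<exists>z\<in>carrier R. z \<noteq> \<zero> \<and> (\<forall>x\<in>carrier R - Units R. z \<otimes> x = \<zero>)"
    and circ_hom: "circ \<in> ring_hom R R"
    and circ_circ: "x \<in> carrier R \<Longrightarrow> circ (circ x) = x"
    and circ_residue: "x \<in> carrier R \<Longrightarrow> x \<ominus> circ x \<notin> Units R"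
begin

abbreviation fixed where "fixed \<equiv> fixed_ring R circ"
abbreviation nonunits where "nonunits \<equiv> carrier R - Units R"
definition skew where "skew = {x \<in> carrier R. circ x = \<ominus> x}"

lemma circ_closed [simp, intro]: "x \<in> carrier R \<Longrightarrow> circ x \<in> carrier R"
  using circ_hom by (rule ring_hom_closed)

lemma circ_add [simp]: "\<lbrakk>x \<in> carrier R; y \<in> carrier R\<rbrakk> \<Longrightarrow> circ (x \<oplus> y) = circ x \<oplus> circ y"
  using circ_hom by (rule ring_hom_add)

lemma circ_mult [simp]: "\<lbrakk>x \<in> carrier R; y \<in> carrier R\<rbrakk> \<Longrightarrow> circ (x \<otimes> y) = circ x \<otimes> circ y"
  using circ_hom by (rule ring_hom_mult)

lemma circ_one [simp]: "circ \<one> = \<one>"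
  using circ_hom by (rule ring_hom_one)

lemma circ_zero [simp]: "circ \<zero> = \<zero>"
  using circ_hom ring_axioms by (simp add: ring_hom_zero)

lemma circ_minus [simp]:
  assumes x: "x \<in> carrier R" shows "circ (\<ominus> x) = \<ominus> circ x"
proof -
  have "circ x \<oplus> circ (\<ominus> x) = circ (x \<oplus> \<ominus> x)" using x by simp
  then show ?thesis using x by (metis a_inv_closed add.inv_equality add.m_comm circ_closed circ_zero r_neg)
qed

lemma circ_diff [simp]: "\<lbrakk>x \<in> carrier R; y \<in> carrier R\<rbrakk> \<Longrightarrow> circ (x \<ominus> y) = circ x \<ominus> circ y"
  by (simp add: minus_eq)

lemma circ_unit: "x \<in> Units R \<Longrightarrow> circ x \<in> Units R"
  by (metis Units_closed Units_inv_closed Units_l_inv_ex circ_closed circ_mult circ_one m_comm unit_factor Units_one_closed)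

lemma circ_unit_iff: "x \<in> carrier R \<Longrightarrow> circ x \<in> Units R \<longleftrightarrow> x \<in> Units R"
  using circ_unit circ_circ by metis

lemma nonunit_mult: "\<lbrakk>x \<in> nonunits; y \<in> carrier R\<rbrakk> \<Longrightarrow> x \<otimes> y \<in> nonunits"
  by (metis DiffD1 DiffD2 DiffI m_closed unit_factor)

lemma zero_nonunit [simp]: "\<zero> \<notin> Units R"
  using one_not_zero by (metis Units_r_inv_ex Units_closed l_null)

lemma nonunit_minus: "x \<in> nonunits \<Longrightarrow> \<ominus> x \<in> nonunits"
  using nonunit_mult[of x "\<ominus> \<one>"] by (auto simp: r_minus)

lemma nonunit_add: "\<lbrakk>x \<in> nonunits; y \<in> nonunits\<rbrakk> \<Longrightarrow> x \<oplus> y \<in> nonunits"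
  using nonunits_add by auto

lemma unit_add_nonunit:
  assumes x: "x \<in> Units R" and y: "y \<in> nonunits"
  shows "x \<oplus> y \<in> Units R"
proof (rule ccontr)
  assume "\<not> ?thesis"
  then have "x \<oplus> y \<in> nonunits" using x y by auto
  then have "(x \<oplus> y) \<oplus> \<ominus> y \<in> nonunits" using nonunit_add nonunit_minus y by blast
  moreover have "(x \<oplus> y) \<oplus> \<ominus> y = x" using Units_closed[OF x] y by (auto simp: a_assoc r_neg)
  ultimately show False using x by simp
qed

lemma unit_minus: "x \<in> Units R \<Longrightarrow> \<ominus> x \<in> Units R"
  by (metis Units_closed Units_minus_one_closed Units_m_closed l_minus l_one one_closed)

lemma unit_double: "x \<in> Units R \<Longrightarrow> x \<oplus> x \<in> Units R"
proof -
  assume x: "x \<in> Units R"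
  have "x \<oplus> x = (\<one> \<oplus> \<one>) \<otimes> x" using Units_closed[OF x] by (simp add: l_distr)
  then show ?thesis using x two_unit by simp
qed

definition half where "half = inv (\<one> \<oplus> \<one>)"

lemma half_closed [simp, intro]: "half \<in> carrier R"
  unfolding half_def using two_unit by simp

lemma half_double: "x \<in> carrier R \<Longrightarrow> half \<otimes> x \<oplus> half \<otimes> x = x"
proof -
  assume x: "x \<in> carrier R"
  have "half \<otimes> x \<oplus> half \<otimes> x = (half \<otimes> (\<one> \<oplus> \<one>)) \<otimes> x" using x half_closed by algebra
  then show ?thesis using two_unit x by (simp add: half_def)
qed

lemma fixedD: "x \<in> fixed \<Longrightarrow> x \<in> carrier R" "x \<in> fixed \<Longrightarrow> circ x = x"
  by (auto simp: fixed_ring_def)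

lemma fixed_add: "\<lbrakk>x \<in> fixed; y \<in> fixed\<rbrakk> \<Longrightarrow> x \<oplus> y \<in> fixed"
  by (auto simp: fixed_ring_def)

lemma fixed_mult: "\<lbrakk>x \<in> fixed; y \<in> fixed\<rbrakk> \<Longrightarrow> x \<otimes> y \<in> fixed"
  by (auto simp: fixed_ring_def)

lemma fixed_inv: "\<lbrakk>x \<in> fixed; x \<in> Units R\<rbrakk> \<Longrightarrow> inv x \<in> fixed"
proof -
  assume x: "x \<in> fixed" "x \<in> Units R"
  have "circ (inv x) \<otimes> x = \<one>"
    using x by (metis Units_inv_closed Units_l_inv circ_mult circ_one fixedD)
  then have "circ (inv x) = inv x"
    using x by (metis Units_closed Units_inv_closed circ_closed comm_inv_char m_comm)
  then show ?thesis using x by (simp add: fixed_ring_def)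
qed

lemma fixed_one: "\<one> \<in> fixed" and fixed_minus: "x \<in> fixed \<Longrightarrow> \<ominus> x \<in> fixed"
  by (auto simp: fixed_ring_def)

lemma fixed_half: "half \<in> fixed"
  unfolding half_def using fixed_inv[OF fixed_add[OF fixed_one fixed_one] two_unit] .

lemma fixed_norm: "x \<in> carrier R \<Longrightarrow> circ x \<otimes> x \<in> fixed"
  by (auto simp: fixed_ring_def circ_circ m_comm)

lemma unit_cancel: "\<lbrakk>a \<in> Units R; x \<in> carrier R; y \<in> carrier R; a \<otimes> x = a \<otimes> y\<rbrakk> \<Longrightarrow> x = y"
  by (simp add: Units_l_cancel)

lemma minus_eq_zero: "\<lbrakk>x \<in> carrier R; y \<in> carrier R; x \<ominus> y = \<zero>\<rbrakk> \<Longrightarrow> x = y"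
  by (metis r_right_minus_eq)

text \<open>For a nonunit \<open>t\<close> the map \<open>c \<mapsto> 2 c + c\<^sup>2 t\<close> of the fixed ring into itself is injective, since the
difference of two values is \<open>c - d\<close> times the unit \<open>2 + t (c + d)\<close>.  The fixed ring being finite,
it is onto; this takes the place of Hensel's lemma.\<close>

lemma solve_quadratic:
  assumes s: "s \<in> fixed" and t: "t \<in> fixed" "t \<notin> Units R"
  shows "\<exists>c\<in>fixed. s \<oplus> ((c \<oplus> c) \<oplus> c \<otimes> c \<otimes> t) = \<zero>"
proof -
  let ?p = "\<lambda>c. (c \<oplus> c) \<oplus> c \<otimes> c \<otimes> t"
  have "inj_on ?p fixed"
  proof (rule inj_onI)
    fix c d assume cd: "c \<in> fixed" "d \<in> fixed" and eq: "?p c = ?p d"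
    have cl: "c \<in> carrier R" "d \<in> carrier R" "t \<in> carrier R" using cd t fixedD by auto
    let ?u = "(\<one> \<oplus> \<one>) \<oplus> t \<otimes> (c \<oplus> d)"
    have u: "?u \<in> Units R"
      using unit_add_nonunit[OF two_unit] nonunit_mult[of t "c \<oplus> d"] cl t by auto
    have "?u \<otimes> (c \<ominus> d) = ?p c \<ominus> ?p d" using cl by algebra
    also have "\<dots> = \<zero>" using eq cl by (simp add: r_right_minus_eq)
    finally have "?u \<otimes> (c \<ominus> d) = ?u \<otimes> \<zero>" using cl u by simp
    then have "c \<ominus> d = \<zero>" using unit_cancel[OF u] cl by auto
    then show "c = d" by (rule minus_eq_zero[OF cl(1,2)])
  qed
  moreover have "?p ` fixed \<subseteq> fixed"
    by (intro image_subsetI fixed_add fixed_mult t)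
  moreover have "finite fixed" using finite_carrier by (simp add: fixed_ring_def)
  ultimately have "?p ` fixed = fixed" by (simp add: endo_inj_surj)
  then obtain c where "c \<in> fixed" "?p c = \<ominus> s" using fixed_minus[OF s] by (metis (no_types, lifting) imageE)
  then show ?thesis using s fixedD r_neg by metis
qed

lemma symmetric_part: "x \<in> carrier R \<Longrightarrow> half \<otimes> (x \<oplus> circ x) \<in> fixed"
  using fixedD[OF fixed_half] by (simp add: fixed_ring_def circ_circ a_comm)

lemma skew_part: "x \<in> carrier R \<Longrightarrow> half \<otimes> (x \<ominus> circ x) \<in> skew"
proof -
  assume x: "x \<in> carrier R"
  have "half \<otimes> (circ x \<ominus> x) = \<ominus> (half \<otimes> (x \<ominus> circ x))"
    using x half_closed circ_closed[OF x] by algebra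
  then show ?thesis using x fixedD[OF fixed_half] by (simp add: skew_def circ_circ)
qed

lemma skewD: "s \<in> skew \<Longrightarrow> s \<in> carrier R" "s \<in> skew \<Longrightarrow> circ s = \<ominus> s"
  by (auto simp: skew_def)

lemma skew_nonunit: "s \<in> skew \<Longrightarrow> s \<in> nonunits"
proof -
  assume s: "s \<in> skew"
  then have c: "s \<in> carrier R" "circ s = \<ominus> s" by (auto dest: skewD)
  have "s \<ominus> circ s = s \<oplus> s" using c by (simp add: minus_eq)
  then have "s \<oplus> s \<notin> Units R" using circ_residue[of s] c by metis
  then show ?thesis using c unit_double by auto
qed

text \<open>The splitting of \<open>x\<close> into \<open>(x + x\<^sup>\<circ>) / 2\<close> and \<open>(x - x\<^sup>\<circ>) / 2\<close>.  The second summand always lies in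
the maximal ideal, so \<open>x\<close> is a nonunit exactly when its symmetric part is one.\<close>

lemma skew_decomposition:
  "bij_betw (\<lambda>(a, s). a \<oplus> s) (fixed \<times> skew) (carrier R)"
  "bij_betw (\<lambda>(a, s). a \<oplus> s) ((fixed \<inter> nonunits) \<times> skew) nonunits"
proof -
  let ?p = "\<lambda>(a, s). a \<oplus> s"
  have inj: "inj_on ?p (fixed \<times> skew)"
  proof (rule inj_onI, clarify)
    fix a s b r assume m: "a \<in> fixed" "s \<in> skew" "b \<in> fixed" "r \<in> skew" and eq: "a \<oplus> s = b \<oplus> r"
    have c: "a \<in> carrier R" "s \<in> carrier R" "b \<in> carrier R" "r \<in> carrier R"
      using m fixedD skewD by auto
    have eq': "a \<oplus> \<ominus> s = b \<oplus> \<ominus> r"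
      using arg_cong[OF eq, of circ] m c by (simp add: fixedD skewD)
    have "a \<oplus> a = (a \<oplus> s) \<oplus> (a \<oplus> \<ominus> s)" using c by algebra
    also have "\<dots> = (b \<oplus> r) \<oplus> (b \<oplus> \<ominus> r)" using eq eq' by simp
    also have "\<dots> = b \<oplus> b" using c by algebra
    finally have aa: "a \<oplus> a = b \<oplus> b" .
    have "a = half \<otimes> (a \<oplus> a)" using c half_closed half_double by (simp add: r_distr)
    also have "\<dots> = b" using c half_closed half_double by (simp add: r_distr aa)
    finally have "a = b" .
    then show "a = b \<and> s = r" using eq c by simp
  qed
  have split: "x = half \<otimes> (x \<oplus> circ x) \<oplus> half \<otimes> (x \<ominus> circ x)" if x: "x \<in> carrier R" for x
  proof -
    have "half \<otimes> (x \<oplus> circ x) \<oplus> half \<otimes> (x \<ominus> circ x) = half \<otimes> x \<oplus> half \<otimes> x"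
      using x half_closed circ_closed[OF x] by algebra
    then show ?thesis using half_double x by simp
  qed
  have "?p ` (fixed \<times> skew) = carrier R"
  proof
    show "?p ` (fixed \<times> skew) \<subseteq> carrier R" using fixedD skewD by auto
    show "carrier R \<subseteq> ?p ` (fixed \<times> skew)"
      using split symmetric_part skew_part by (force simp: image_iff)
  qed
  with inj show "bij_betw ?p (fixed \<times> skew) (carrier R)" by (simp add: bij_betw_def)
  have "?p ` ((fixed \<inter> nonunits) \<times> skew) = nonunits"
  proof
    show "?p ` ((fixed \<inter> nonunits) \<times> skew) \<subseteq> nonunits"
      using nonunit_add skew_nonunit by auto
    show "nonunits \<subseteq> ?p ` ((fixed \<inter> nonunits) \<times> skew)"
    proof
      fix x assume x: "x \<in> nonunits"
      then have "x \<oplus> circ x \<in> nonunits" using nonunit_add circ_unit_iff by auto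
      then have "half \<otimes> (x \<oplus> circ x) \<in> nonunits" using nonunit_mult m_comm half_closed by (metis Diff_iff)
      then show "x \<in> ?p ` ((fixed \<inter> nonunits) \<times> skew)"
        using split[of x] symmetric_part[of x] skew_part[of x] x by (force simp: image_iff)
    qed
  qed
  moreover have "inj_on ?p ((fixed \<inter> nonunits) \<times> skew)"
    using inj by (rule inj_on_subset) auto
  ultimately show "bij_betw ?p ((fixed \<inter> nonunits) \<times> skew) nonunits" by (simp add: bij_betw_def)
qed

lemma card_fixed_skew: "card fixed * card skew = card (carrier R)"
  using bij_betw_same_card[OF skew_decomposition(1)] by (simp add: card_cartesian_product)

lemma card_nonunits_skew: "card (fixed \<inter> nonunits) * card skew = card nonunits"
  using bij_betw_same_card[OF skew_decomposition(2)] by (simp add: card_cartesian_product)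

text \<open>The solutions \<open>y\<close> form a translate of the skew elements: \<open>x\<^sup>\<circ> y\<close> has trace \<open>t\<close> exactly when it
differs from \<open>t / 2\<close> by a skew element, and multiplication by \<open>x\<^sup>\<circ>\<close> is bijective.\<close>

lemma card_trace_fibre:
  assumes x: "x \<in> Units R" and t: "t \<in> fixed"
  shows "card {y \<in> carrier R. circ x \<otimes> y \<oplus> circ y \<otimes> x = t} = card skew"
proof -
  have cx: "circ x \<in> Units R" "x \<in> carrier R" using x circ_unit by auto
  have tc: "t \<in> carrier R" "circ t = t" using t fixedD by auto
  have hc: "half \<in> carrier R" "circ half = half" using fixedD[OF fixed_half] by auto
  have tr: "circ x \<otimes> y \<oplus> circ y \<otimes> x = t \<longleftrightarrow> circ x \<otimes> y \<ominus> half \<otimes> t \<in> skew" if y: "y \<in> carrier R" for y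
  proof -
    let ?z = "circ x \<otimes> y"
    have z: "?z \<in> carrier R" "circ ?z = circ y \<otimes> x" using y cx by (auto simp: circ_circ m_comm)
    have "?z \<ominus> half \<otimes> t \<in> skew \<longleftrightarrow> circ ?z \<ominus> half \<otimes> t = \<ominus> (?z \<ominus> half \<otimes> t)"
      using z tc hc unfolding skew_def by simp
    also have "\<dots> \<longleftrightarrow> (circ ?z \<ominus> half \<otimes> t) \<oplus> (?z \<ominus> half \<otimes> t) = \<zero>"
      using z tc hc by (metis circ_closed l_neg m_closed minus_closed minus_equality)
    also have "(circ ?z \<ominus> half \<otimes> t) \<oplus> (?z \<ominus> half \<otimes> t) = (?z \<oplus> circ ?z) \<ominus> (half \<otimes> t \<oplus> half \<otimes> t)"
      using z tc hc circ_closed[OF z(1)] by algebra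
    also have "\<dots> = (?z \<oplus> circ ?z) \<ominus> t" using half_double tc by simp
    also have "\<dots> = \<zero> \<longleftrightarrow> ?z \<oplus> circ ?z = t"
      using z(1) circ_closed[OF z(1)] tc(1) by (metis a_closed r_right_minus_eq)
    finally show ?thesis using z by simp
  qed
  have "bij_betw (\<lambda>y. circ x \<otimes> y \<ominus> half \<otimes> t) {y \<in> carrier R. circ x \<otimes> y \<oplus> circ y \<otimes> x = t} skew"
  proof (rule bij_betw_byWitness[where f' = "\<lambda>s. inv (circ x) \<otimes> (s \<oplus> half \<otimes> t)"])
    have recover: "circ x \<otimes> (inv (circ x) \<otimes> (s \<oplus> half \<otimes> t)) \<ominus> half \<otimes> t = s" if "s \<in> carrier R" for s
    proof -
      have "circ x \<otimes> (inv (circ x) \<otimes> (s \<oplus> half \<otimes> t)) = s \<oplus> half \<otimes> t"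
        using cx that tc hc by (simp add: m_assoc[symmetric])
      moreover have "(s \<oplus> half \<otimes> t) \<ominus> half \<otimes> t = s" using that tc hc by algebra
      ultimately show ?thesis by simp
    qed
    show "\<forall>s\<in>skew. circ x \<otimes> (inv (circ x) \<otimes> (s \<oplus> half \<otimes> t)) \<ominus> half \<otimes> t = s"
      using recover skewD by auto
    show "\<forall>y\<in>{y \<in> carrier R. circ x \<otimes> y \<oplus> circ y \<otimes> x = t}.
            inv (circ x) \<otimes> (circ x \<otimes> y \<ominus> half \<otimes> t \<oplus> half \<otimes> t) = y"
    proof
      fix y assume "y \<in> {y \<in> carrier R. circ x \<otimes> y \<oplus> circ y \<otimes> x = t}"
      then have y: "y \<in> carrier R" by simp
      have "(circ x \<otimes> y \<ominus> half \<otimes> t) \<oplus> half \<otimes> t = circ x \<otimes> y" using y cx(2) circ_closed[OF cx(2)] tc hc by algebra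
      then show "inv (circ x) \<otimes> (circ x \<otimes> y \<ominus> half \<otimes> t \<oplus> half \<otimes> t) = y"
        using cx y by (simp add: m_assoc[symmetric])
    qed
    show "(\<lambda>y. circ x \<otimes> y \<ominus> half \<otimes> t) ` {y \<in> carrier R. circ x \<otimes> y \<oplus> circ y \<otimes> x = t} \<subseteq> skew"
      using tr by auto
    show "(\<lambda>s. inv (circ x) \<otimes> (s \<oplus> half \<otimes> t)) ` skew \<subseteq> {y \<in> carrier R. circ x \<otimes> y \<oplus> circ y \<otimes> x = t}"
    proof
      fix y assume "y \<in> (\<lambda>s. inv (circ x) \<otimes> (s \<oplus> half \<otimes> t)) ` skew"
      then obtain s where s: "s \<in> skew" "y = inv (circ x) \<otimes> (s \<oplus> half \<otimes> t)" by blast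
      then have y: "y \<in> carrier R" using skewD(1) cx tc hc by simp
      have "circ x \<otimes> y \<ominus> half \<otimes> t \<in> skew" using recover[of s] s skewD(1) by simp
      then show "y \<in> {y \<in> carrier R. circ x \<otimes> y \<oplus> circ y \<otimes> x = t}" using tr y by simp
    qed
  qed
  then show ?thesis by (rule bij_betw_same_card)
qed

end

section \<open>Anisotropic norm forms over the local ring\<close>

context involutive_local_ring
begin

abbreviation fixed_units where "fixed_units \<equiv> fixed \<inter> Units R"
definition squares where "squares = (\<lambda>a. a \<otimes> a) ` fixed_units"
text \<open>The reduced norm of the quaternion \<open>x + y j\<close>, where \<open>j\<^sup>2 = - D\<close> and \<open>j x = x\<^sup>\<circ> j\<close>.\<close>

definition nrm where "nrm D x y = circ x \<otimes> x \<oplus> D \<otimes> (circ y \<otimes> y)"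
definition nrm_fibre where "nrm_fibre D s = {(x, y). x \<in> carrier R \<and> y \<in> carrier R \<and> nrm D x y = s}"

lemma finite_fixed: "finite fixed"
  using finite_carrier by (simp add: fixed_ring_def)

text \<open>Of the factors of \<open>(b - a) (b + a) = 0\<close> at least one is a unit, since \<open>2 a\<close> is a unit and the
nonunits are closed under addition.  So a unit square has exactly two fixed roots.\<close>

lemma square_roots:
  assumes a: "a \<in> fixed_units"
  shows "{b \<in> fixed_units. b \<otimes> b = a \<otimes> a} = {a, \<ominus> a}" and "a \<noteq> \<ominus> a"
proof -
  have ac: "a \<in> carrier R" using a fixedD by auto
  have aa: "a \<oplus> a \<in> Units R" using unit_double a by simp
  show "a \<noteq> \<ominus> a"
  proof
    assume "a = \<ominus> a"
    then have "a \<oplus> a = \<zero>" using ac r_neg[of a] by simp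
    then show False using aa by simp
  qed
  have "b = a \<or> b = \<ominus> a" if b: "b \<in> fixed_units" "b \<otimes> b = a \<otimes> a" for b
  proof -
    have bc: "b \<in> carrier R" using b fixedD by auto
    have "(b \<ominus> a) \<otimes> (b \<oplus> a) = b \<otimes> b \<ominus> a \<otimes> a" using ac bc by algebra
    then have z: "(b \<ominus> a) \<otimes> (b \<oplus> a) = \<zero>" using b ac by (simp add: r_right_minus_eq)
    show ?thesis
    proof (cases "b \<ominus> a \<in> Units R")
      case True
      then have "b \<oplus> a = \<zero>" using z unit_cancel[OF True, of "b \<oplus> a" \<zero>] ac bc by simp
      then show ?thesis using ac bc by (simp add: minus_equality)
    next
      case False
      then have n: "b \<ominus> a \<in> nonunits" using ac bc by simp
      have "(a \<oplus> a) \<oplus> (b \<ominus> a) = b \<oplus> a" using ac bc by algebra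
      then have u: "b \<oplus> a \<in> Units R" using unit_add_nonunit[OF aa n] by simp
      have "(b \<oplus> a) \<otimes> (b \<ominus> a) = (b \<oplus> a) \<otimes> \<zero>" using z ac bc by (simp add: m_comm)
      then have "b \<ominus> a = \<zero>" using unit_cancel[OF u] ac bc by blast
      then show ?thesis using minus_eq_zero[OF bc ac] by simp
    qed
  qed
  moreover have "\<ominus> a \<in> fixed_units" using a fixed_minus unit_minus by simp
  moreover have "(\<ominus> a) \<otimes> (\<ominus> a) = a \<otimes> a" using ac by algebra
  ultimately show "{b \<in> fixed_units. b \<otimes> b = a \<otimes> a} = {a, \<ominus> a}" using a by blast
qed

lemma card_squares: "card fixed_units = 2 * card squares"
proof -
  have fin: "finite fixed_units" using finite_fixed by simp
  have "card fixed_units = (\<Sum>s\<in>squares. card {b \<in> fixed_units. b \<otimes> b = s})"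
    using sum.image_gen[OF fin, of "\<lambda>_. 1::nat" "\<lambda>a. a \<otimes> a"] by (simp add: squares_def)
  also have "\<dots> = (\<Sum>s\<in>squares. 2)"
  proof (rule sum.cong[OF refl])
    fix s assume "s \<in> squares"
    then obtain a where a: "a \<in> fixed_units" "s = a \<otimes> a" unfolding squares_def by blast
    show "card {b \<in> fixed_units. b \<otimes> b = s} = 2"
      unfolding a(2) square_roots(1)[OF a(1)] using square_roots(2)[OF a(1)] by simp
  qed
  finally show ?thesis by simp
qed

lemma fixed_units_mult: "\<lbrakk>a \<in> fixed_units; b \<in> fixed_units\<rbrakk> \<Longrightarrow> a \<otimes> b \<in> fixed_units"
  using fixed_mult by simp

lemma squares_subset: "squares \<subseteq> fixed_units"
  unfolding squares_def using fixed_units_mult by blast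

text \<open>As squaring is two-to-one, the squares make up half of the fixed units, and the coset \<open>e Q\<close> of a
nonsquare \<open>e\<close> makes up the other half.\<close>

lemma squares_index_two:
  assumes e: "e \<in> fixed_units" "e \<notin> squares" and s: "s \<in> fixed_units"
  shows "s \<in> squares \<or> (\<exists>r\<in>squares. s = e \<otimes> r)"
proof -
  have fin: "finite fixed_units" using finite_fixed by simp
  have finq: "finite squares" using fin by (simp add: squares_def)
  have sub: "(\<lambda>r. e \<otimes> r) ` squares \<subseteq> fixed_units"
    using squares_subset fixed_units_mult[OF e(1)] by blast
  have inj: "inj_on (\<lambda>r. e \<otimes> r) squares"
  proof (rule inj_onI)
    fix x y assume "x \<in> squares" "y \<in> squares" "e \<otimes> x = e \<otimes> y"
    then show "x = y" using unit_cancel[of e x y] e(1) squares_subset Units_closed by blast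
  qed
  have disj: "squares \<inter> (\<lambda>r. e \<otimes> r) ` squares = {}"
  proof (rule ccontr)
    assume "\<not> ?thesis"
    then obtain a b where ab: "a \<in> fixed_units" "b \<in> fixed_units" "a \<otimes> a = e \<otimes> (b \<otimes> b)"
      unfolding squares_def by blast
    have c: "a \<in> carrier R" "b \<in> carrier R" "e \<in> carrier R" using ab(1,2) e(1) fixedD by auto
    have i: "inv b \<in> fixed_units" "inv b \<in> carrier R" using ab(2) fixed_inv by auto
    have "(a \<otimes> inv b) \<otimes> (a \<otimes> inv b) = (a \<otimes> a) \<otimes> (inv b \<otimes> inv b)" using c i by algebra
    also have "\<dots> = e \<otimes> ((b \<otimes> inv b) \<otimes> (b \<otimes> inv b))" unfolding ab(3) using c i by algebra
    also have "\<dots> = e" using ab(2) c by simp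
    finally have "e = (a \<otimes> inv b) \<otimes> (a \<otimes> inv b)" by (rule sym)
    then have "e \<in> squares" unfolding squares_def
      by (rule image_eqI[OF _ fixed_units_mult[OF ab(1) i(1)]])
    then show False using e(2) by simp
  qed
  have "card (squares \<union> (\<lambda>r. e \<otimes> r) ` squares) = card fixed_units"
    using card_Un_disjoint[OF finq _ disj] card_image[OF inj] finq card_squares by simp
  then have "squares \<union> (\<lambda>r. e \<otimes> r) ` squares = fixed_units"
    using squares_subset sub fin by (intro card_subset_eq) auto
  then show ?thesis using s by blast
qed

lemma nrm_closed [simp]: "\<lbrakk>D \<in> carrier R; x \<in> carrier R; y \<in> carrier R\<rbrakk> \<Longrightarrow> nrm D x y \<in> carrier R"
  by (simp add: nrm_def)

lemma nrm_fixed: "\<lbrakk>D \<in> fixed; x \<in> carrier R; y \<in> carrier R\<rbrakk> \<Longrightarrow> nrm D x y \<in> fixed"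
  unfolding nrm_def by (intro fixed_add fixed_mult fixed_norm)

lemma nrm_nonunit:
  assumes "D \<in> carrier R" "x \<in> nonunits" "y \<in> nonunits" shows "nrm D x y \<notin> Units R"
proof -
  have "circ x \<otimes> x \<in> nonunits" "D \<otimes> (circ y \<otimes> y) \<in> nonunits"
    using nonunit_mult[OF assms(2), of "circ x"] nonunit_mult[OF assms(3), of "D \<otimes> circ y"] assms
    by (auto simp: m_ac)
  then show ?thesis unfolding nrm_def by (rule nonunits_add)
qed

text \<open>The product formula for the quaternions \<open>x + y j\<close> and \<open>x' + y' j\<close>, whose product is
\<open>(x x' - D y y'\<^sup>\<circ>) + (x y' + y x'\<^sup>\<circ>) j\<close>.\<close>

lemma nrm_mult:
  assumes D: "D \<in> fixed" and c: "x \<in> carrier R" "y \<in> carrier R" "x' \<in> carrier R" "y' \<in> carrier R"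
  shows "nrm D (x \<otimes> x' \<ominus> D \<otimes> (y \<otimes> circ y')) (x \<otimes> y' \<oplus> y \<otimes> circ x') = nrm D x y \<otimes> nrm D x' y'"
proof -
  have d: "D \<in> carrier R" "circ D = D" using D fixedD by auto
  have cc: "circ x \<in> carrier R" "circ y \<in> carrier R" "circ x' \<in> carrier R" "circ y' \<in> carrier R" using c by auto
  have "nrm D (x \<otimes> x' \<ominus> D \<otimes> (y \<otimes> circ y')) (x \<otimes> y' \<oplus> y \<otimes> circ x')
    = (circ x \<otimes> circ x' \<ominus> D \<otimes> (circ y \<otimes> y')) \<otimes> (x \<otimes> x' \<ominus> D \<otimes> (y \<otimes> circ y'))
      \<oplus> D \<otimes> ((circ x \<otimes> circ y' \<oplus> circ y \<otimes> x') \<otimes> (x \<otimes> y' \<oplus> y \<otimes> circ x'))"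
    unfolding nrm_def using c d cc by (simp add: circ_circ)
  also have "\<dots> = nrm D x y \<otimes> nrm D x' y'"
    unfolding nrm_def using c d(1) cc by algebra
  finally show ?thesis .
qed

text \<open>Multiplying the product by the conjugate \<open>x\<^sup>\<circ> - y j\<close> from the left gives back the second factor
times the norm of the first; thus multiplication by a quaternion of unit norm is injective.\<close>

lemma nrm_mult_recover:
  assumes D: "D \<in> fixed" and c: "x \<in> carrier R" "y \<in> carrier R" "x' \<in> carrier R" "y' \<in> carrier R"
  shows "circ x \<otimes> (x \<otimes> x' \<ominus> D \<otimes> (y \<otimes> circ y')) \<oplus> D \<otimes> (y \<otimes> circ (x \<otimes> y' \<oplus> y \<otimes> circ x')) = nrm D x y \<otimes> x'"
    and "circ x \<otimes> (x \<otimes> y' \<oplus> y \<otimes> circ x') \<ominus> y \<otimes> circ (x \<otimes> x' \<ominus> D \<otimes> (y \<otimes> circ y')) = nrm D x y \<otimes> y'"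
proof -
  have d: "D \<in> carrier R" "circ D = D" using D fixedD by auto
  have cc: "circ x \<in> carrier R" "circ y \<in> carrier R" "circ x' \<in> carrier R" "circ y' \<in> carrier R" using c by auto
  have e: "circ (x \<otimes> y' \<oplus> y \<otimes> circ x') = circ x \<otimes> circ y' \<oplus> circ y \<otimes> x'"
    "circ (x \<otimes> x' \<ominus> D \<otimes> (y \<otimes> circ y')) = circ x \<otimes> circ x' \<ominus> D \<otimes> (circ y \<otimes> y')"
    using c d cc by (auto simp: circ_circ)
  show "circ x \<otimes> (x \<otimes> x' \<ominus> D \<otimes> (y \<otimes> circ y')) \<oplus> D \<otimes> (y \<otimes> circ (x \<otimes> y' \<oplus> y \<otimes> circ x')) = nrm D x y \<otimes> x'"
    unfolding e nrm_def using c d(1) cc by algebra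
  show "circ x \<otimes> (x \<otimes> y' \<oplus> y \<otimes> circ x') \<ominus> y \<otimes> circ (x \<otimes> x' \<ominus> D \<otimes> (y \<otimes> circ y')) = nrm D x y \<otimes> y'"
    unfolding e nrm_def using c d(1) cc by algebra
qed

lemma finite_nrm_fibre: "finite (nrm_fibre D s)"
  by (rule finite_subset[of _ "carrier R \<times> carrier R"]) (auto simp: nrm_fibre_def finite_carrier)

lemma card_nrm_fibre_le:
  assumes D: "D \<in> fixed" and c: "x \<in> carrier R" "y \<in> carrier R" and u: "nrm D x y \<in> Units R"
  shows "card (nrm_fibre D s) \<le> card (nrm_fibre D (nrm D x y \<otimes> s))"
proof (rule card_inj_on_le)
  let ?m = "\<lambda>(x', y'). (x \<otimes> x' \<ominus> D \<otimes> (y \<otimes> circ y'), x \<otimes> y' \<oplus> y \<otimes> circ x')"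
  have d: "D \<in> carrier R" using D fixedD by auto
  show "inj_on ?m (nrm_fibre D s)"
  proof (rule inj_onI)
    fix p r assume pr: "p \<in> nrm_fibre D s" "r \<in> nrm_fibre D s" and eq: "?m p = ?m r"
    obtain a b where p: "p = (a, b)" by force
    obtain a' b' where r: "r = (a', b')" by force
    have k: "a \<in> carrier R" "b \<in> carrier R" "a' \<in> carrier R" "b' \<in> carrier R"
      using pr by (auto simp: p r nrm_fibre_def)
    have eqs: "x \<otimes> a \<ominus> D \<otimes> (y \<otimes> circ b) = x \<otimes> a' \<ominus> D \<otimes> (y \<otimes> circ b')"
      "x \<otimes> b \<oplus> y \<otimes> circ a = x \<otimes> b' \<oplus> y \<otimes> circ a'" using eq by (simp_all add: p r)
    have "nrm D x y \<otimes> a = nrm D x y \<otimes> a'" "nrm D x y \<otimes> b = nrm D x y \<otimes> b'"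
      unfolding nrm_mult_recover[OF D c k(1,2), symmetric] nrm_mult_recover[OF D c k(3,4), symmetric] eqs
      by (rule refl)+
    then have "a = a'" "b = b'" using unit_cancel[OF u k(1,3)] unit_cancel[OF u k(2,4)] by simp_all
    then show "p = r" by (simp add: p r)
  qed
  show "?m ` nrm_fibre D s \<subseteq> nrm_fibre D (nrm D x y \<otimes> s)"
    using nrm_mult[OF D c] c d by (auto simp: nrm_fibre_def)
qed (rule finite_nrm_fibre)

context
  fixes D assumes D: "D \<in> fixed"
    and anisotropic: "\<And>x y. \<lbrakk>x \<in> carrier R; y \<in> carrier R; x \<in> Units R \<or> y \<in> Units R\<rbrakk> \<Longrightarrow> nrm D x y \<in> Units R"
begin

lemma D_closed: "D \<in> carrier R"
  using D fixedD by simp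

lemma nrm_fixed_units:
  "\<lbrakk>x \<in> carrier R; y \<in> carrier R; x \<in> Units R \<or> y \<in> Units R\<rbrakk> \<Longrightarrow> nrm D x y \<in> fixed_units"
  using anisotropic nrm_fixed[OF D] by simp

text \<open>If all values were squares, then \<open>D = e\<^sup>2\<close> would be one, and from \<open>k = b\<^sup>2\<close> it would follow that
\<open>k + 1 = b\<^sup>2 + D (1 / e)\<^sup>2\<close> is a value, hence again a square of a unit.  By induction all positive
multiples of \<open>1\<close> would be units, which is absurd for the multiple by the order of the finite ring.\<close>

lemma nrm_nonsquare: "\<exists>x\<in>carrier R. \<exists>y\<in>carrier R. (x \<in> Units R \<or> y \<in> Units R) \<and> nrm D x y \<notin> squares"
proof (rule ccontr)
  assume "\<not> ?thesis"
  then have sq: "nrm D x y \<in> squares" if "x \<in> carrier R" "y \<in> carrier R" "x \<in> Units R \<or> y \<in> Units R" for x y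
    using that by blast
  have "nrm D \<zero> \<one> = D" using D_closed by (simp add: nrm_def)
  then have "D \<in> squares" using sq[of \<zero> \<one>] by simp
  then obtain e where e: "e \<in> fixed_units" "D = e \<otimes> e" unfolding squares_def by blast
  have i: "inv e \<in> fixed" "inv e \<in> carrier R" "circ (inv e) = inv e" "e \<in> carrier R"
    using e fixed_inv[of e] fixedD by auto
  have De: "D \<otimes> (inv e \<otimes> inv e) = \<one>"
  proof -
    have "D \<otimes> (inv e \<otimes> inv e) = (e \<otimes> inv e) \<otimes> (e \<otimes> inv e)" unfolding e(2) using i by algebra
    then show ?thesis using e(1) by simp
  qed
  have all: "[Suc k] \<cdot> \<one> \<in> squares" for k :: nat
  proof (induction k)
    case 0
    have "\<one> \<otimes> \<one> \<in> squares" unfolding squares_def using fixed_one by (intro imageI) simp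
    then show ?case by simp
  next
    case (Suc k)
    then obtain b where b: "b \<in> fixed_units" "[Suc k] \<cdot> \<one> = b \<otimes> b" unfolding squares_def by blast
    have "nrm D b (inv e) = b \<otimes> b \<oplus> \<one>"
      using b fixedD[of b] i De by (simp add: nrm_def)
    moreover have "nrm D b (inv e) \<in> squares" using sq[of b "inv e"] b i fixedD by auto
    moreover have "[Suc (Suc k)] \<cdot> \<one> = [Suc k] \<cdot> \<one> \<oplus> \<one>" by (rule add.nat_pow_Suc)
    ultimately show ?case using b by simp
  qed
  have "[order (add_monoid R)] \<cdot> \<one> = \<zero>" using add.pow_order_eq_1[of \<one>] by simp
  moreover have "order (add_monoid R) > 0" using finite_carrier by (auto simp: order_def card_gt_0_iff)
  ultimately have "\<zero> \<in> squares" using all[of "order (add_monoid R) - 1"] by simp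
  then show False using squares_subset by auto
qed

text \<open>A square \<open>a\<^sup>2\<close> is the norm of \<open>a\<close>, and a product \<open>e a\<^sup>2\<close> with a represented nonsquare \<open>e\<close> is
obtained by scaling the vector that represents \<open>e\<close>.\<close>

lemma nrm_represents:
  assumes s: "s \<in> fixed_units"
  shows "\<exists>x\<in>carrier R. \<exists>y\<in>carrier R. nrm D x y = s"
proof -
  obtain x y where xy: "x \<in> carrier R" "y \<in> carrier R" "x \<in> Units R \<or> y \<in> Units R" "nrm D x y \<notin> squares"
    using nrm_nonsquare by blast
  have e: "nrm D x y \<in> fixed_units" using nrm_fixed_units xy by simp
  consider a where "a \<in> fixed_units" "s = a \<otimes> a" | a where "a \<in> fixed_units" "s = nrm D x y \<otimes> (a \<otimes> a)"
    using squares_index_two[OF e xy(4) s] unfolding squares_def by blast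
  then show ?thesis
  proof cases
    case (1 a)
    then have "nrm D a \<zero> = s" "a \<in> carrier R" using fixedD D_closed by (auto simp: nrm_def)
    then show ?thesis by blast
  next
    case (2 a)
    have a: "a \<in> carrier R" "circ a = a" using 2 fixedD by auto
    have "nrm D (a \<otimes> x) (a \<otimes> y) = a \<otimes> circ x \<otimes> (a \<otimes> x) \<oplus> D \<otimes> (a \<otimes> circ y \<otimes> (a \<otimes> y))"
      using a xy by (simp add: nrm_def)
    also have "\<dots> = nrm D x y \<otimes> (a \<otimes> a)"
      unfolding nrm_def using a(1) xy(1,2) circ_closed[OF xy(1)] circ_closed[OF xy(2)] D_closed by algebra
    finally show ?thesis using 2 a xy by (metis m_closed)
  qed
qed

lemma card_nrm_fibre_one:
  assumes s: "s \<in> fixed_units" shows "card (nrm_fibre D s) = card (nrm_fibre D \<one>)"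
proof (rule antisym)
  have sc: "s \<in> carrier R" "inv s \<in> fixed_units" using s fixed_inv by auto
  obtain x y where xy: "x \<in> carrier R" "y \<in> carrier R" "nrm D x y = s" using nrm_represents[OF s] by blast
  show "card (nrm_fibre D \<one>) \<le> card (nrm_fibre D s)"
    using card_nrm_fibre_le[OF D xy(1,2), of \<one>] xy(3) s sc by simp
  \<comment> \<open>Multiplication by a quaternion of norm \<open>1 / s\<close> maps the fibre over \<open>s\<close> into the fibre over \<open>1\<close>.\<close>
  obtain x y where xy: "x \<in> carrier R" "y \<in> carrier R" "nrm D x y = inv s" using nrm_represents[OF sc(2)] by blast
  show "card (nrm_fibre D s) \<le> card (nrm_fibre D \<one>)"
    using card_nrm_fibre_le[OF D xy(1,2), of s] xy(3) s sc by simp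
qed

text \<open>The pairs with some unit entry are partitioned by their norms, the fixed units, into fibres of
equal size.\<close>

theorem card_nrm_fibre:
  assumes s: "s \<in> fixed_units"
  shows "card fixed_units * card (nrm_fibre D s) + card nonunits * card nonunits = card (carrier R) * card (carrier R)"
proof -
  let ?W = "carrier R \<times> carrier R - nonunits \<times> nonunits"
  have finW: "finite ?W" using finite_carrier by simp
  have W: "(x, y) \<in> ?W \<longleftrightarrow> x \<in> carrier R \<and> y \<in> carrier R \<and> nrm D x y \<in> Units R" for x y
    using anisotropic[of x y] nrm_nonunit[of D x y] D_closed by blast
  have im: "(\<lambda>(x, y). nrm D x y) ` ?W \<subseteq> fixed_units" using W nrm_fixed[OF D] by auto
  have "card ?W = (\<Sum>r\<in>fixed_units. card {p \<in> ?W. (\<lambda>(x, y). nrm D x y) p = r})"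
    using sum.group[OF finW _ im, of "\<lambda>_. 1::nat"] finite_fixed by simp
  also have "\<dots> = (\<Sum>r\<in>fixed_units. card (nrm_fibre D \<one>))"
  proof (rule sum.cong[OF refl])
    fix r assume r: "r \<in> fixed_units"
    have "{p \<in> ?W. (\<lambda>(x, y). nrm D x y) p = r} = nrm_fibre D r"
      using W r by (auto simp: nrm_fibre_def)
    then show "card {p \<in> ?W. (\<lambda>(x, y). nrm D x y) p = r} = card (nrm_fibre D \<one>)"
      using card_nrm_fibre_one[OF r] by simp
  qed
  finally have 1: "card ?W = card fixed_units * card (nrm_fibre D s)" using card_nrm_fibre_one[OF s] by simp
  have "card (carrier R \<times> carrier R) = card ?W + card (nonunits \<times> nonunits)"
    using card_Diff_subset[of "nonunits \<times> nonunits" "carrier R \<times> carrier R"]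
      card_mono[of "carrier R \<times> carrier R" "nonunits \<times> nonunits"] finite_carrier
    by (simp add: Sigma_mono)
  then show ?thesis using 1 by (simp add: card_cartesian_product)
qed

end

end

section \<open>Hermitian planes\<close>

text \<open>Non-degeneracy is expressed by a generating pair of vectors with unit Gram determinant; such a
pair is automatically a basis.\<close>

locale hermitian_plane = involutive_local_ring R circ + hermitian_form R M circ h
  for R :: "('a, 'm) ring_scheme" (structure) and circ and M :: "('a, 'v, 'n) module_scheme" (structure) and h +
  fixes e1 e2 :: 'v
  assumes e_closed: "e1 \<in> carrier M" "e2 \<in> carrier M"
    and e_span: "x \<in> carrier M \<Longrightarrow> \<exists>a\<in>carrier R. \<exists>b\<in>carrier R. x = a \<odot>\<^bsub>M\<^esub> e1 \<oplus>\<^bsub>M\<^esub> b \<odot>\<^bsub>M\<^esub> e2"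
    and e_gram: "h e1 e1 \<otimes> h e2 e2 \<ominus> h e1 e2 \<otimes> h e2 e1 \<in> Units R"
begin

definition comb where "comb u v a b = a \<odot>\<^bsub>M\<^esub> u \<oplus>\<^bsub>M\<^esub> b \<odot>\<^bsub>M\<^esub> v"
definition gram where "gram u v = h u u \<otimes> h v v \<ominus> h u v \<otimes> h v u"
definition unimodular where "unimodular u \<longleftrightarrow> u \<in> carrier M \<and> (\<exists>v\<in>carrier M. h u v = \<one>)"

declare form_closed [simp, intro]

lemma comb_closed [simp, intro]:
  "\<lbrakk>u \<in> carrier M; v \<in> carrier M; a \<in> carrier R; b \<in> carrier R\<rbrakk> \<Longrightarrow> comb u v a b \<in> carrier M"
  by (simp add: comb_def)

lemma form_swap: "\<lbrakk>x \<in> carrier M; y \<in> carrier M\<rbrakk> \<Longrightarrow> circ (h x y) = h y x"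
  by (rule form_hermitian[symmetric])

lemma form_fixed: "x \<in> carrier M \<Longrightarrow> h x x \<in> fixed"
  by (simp add: fixed_ring_def form_swap)

lemma form_smult_left:
  "\<lbrakk>a \<in> carrier R; x \<in> carrier M; y \<in> carrier M\<rbrakk> \<Longrightarrow> h (a \<odot>\<^bsub>M\<^esub> x) y = circ a \<otimes> h x y"
  by (metis circ_mult form_closed form_hermitian form_smult_right smult_closed)

lemma form_comb_right:
  assumes "u \<in> carrier M" "v \<in> carrier M" "a \<in> carrier R" "b \<in> carrier R" "x \<in> carrier M"
  shows "h x (comb u v a b) = a \<otimes> h x u \<oplus> b \<otimes> h x v"
  using assms by (simp add: comb_def form_add_right form_smult_right)

lemma form_comb_left:
  assumes "u \<in> carrier M" "v \<in> carrier M" "a \<in> carrier R" "b \<in> carrier R" "x \<in> carrier M"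
  shows "h (comb u v a b) x = circ a \<otimes> h u x \<oplus> circ b \<otimes> h v x"
  using assms by (simp add: comb_def form_add_left form_smult_left)

lemma gram_closed [simp]: "\<lbrakk>u \<in> carrier M; v \<in> carrier M\<rbrakk> \<Longrightarrow> gram u v \<in> carrier R"
  by (simp add: gram_def)

lemma gram_fixed: "\<lbrakk>u \<in> carrier M; v \<in> carrier M\<rbrakk> \<Longrightarrow> gram u v \<in> fixed"
  by (simp add: gram_def fixed_ring_def form_swap m_comm)

text \<open>Cramer's rule recovers the coordinates of a vector from its pairings with \<open>u\<close> and \<open>v\<close>.\<close>

lemma cramer:
  assumes c: "u \<in> carrier M" "v \<in> carrier M" "a \<in> carrier R" "b \<in> carrier R"
  shows "gram u v \<otimes> a = h v v \<otimes> h u (comb u v a b) \<ominus> h u v \<otimes> h v (comb u v a b)"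
    and "gram u v \<otimes> b = h u u \<otimes> h v (comb u v a b) \<ominus> h v u \<otimes> h u (comb u v a b)"
proof -
  have cl: "h u u \<in> carrier R" "h u v \<in> carrier R" "h v u \<in> carrier R" "h v v \<in> carrier R"
    using c by auto
  show "gram u v \<otimes> a = h v v \<otimes> h u (comb u v a b) \<ominus> h u v \<otimes> h v (comb u v a b)"
    unfolding form_comb_right[OF c c(1)] form_comb_right[OF c c(2)] gram_def using cl c(3,4) by algebra
  show "gram u v \<otimes> b = h u u \<otimes> h v (comb u v a b) \<ominus> h v u \<otimes> h u (comb u v a b)"
    unfolding form_comb_right[OF c c(1)] form_comb_right[OF c c(2)] gram_def using cl c(3,4) by algebra
qed

lemma comb_inject:
  assumes g: "gram u v \<in> Units R" and uv: "u \<in> carrier M" "v \<in> carrier M"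
    and ab: "a \<in> carrier R" "b \<in> carrier R" and cd: "c \<in> carrier R" "d \<in> carrier R"
    and eq: "comb u v a b = comb u v c d"
  shows "a = c \<and> b = d"
  using cramer[OF uv ab] cramer[OF uv cd] eq unit_cancel[OF g] ab cd by metis

lemma inj_comb:
  assumes "gram u v \<in> Units R" "u \<in> carrier M" "v \<in> carrier M"
  shows "inj_on (\<lambda>(a, b). comb u v a b) (carrier R \<times> carrier R)"
  using comb_inject[OF assms] by (auto intro!: inj_onI)

lemma bij_comb_e: "bij_betw (\<lambda>(a, b). comb e1 e2 a b) (carrier R \<times> carrier R) (carrier M)"
proof -
  have "(\<lambda>(a, b). comb e1 e2 a b) ` (carrier R \<times> carrier R) = carrier M"
    using e_span e_closed by (force simp: comb_def image_iff)
  then show ?thesis using inj_comb[of e1 e2] e_gram e_closed by (simp add: bij_betw_def gram_def)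
qed

text \<open>Coordinates are unique by Cramer's rule.  Since the generating pair shows that the module has
\<open>|R|\<^sup>2\<close> elements, a pair with unit Gram determinant also generates.\<close>

lemma bij_comb:
  assumes "gram u v \<in> Units R" "u \<in> carrier M" "v \<in> carrier M"
  shows "bij_betw (\<lambda>(a, b). comb u v a b) (carrier R \<times> carrier R) (carrier M)"
proof -
  let ?p = "\<lambda>(a, b). comb u v a b"
  have fin: "finite (carrier M)" 
    using bij_betw_finite[OF bij_comb_e] finite_carrier by auto
  have "card (?p ` (carrier R \<times> carrier R)) = card (carrier M)"
    using card_image[OF inj_comb[OF assms]] bij_betw_same_card[OF bij_comb_e] by simp
  moreover have "?p ` (carrier R \<times> carrier R) \<subseteq> carrier M" using assms by auto
  ultimately have "?p ` (carrier R \<times> carrier R) = carrier M"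
    using fin by (simp add: card_subset_eq)
  then show ?thesis using inj_comb[OF assms] by (simp add: bij_betw_def)
qed

lemma comb_cases:
  assumes "gram u v \<in> Units R" "u \<in> carrier M" "v \<in> carrier M" "x \<in> carrier M"
  obtains a b where "a \<in> carrier R" "b \<in> carrier R" "x = comb u v a b"
proof -
  have "x \<in> (\<lambda>(a, b). comb u v a b) ` (carrier R \<times> carrier R)"
    using bij_betw_imp_surj_on[OF bij_comb[OF assms(1-3)]] assms(4) by simp
  then show thesis using that by (elim imageE SigmaE) simp
qed

lemma unimodularI: "\<lbrakk>u \<in> carrier M; v \<in> carrier M; h u v \<in> Units R\<rbrakk> \<Longrightarrow> unimodular u"
  unfolding unimodular_def
  by (intro conjI bexI[of _ "inv (h u v) \<odot>\<^bsub>M\<^esub> v"]) (auto simp: form_smult_right)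

lemma gram_imp_primitive:
  assumes g: "gram u v \<in> Units R" and uv: "u \<in> carrier M" "v \<in> carrier M"
  shows "primitive R M u"
proof -
  have ne: "u \<noteq> v"
  proof
    assume "u = v"
    then have "gram u v = \<zero>" using uv by (simp add: gram_def r_right_minus_eq)
    then show False using g by simp
  qed
  have fs: "(\<Oplus>\<^bsub>M\<^esub> s\<in>{u, v}. c s \<odot>\<^bsub>M\<^esub> s) = comb u v (c u) (c v)" if "c \<in> {u, v} \<rightarrow>\<^sub>E carrier R" for c
  proof -
    have c: "c u \<in> carrier R" "c v \<in> carrier R" using that by auto
    show ?thesis using ne uv c by (simp add: comb_def M.finsum_insert)
  qed
  have "\<exists>!c. c \<in> {u, v} \<rightarrow>\<^sub>E carrier R \<and> x = (\<Oplus>\<^bsub>M\<^esub> s\<in>{u, v}. c s \<odot>\<^bsub>M\<^esub> s)" if x: "x \<in> carrier M" for x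
  proof -
    obtain a b where ab: "a \<in> carrier R" "b \<in> carrier R" "x = comb u v a b"
      using comb_cases[OF g uv x] .
    show ?thesis
    proof (rule ex1I)
      let ?c = "\<lambda>s\<in>{u, v}. if s = u then a else b"
      have "?c \<in> {u, v} \<rightarrow>\<^sub>E carrier R" using ab by auto
      then show "?c \<in> {u, v} \<rightarrow>\<^sub>E carrier R \<and> x = (\<Oplus>\<^bsub>M\<^esub> s\<in>{u, v}. ?c s \<odot>\<^bsub>M\<^esub> s)"
        using fs[of ?c] ab ne by simp
    next
      fix c assume c: "c \<in> {u, v} \<rightarrow>\<^sub>E carrier R \<and> x = (\<Oplus>\<^bsub>M\<^esub> s\<in>{u, v}. c s \<odot>\<^bsub>M\<^esub> s)"
      then have "comb u v (c u) (c v) = comb u v a b" using fs ab by simp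
      then have "c u = a \<and> c v = b" using comb_inject[OF g uv] ab c by blast
      then show "c = (\<lambda>s\<in>{u, v}. if s = u then a else b)"
        using c by (intro ext) (auto simp: PiE_def extensional_def)
    qed
  qed
  then have "finite_basis R M {u, v}" unfolding finite_basis_def using uv by simp
  then show ?thesis unfolding primitive_def by blast
qed

lemma primitive_torsion_free:
  assumes u: "primitive R M u" and z: "z \<in> carrier R" "z \<odot>\<^bsub>M\<^esub> u = \<zero>\<^bsub>M\<^esub>"
  shows "z = \<zero>"
proof -
  obtain S where S: "finite_basis R M S" "u \<in> S" using u unfolding primitive_def by blast
  have fin: "finite S" "S \<subseteq> carrier M"
    and ex1: "\<And>x. x \<in> carrier M \<Longrightarrow> \<exists>!c. c \<in> S \<rightarrow>\<^sub>E carrier R \<and> x = (\<Oplus>\<^bsub>M\<^esub> s\<in>S. c s \<odot>\<^bsub>M\<^esub> s)"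
    using S(1) unfolding finite_basis_def by auto
  let ?c = "\<lambda>y. \<lambda>s\<in>S. if s = u then y else \<zero>"
  have *: "?c y \<in> S \<rightarrow>\<^sub>E carrier R \<and> \<zero>\<^bsub>M\<^esub> = (\<Oplus>\<^bsub>M\<^esub> s\<in>S. ?c y s \<odot>\<^bsub>M\<^esub> s)"
    if y: "y \<in> carrier R" "y \<odot>\<^bsub>M\<^esub> u = \<zero>\<^bsub>M\<^esub>" for y
  proof -
    have "(\<Oplus>\<^bsub>M\<^esub> s\<in>S. ?c y s \<odot>\<^bsub>M\<^esub> s) = (\<Oplus>\<^bsub>M\<^esub> s\<in>S. \<zero>\<^bsub>M\<^esub>)"
      by (rule M.finsum_cong') (use y fin(2) in \<open>auto simp: smult_l_null\<close>)
    then show ?thesis using y by auto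
  qed
  have "?c z = ?c \<zero>" using ex1[of "\<zero>\<^bsub>M\<^esub>"] *[of z] *[of \<zero>] z fin S(2) by (auto simp: subset_iff)
  then have "?c z u = ?c \<zero> u" by (rule fun_cong)
  then show ?thesis using S(2) by simp
qed

text \<open>If \<open>u\<close> paired with \<open>e1\<close> and \<open>e2\<close> to nonunits only, a socle element \<open>z\<close> would kill both values;
then \<open>z u = 0\<close> by Cramer's rule, which is impossible for a member of a basis.\<close>

lemma primitive_imp_unimodular:
  assumes u: "primitive R M u" shows "unimodular u"
proof -
  have uc: "u \<in> carrier M" using u unfolding primitive_def finite_basis_def by auto
  have "h u e1 \<in> Units R \<or> h u e2 \<in> Units R"
  proof (rule ccontr)
    assume "\<not> ?thesis"
    then have n: "h e1 u \<in> nonunits" "h e2 u \<in> nonunits"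
      using circ_unit_iff[of "h u e1"] circ_unit_iff[of "h u e2"] uc e_closed by (auto simp: form_swap)
    obtain z where z: "z \<in> carrier R" "z \<noteq> \<zero>" "\<forall>x\<in>nonunits. z \<otimes> x = \<zero>" using socle by blast
    have zu: "z \<odot>\<^bsub>M\<^esub> u \<in> carrier M" using z uc by simp
    have h0: "h e1 (z \<odot>\<^bsub>M\<^esub> u) = \<zero>" "h e2 (z \<odot>\<^bsub>M\<^esub> u) = \<zero>"
      using n z e_closed uc by (auto simp: form_smult_right)
    have g: "gram e1 e2 \<in> Units R" using e_gram by (simp add: gram_def)
    obtain a b where ab: "a \<in> carrier R" "b \<in> carrier R" "z \<odot>\<^bsub>M\<^esub> u = comb e1 e2 a b"
      using comb_cases[OF g e_closed zu] .
    have "gram e1 e2 \<otimes> a = \<zero>" "gram e1 e2 \<otimes> b = \<zero>"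
      using cramer[OF e_closed ab(1,2)] h0 ab(3) e_closed by (auto simp: r_right_minus_eq)
    then have "a = \<zero>" "b = \<zero>"
      using unit_cancel[OF g ab(1) R.zero_closed] unit_cancel[OF g ab(2) R.zero_closed] Units_closed[OF g] by simp_all
    then have "z \<odot>\<^bsub>M\<^esub> u = \<zero>\<^bsub>M\<^esub>" using ab(3) e_closed by (simp add: comb_def)
    then show False using primitive_torsion_free[OF u] z by blast
  qed
  then show ?thesis using unimodularI uc e_closed by blast
qed

text \<open>Start from \<open>v\<close> with \<open>h u v = 1\<close>.  For fixed \<open>c\<close> the vector \<open>v + c u\<close> has norm
\<open>h v v + 2 c + c\<^sup>2 h u u\<close>, which vanishes for a suitable \<open>c\<close>; its pairing with \<open>u\<close> is the unit
\<open>1 + c h u u\<close>, which is scaled away.\<close>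

lemma hyperbolic_partner:
  assumes u: "unimodular u" and t: "h u u \<notin> Units R"
  obtains w where "w \<in> carrier M" "h w w = \<zero>" "h u w = \<one>"
proof -
  obtain v where v: "u \<in> carrier M" "v \<in> carrier M" "h u v = \<one>" using u by (auto simp: unimodular_def)
  have vu: "h v u = \<one>" using form_swap[OF v(1,2)] v(3) by simp
  obtain c where c: "c \<in> fixed" "h v v \<oplus> ((c \<oplus> c) \<oplus> c \<otimes> c \<otimes> h u u) = \<zero>"
    using solve_quadratic[OF form_fixed[OF v(2)] form_fixed[OF v(1)] t] by blast
  have cc: "c \<in> carrier R" "circ c = c" using c fixedD by auto
  let ?w = "comb v u \<one> c" and ?e = "\<one> \<oplus> c \<otimes> h u u"
  have w: "?w \<in> carrier M" using v cc by simp
  have hh: "h u u \<in> carrier R" "h v v \<in> carrier R" using v by auto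
  have "h ?w ?w = h v v \<oplus> ((c \<oplus> c) \<oplus> c \<otimes> c \<otimes> h u u)"
  proof -
    have "h ?w ?w = \<one> \<otimes> (\<one> \<otimes> h v v \<oplus> c \<otimes> \<one>) \<oplus> c \<otimes> (\<one> \<otimes> \<one> \<oplus> c \<otimes> h u u)"
      using v vu cc by (simp add: form_comb_right form_comb_left R.a_ac)
    also have "\<dots> = h v v \<oplus> ((c \<oplus> c) \<oplus> c \<otimes> c \<otimes> h u u)" using hh cc(1) by algebra
    finally show ?thesis .
  qed
  then have ww: "h ?w ?w = \<zero>" using c by simp
  have uw: "h u ?w = ?e" using v cc by (simp add: form_comb_right)
  have e: "?e \<in> Units R"
    using unit_add_nonunit[OF Units_one_closed, of "c \<otimes> h u u"] nonunit_mult[of "h u u" c] t hh cc m_comm by (metis DiffI)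
  have ie: "inv ?e \<in> carrier R" using e by simp
  have "h (inv ?e \<odot>\<^bsub>M\<^esub> ?w) (inv ?e \<odot>\<^bsub>M\<^esub> ?w) = \<zero>"
    using ww w ie by (simp add: form_smult_left form_smult_right)
  moreover have "h u (inv ?e \<odot>\<^bsub>M\<^esub> ?w) = \<one>"
    using uw w ie e v by (simp add: form_smult_right)
  ultimately show ?thesis using that w ie by (meson smult_closed)
qed

text \<open>This is where isotropy is reduced to the residue field: by the existence of hyperbolic partners
a vector whose norm merely lies in the maximal ideal already yields an isotropic one.\<close>

lemma isotropic_iff:
  "isotropic R M h \<longleftrightarrow> (\<exists>u. unimodular u \<and> h u u \<notin> Units R)"
proof
  assume "isotropic R M h"
  then show "\<exists>u. unimodular u \<and> h u u \<notin> Units R"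
    unfolding isotropic_def using primitive_imp_unimodular zero_nonunit by metis
next
  assume "\<exists>u. unimodular u \<and> h u u \<notin> Units R"
  then obtain u where u: "unimodular u" "h u u \<notin> Units R" by blast
  obtain w where w: "w \<in> carrier M" "h w w = \<zero>" "h u w = \<one>" using hyperbolic_partner[OF u] .
  have uc: "u \<in> carrier M" using u by (simp add: unimodular_def)
  have "h w u = \<one>" using form_swap[OF uc w(1)] w(3) by simp
  then have "gram w u = \<zero> \<otimes> h u u \<ominus> \<one> \<otimes> \<one>" by (simp only: gram_def w)
  also have "\<dots> = \<ominus> \<one>" using form_closed[OF uc uc] by algebra
  finally have "gram w u \<in> Units R" using unit_minus[OF Units_one_closed] by simp
  then have "primitive R M w" using gram_imp_primitive[of w u] w uc by simp
  then show "isotropic R M h" using w by (auto simp: isotropic_def)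
qed

text \<open>The vector \<open>- (h u e2) e1 + (h u e1) e2\<close> is orthogonal to \<open>u\<close>.  In coordinates its norm is that of the
row vector \<open>u\<^sup>* G\<close> for the adjugate of the Gram matrix \<open>G\<close>, that is \<open>det G\<close> times the norm of \<open>u\<close>.
It is important that the norm of this partner depends only on \<open>h u u\<close>.\<close>

lemma orthogonal_partner:
  assumes u: "u \<in> carrier M"
  obtains v where "v \<in> carrier M" "h u v = \<zero>" "h v v = h u u \<otimes> gram e1 e2"
proof -
  let ?v = "comb e1 e2 (\<ominus> h u e2) (h u e1)"
  have g: "gram e1 e2 \<in> Units R" using e_gram by (simp add: gram_def)
  obtain x y where xy: "x \<in> carrier R" "y \<in> carrier R" "u = comb e1 e2 x y"
    using comb_cases[OF g e_closed u] .
  have v: "?v \<in> carrier M" using u e_closed by simp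
  have cl: "h e1 e1 \<in> carrier R" "h e1 e2 \<in> carrier R" "h e2 e1 \<in> carrier R" "h e2 e2 \<in> carrier R"
    "h u e1 \<in> carrier R" "h u e2 \<in> carrier R" "circ x \<in> carrier R" "circ y \<in> carrier R"
    "h e1 u \<in> carrier R" "h e2 u \<in> carrier R"
    using u xy e_closed by auto
  have "h u ?v = (\<ominus> h u e2) \<otimes> h u e1 \<oplus> h u e1 \<otimes> h u e2"
    using u e_closed by (simp add: form_comb_right)
  also have "\<dots> = \<zero>" using cl by algebra
  finally have 1: "h u ?v = \<zero>" .
  have ue: "h u e1 = circ x \<otimes> h e1 e1 \<oplus> circ y \<otimes> h e2 e1" "h u e2 = circ x \<otimes> h e1 e2 \<oplus> circ y \<otimes> h e2 e2"
    unfolding xy(3) using xy(1,2) e_closed by (simp_all add: form_comb_left)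
  have uu: "h u u = circ x \<otimes> h e1 u \<oplus> circ y \<otimes> h e2 u"
    using form_comb_left[OF e_closed xy(1,2) u] xy(3) by simp
  \<comment> \<open>Rows of \<open>G\<close> times its adjugate.\<close>
  have adj: "(\<ominus> h u e2) \<otimes> h e1 e1 \<oplus> h u e1 \<otimes> h e1 e2 = \<ominus> (circ y \<otimes> gram e1 e2)"
    "(\<ominus> h u e2) \<otimes> h e2 e1 \<oplus> h u e1 \<otimes> h e2 e2 = circ x \<otimes> gram e1 e2"
    unfolding ue gram_def using cl(1-4,7,8) by algebra+
  have "h ?v ?v = (\<ominus> h e2 u) \<otimes> ((\<ominus> h u e2) \<otimes> h e1 e1 \<oplus> h u e1 \<otimes> h e1 e2)
                 \<oplus> h e1 u \<otimes> ((\<ominus> h u e2) \<otimes> h e2 e1 \<oplus> h u e1 \<otimes> h e2 e2)"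
    using form_comb_left[OF e_closed, of "\<ominus> h u e2" "h u e1" ?v] e_closed u v
    by (simp add: form_comb_right form_swap)
  also have "\<dots> = h u u \<otimes> gram e1 e2"
    unfolding adj uu using cl(7-10) gram_closed[OF e_closed] by algebra
  finally have 2: "h ?v ?v = h u u \<otimes> gram e1 e2" .
  show ?thesis using that[OF v 1 2] .
qed

end

section \<open>The unitary group of a hermitian plane and its orbits\<close>

context hermitian_plane
begin

abbreviation UG where "UG \<equiv> unitary_group R M h"

abbreviation stab_index where "stab_index u \<equiv> card (rcosets\<^bsub>UG\<^esub> (stabilizer UG (\<lambda>g. g) u))"

lemma unitary_carrier:
  "g \<in> carrier UG \<longleftrightarrow> g \<in> Bij (carrier M) \<and> g \<in> linear_maps R M M
     \<and> (\<forall>x\<in>carrier M. \<forall>y\<in>carrier M. h (g x) (g y) = h x y)"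
  by (auto simp: unitary_group_def)

lemma unitary_add: "\<lbrakk>g \<in> carrier UG; x \<in> carrier M; y \<in> carrier M\<rbrakk> \<Longrightarrow> g (x \<oplus>\<^bsub>M\<^esub> y) = g x \<oplus>\<^bsub>M\<^esub> g y"
  and unitary_smult: "\<lbrakk>g \<in> carrier UG; a \<in> carrier R; x \<in> carrier M\<rbrakk> \<Longrightarrow> g (a \<odot>\<^bsub>M\<^esub> x) = a \<odot>\<^bsub>M\<^esub> g x"
  and unitary_closed: "\<lbrakk>g \<in> carrier UG; x \<in> carrier M\<rbrakk> \<Longrightarrow> g x \<in> carrier M"
  and unitary_form: "\<lbrakk>g \<in> carrier UG; x \<in> carrier M; y \<in> carrier M\<rbrakk> \<Longrightarrow> h (g x) (g y) = h x y"
  by (auto simp: unitary_carrier linear_maps_def)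

lemma unitary_subgroup: "subgroup (carrier UG) (BijGroup (carrier M))"
proof
  show "carrier UG \<subseteq> carrier (BijGroup (carrier M))"
    by (auto simp: unitary_carrier BijGroup_def)
next
  fix f g assume f: "f \<in> carrier UG" and g: "g \<in> carrier UG"
  have B: "f \<in> Bij (carrier M)" "g \<in> Bij (carrier M)" using f g by (auto simp: unitary_carrier)
  have eq: "f \<otimes>\<^bsub>BijGroup (carrier M)\<^esub> g = compose (carrier M) f g" using B by (simp add: BijGroup_def)
  have "compose (carrier M) f g \<in> linear_maps R M M"
    unfolding linear_maps_def
    using f g by (auto simp: compose_eq unitary_add unitary_smult unitary_closed compose_def)
  then show "f \<otimes>\<^bsub>BijGroup (carrier M)\<^esub> g \<in> carrier UG"
    unfolding eq unitary_carrier using compose_Bij[OF B] f g by (simp add: compose_eq unitary_form unitary_closed)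
next
  show "\<one>\<^bsub>BijGroup (carrier M)\<^esub> \<in> carrier UG"
    unfolding unitary_carrier by (auto simp: BijGroup_def id_Bij linear_maps_def)
next
  fix g assume g: "g \<in> carrier UG"
  have B: "g \<in> Bij (carrier M)" using g by (simp add: unitary_carrier)
  let ?i = "\<lambda>x\<in>carrier M. inv_into (carrier M) g x"
  have eq: "inv\<^bsub>BijGroup (carrier M)\<^esub> g = ?i" using B by (rule inv_BijGroup)
  have bij: "bij_betw g (carrier M) (carrier M)" using B by (simp add: Bij_def)
  have gi: "g (?i x) = x" and ic: "?i x \<in> carrier M" if "x \<in> carrier M" for x
    using that bij by (auto simp: bij_betw_def f_inv_into_f inv_into_into)
  have ig: "?i (g x) = x" if "x \<in> carrier M" for x
    using that bij by (auto simp: bij_betw_def)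
  have add: "?i (x \<oplus>\<^bsub>M\<^esub> y) = ?i x \<oplus>\<^bsub>M\<^esub> ?i y" if "x \<in> carrier M" "y \<in> carrier M" for x y
    using ig[of "?i x \<oplus>\<^bsub>M\<^esub> ?i y"] unitary_add[OF g ic[OF that(1)] ic[OF that(2)]]
      gi[OF that(1)] gi[OF that(2)] ic[OF that(1)] ic[OF that(2)] by (metis M.add.m_closed)
  have sm: "?i (a \<odot>\<^bsub>M\<^esub> x) = a \<odot>\<^bsub>M\<^esub> ?i x" if "a \<in> carrier R" "x \<in> carrier M" for a x
    using ig[of "a \<odot>\<^bsub>M\<^esub> ?i x"] unitary_smult[OF g that(1) ic[OF that(2)]] gi[OF that(2)] ic[OF that(2)] that(1)
    by (metis smult_closed)
  have "?i \<in> linear_maps R M M"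
    unfolding linear_maps_def using add sm restrict_PiE_iff[of "inv_into (carrier M) g" "carrier M" "\<lambda>_. carrier M"] ic
    by (auto simp del: restrict_apply simp: restrict_apply')
  moreover have "h (?i x) (?i y) = h x y" if "x \<in> carrier M" "y \<in> carrier M" for x y
    using unitary_form[OF g ic[OF that(1)] ic[OF that(2)]] gi[OF that(1)] gi[OF that(2)] by metis
  ultimately show "inv\<^bsub>BijGroup (carrier M)\<^esub> g \<in> carrier UG"
    unfolding eq unitary_carrier using restrict_inv_into_Bij[OF B] by blast
qed

lemma unitary_action: "group_action UG (carrier M) (\<lambda>g. g)"
proof -
  have UG: "UG = BijGroup (carrier M)\<lparr>carrier := carrier UG\<rparr>"
    by (simp add: unitary_group_def)
  have "group UG"
    using subgroup.subgroup_is_group[OF unitary_subgroup group_BijGroup] UG by simp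
  moreover have "(\<lambda>g. g) \<in> hom UG (BijGroup (carrier M))"
    using subgroup.subset[OF unitary_subgroup] unfolding hom_def
    by (auto simp: unitary_group_def)
  ultimately show ?thesis
    by (intro group_action.intro group_hom.intro group_hom_axioms.intro group_BijGroup)
qed

text \<open>The linear map that sends one basis to the other preserves the form.\<close>

lemma equal_gram_conjugate:
  assumes g: "gram u u' \<in> Units R" and u: "u \<in> carrier M" "u' \<in> carrier M"
    and w: "w \<in> carrier M" "w' \<in> carrier M"
    and eq: "h w w = h u u" "h w w' = h u u'" "h w' w' = h u' u'"
  shows "\<exists>k\<in>carrier UG. k u = w"
proof -
  have eq': "h w' w = h u' u" using form_swap[OF u] form_swap[OF w] eq(2) by simp
  have g': "gram w w' \<in> Units R" using g eq eq' by (simp add: gram_def)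
  let ?P = "\<lambda>(a, b). comb u u' a b" and ?Q = "\<lambda>(a, b). comb w w' a b"
  let ?C = "carrier R \<times> carrier R"
  have bu: "bij_betw ?P ?C (carrier M)" and bw: "bij_betw ?Q ?C (carrier M)"
    using bij_comb[OF g u] bij_comb[OF g' w] by auto
  define k where "k = (\<lambda>x\<in>carrier M. ?Q (inv_into ?C ?P x))"
  have kc: "k (comb u u' a b) = comb w w' a b" if "a \<in> carrier R" "b \<in> carrier R" for a b
  proof -
    have "inv_into ?C ?P (?P (a, b)) = (a, b)"
      using bu that by (intro inv_into_f_f) (auto simp: bij_betw_def)
    then show ?thesis using that u by (simp add: k_def)
  qed
  have "bij_betw (?Q \<circ> inv_into ?C ?P) (carrier M) (carrier M)"
    using bij_betw_trans[OF bij_betw_inv_into[OF bu] bw] .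
  then have "bij_betw k (carrier M) (carrier M)"
    by (rule iffD1[OF bij_betw_cong, rotated]) (simp add: k_def)
  then have kB: "k \<in> Bij (carrier M)" by (simp add: Bij_def k_def)
  have kcl: "k \<in> carrier M \<rightarrow>\<^sub>E carrier M" using kB
    by (auto simp: Bij_def bij_betw_def PiE_def)
  have add: "k (x \<oplus>\<^bsub>M\<^esub> y) = k x \<oplus>\<^bsub>M\<^esub> k y" and form: "h (k x) (k y) = h x y"
    if xy: "x \<in> carrier M" "y \<in> carrier M" for x y
  proof -
    obtain a b where ab: "a \<in> carrier R" "b \<in> carrier R" "x = comb u u' a b" using comb_cases[OF g u xy(1)] .
    obtain c d where cd: "c \<in> carrier R" "d \<in> carrier R" "y = comb u u' c d" using comb_cases[OF g u xy(2)] .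
    have s: "comb z z' a b \<oplus>\<^bsub>M\<^esub> comb z z' c d = comb z z' (a \<oplus> c) (b \<oplus> d)"
      if "z \<in> carrier M" "z' \<in> carrier M" for z z'
      using that ab(1,2) cd(1,2) by (simp add: comb_def smult_l_distr M.a_ac)
    show "k (x \<oplus>\<^bsub>M\<^esub> y) = k x \<oplus>\<^bsub>M\<^esub> k y"
      unfolding ab(3) cd(3) s[OF u] using kc ab(1,2) cd(1,2) s[OF w] by simp
    show "h (k x) (k y) = h x y"
      unfolding ab(3) cd(3) kc[OF ab(1,2)] kc[OF cd(1,2)]
      using ab(1,2) cd(1,2) u w eq eq' by (simp add: form_comb_left form_comb_right)
  qed
  have sm: "k (r \<odot>\<^bsub>M\<^esub> x) = r \<odot>\<^bsub>M\<^esub> k x" if x: "x \<in> carrier M" and r: "r \<in> carrier R" for x r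
  proof -
    obtain a b where ab: "a \<in> carrier R" "b \<in> carrier R" "x = comb u u' a b" using comb_cases[OF g u x] .
    have s: "r \<odot>\<^bsub>M\<^esub> comb z z' a b = comb z z' (r \<otimes> a) (r \<otimes> b)"
      if "z \<in> carrier M" "z' \<in> carrier M" for z z'
      using that ab(1,2) r by (simp add: comb_def smult_r_distr smult_assoc1)
    show ?thesis unfolding ab(3) s[OF u] using kc ab(1,2) r s[OF w] by simp
  qed
  have "k \<in> carrier UG" unfolding unitary_carrier linear_maps_def using kB kcl add sm form by blast
  moreover have "comb u u' \<one> \<zero> = u" "comb w w' \<one> \<zero> = w" using u w by (simp_all add: comb_def)
  then have "k u = w" using kc[OF R.one_closed R.zero_closed] by metis
  ultimately show ?thesis by blast
qed

text \<open>Both \<open>u\<close> and \<open>w\<close> are completed to a basis whose Gram matrix depends only on the common norm,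
by an orthogonal partner if that norm is a unit and by a hyperbolic partner otherwise.\<close>

lemma unitary_transitive:
  assumes u: "unimodular u" and w: "unimodular w" and t: "h w w = h u u"
  shows "\<exists>k\<in>carrier UG. k u = w"
proof (cases "h u u \<in> Units R")
  case True
  have c: "u \<in> carrier M" "w \<in> carrier M" using u w by (auto simp: unimodular_def)
  obtain u' where u': "u' \<in> carrier M" "h u u' = \<zero>" "h u' u' = h u u \<otimes> gram e1 e2"
    using orthogonal_partner[OF c(1)] .
  obtain w' where w': "w' \<in> carrier M" "h w w' = \<zero>" "h w' w' = h w w \<otimes> gram e1 e2"
    using orthogonal_partner[OF c(2)] .
  have "gram u u' = h u u \<otimes> (h u u \<otimes> gram e1 e2)"
    using u' c by (simp add: gram_def R.minus_eq e_closed)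
  moreover have "gram e1 e2 \<in> Units R" using e_gram by (simp add: gram_def)
  ultimately have "gram u u' \<in> Units R" using True by simp
  then show ?thesis using equal_gram_conjugate[of u u' w w'] c u' w' t by simp
next
  case False
  have c: "u \<in> carrier M" "w \<in> carrier M" using u w by (auto simp: unimodular_def)
  obtain u' where u': "u' \<in> carrier M" "h u' u' = \<zero>" "h u u' = \<one>"
    using hyperbolic_partner[OF u False] .
  obtain w' where w': "w' \<in> carrier M" "h w' w' = \<zero>" "h w w' = \<one>"
    using hyperbolic_partner[OF w] False t by metis
  have "h u' u = \<one>" using form_swap[OF c(1) u'(1)] u'(3) by simp
  then have "gram u u' = h u u \<otimes> \<zero> \<ominus> \<one> \<otimes> \<one>" by (simp only: gram_def u')
  also have "\<dots> = \<ominus> \<one>" using form_closed[OF c(1) c(1)] by algebra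
  finally have "gram u u' \<in> Units R" using unit_minus[OF Units_one_closed] by simp
  then show ?thesis using equal_gram_conjugate[of u u' w w'] c u' w' t by simp
qed

lemma unitary_unimodular:
  assumes "k \<in> carrier UG" "unimodular u" shows "unimodular (k u)"
  using assms unitary_form[OF assms(1)] unitary_closed[OF assms(1)] unfolding unimodular_def by metis

theorem stabilizer_index:
  assumes u: "unimodular u"
  shows "stab_index u = card {w. unimodular w \<and> h w w = h u u}"
proof -
  have uc: "u \<in> carrier M" using u by (simp add: unimodular_def)
  have "orbit UG (\<lambda>g. g) u = {w. unimodular w \<and> h w w = h u u}"
    unfolding orbit_def
    using unitary_transitive[OF u] unitary_unimodular[OF _ u] unitary_form[OF _ uc uc] by auto
  then show ?thesis
    using bij_betw_same_card[OF group_action.orbit_stab_fun_is_bij[OF unitary_action uc]] by simp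
qed

end

section \<open>Counting vectors of given norm\<close>

context hermitian_plane
begin

definition sphere where "sphere t = {w. unimodular w \<and> h w w = t}"

text \<open>A combination with nonunit coefficients pairs with every vector to a nonunit, never to \<open>1\<close>.\<close>

lemma unimodular_comb_imp:
  assumes uv: "u \<in> carrier M" "v \<in> carrier M" and xy: "x \<in> carrier R" "y \<in> carrier R"
    and um: "unimodular (comb u v x y)"
  shows "x \<in> Units R \<or> y \<in> Units R"
proof (rule ccontr)
  assume n: "\<not> ?thesis"
  obtain z where z: "z \<in> carrier M" "h (comb u v x y) z = \<one>" using um by (auto simp: unimodular_def)
  have "circ x \<in> nonunits" "circ y \<in> nonunits" using n xy circ_unit_iff by auto
  then have "circ x \<otimes> h u z \<in> nonunits" "circ y \<otimes> h v z \<in> nonunits"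
    using nonunit_mult uv z(1) form_closed by metis+
  then have "circ x \<otimes> h u z \<oplus> circ y \<otimes> h v z \<notin> Units R" by (rule nonunits_add)
  then show False using z uv xy by (simp add: form_comb_left)
qed

text \<open>Modulo the maximal ideal the trace of \<open>z\<close> is \<open>2 z\<close>.\<close>

lemma trace_unit:
  assumes z: "z \<in> carrier R" shows "z \<oplus> circ z \<in> Units R \<longleftrightarrow> z \<in> Units R"
proof
  assume "z \<oplus> circ z \<in> Units R"
  then show "z \<in> Units R" using nonunit_add[of z "circ z"] z circ_unit_iff by blast
next
  assume u: "z \<in> Units R"
  have "z \<ominus> circ z \<in> nonunits" using circ_residue z by simp
  then have "(z \<oplus> z) \<oplus> \<ominus> (z \<ominus> circ z) \<in> Units R"
    using unit_add_nonunit[OF unit_double[OF u]] nonunit_minus by blast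
  moreover have "(z \<oplus> z) \<oplus> \<ominus> (z \<ominus> circ z) = z \<oplus> circ z" using z circ_closed[OF z] by algebra
  ultimately show "z \<oplus> circ z \<in> Units R" by simp
qed

text \<open>With respect to a hyperbolic pair the norm of \<open>(x, y)\<close> is the trace of \<open>x\<^sup>\<circ> y\<close>, which is a unit
exactly when \<open>x\<close> and \<open>y\<close> both are.  The sphere is the union of the solutions with \<open>x\<close> a unit and of
those with \<open>y\<close> a unit; swapping coordinates exchanges the two sets.  They coincide if \<open>t\<close> is a unit
and are disjoint otherwise.\<close>

lemma card_sphere_isotropic:
  assumes iso: "isotropic R M h" and t: "t \<in> fixed"
  shows "card (sphere t) = (if t \<in> Units R then 1 else 2) * (card (Units R) * card skew)"
proof -
  obtain u0 where u0: "unimodular u0" "h u0 u0 \<notin> Units R" using iso isotropic_iff by blast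
  obtain e where e: "e \<in> carrier M" "h e e = \<zero>" "h u0 e = \<one>" using hyperbolic_partner[OF u0] .
  have u0c: "u0 \<in> carrier M" using u0 by (simp add: unimodular_def)
  have "h e u0 = \<one>" using form_swap[OF u0c e(1)] e(3) by simp
  then have eum: "unimodular e" using e(1) u0c by (auto simp: unimodular_def)
  obtain f where f: "f \<in> carrier M" "h f f = \<zero>" "h e f = \<one>"
    using hyperbolic_partner[OF eum] e(2) by auto
  have fe: "h f e = \<one>" using form_swap[OF e(1) f(1)] f(3) by simp
  have "gram e f = \<zero> \<otimes> \<zero> \<ominus> \<one> \<otimes> \<one>" by (simp only: gram_def e f fe)
  also have "\<dots> = \<ominus> \<one>" by algebra
  finally have g: "gram e f \<in> Units R" using unit_minus[OF Units_one_closed] by simp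
  have norm: "h (comb e f x y) (comb e f x y) = circ x \<otimes> y \<oplus> circ y \<otimes> x"
    if "x \<in> carrier R" "y \<in> carrier R" for x y
    using that e f fe by (simp add: form_comb_left form_comb_right R.m_comm R.a_comm)
  have um: "unimodular (comb e f x y) \<longleftrightarrow> x \<in> Units R \<or> y \<in> Units R"
    if xy: "x \<in> carrier R" "y \<in> carrier R" for x y
  proof
    assume "x \<in> Units R \<or> y \<in> Units R"
    moreover have "h (comb e f x y) f = circ x" "h (comb e f x y) e = circ y"
      using xy e f fe by (simp_all add: form_comb_left)
    ultimately show "unimodular (comb e f x y)"
      using unimodularI[of "comb e f x y" f] unimodularI[of "comb e f x y" e] circ_unit xy e f by auto
  qed (rule unimodular_comb_imp[OF e(1) f(1) xy])
  let ?T = "\<lambda>x. {y \<in> carrier R. circ x \<otimes> y \<oplus> circ y \<otimes> x = t}"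
  let ?A = "Sigma (Units R) ?T"
  let ?B = "(\<lambda>(x, y). (y, x)) ` ?A"
  have tu: "t \<in> Units R \<longleftrightarrow> x \<in> Units R \<and> y \<in> Units R"
    if xy: "x \<in> carrier R" "y \<in> carrier R" "circ x \<otimes> y \<oplus> circ y \<otimes> x = t" for x y
  proof -
    have "circ (circ x \<otimes> y) = circ y \<otimes> x" using xy by (simp add: circ_circ m_comm)
    then have "t \<in> Units R \<longleftrightarrow> circ x \<otimes> y \<in> Units R"
      using trace_unit[of "circ x \<otimes> y"] xy by simp
    also have "\<dots> \<longleftrightarrow> circ x \<in> Units R \<and> y \<in> Units R"
      using xy by (metis Units_m_closed circ_closed m_comm unit_factor)
    finally show ?thesis using circ_unit_iff xy by simp
  qed
  have finT: "finite (?T x)" for x using finite_carrier by simp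
  have finU: "finite (Units R)" using finite_carrier by (rule finite_subset[rotated]) (auto simp: Units_def)
  have cA: "card ?A = card (Units R) * card skew"
    using finT finU card_trace_fibre[OF _ t] by (simp add: card_SigmaI)
  have cB: "card ?B = card ?A" by (intro card_image inj_onI) auto
  have Bmem: "(x, y) \<in> ?B \<longleftrightarrow> x \<in> carrier R \<and> y \<in> Units R \<and> circ x \<otimes> y \<oplus> circ y \<otimes> x = t" for x y
  proof -
    have "(x, y) \<in> ?B \<longleftrightarrow> y \<in> Units R \<and> x \<in> carrier R \<and> circ y \<otimes> x \<oplus> circ x \<otimes> y = t"
      by (auto simp: image_iff)
    also have "\<dots> \<longleftrightarrow> y \<in> Units R \<and> x \<in> carrier R \<and> circ x \<otimes> y \<oplus> circ y \<otimes> x = t"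
      by (intro conj_cong refl) (metis R.a_comm R.m_closed Units_closed circ_closed)
    finally show ?thesis by blast
  qed
  have sph: "sphere t = (\<lambda>(x, y). comb e f x y) ` (?A \<union> ?B)" (is "_ = ?p ` _")
  proof (intro equalityI subsetI)
    fix w assume w: "w \<in> sphere t"
    then have wc: "w \<in> carrier M" by (simp add: sphere_def unimodular_def)
    obtain x y where xy: "x \<in> carrier R" "y \<in> carrier R" "w = comb e f x y"
      using comb_cases[OF g e(1) f(1) wc] .
    have "circ x \<otimes> y \<oplus> circ y \<otimes> x = t" "x \<in> Units R \<or> y \<in> Units R"
      using w norm[OF xy(1,2)] um[OF xy(1,2)] unfolding sphere_def xy(3) by auto
    then have "(x, y) \<in> ?A \<union> ?B" using xy Bmem[of x y] by auto
    then show "w \<in> ?p ` (?A \<union> ?B)" using xy(3) by force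
  next
    fix w assume "w \<in> ?p ` (?A \<union> ?B)"
    then obtain x y where xy: "(x, y) \<in> ?A \<union> ?B" "w = comb e f x y" by force
    then have "x \<in> carrier R" "y \<in> carrier R" "x \<in> Units R \<or> y \<in> Units R" "circ x \<otimes> y \<oplus> circ y \<otimes> x = t"
      using Bmem[of x y] by auto
    then show "w \<in> sphere t" unfolding xy(2) sphere_def using norm um by simp
  qed
  have "?A \<union> ?B \<subseteq> carrier R \<times> carrier R" using Bmem by auto
  then have "inj_on ?p (?A \<union> ?B)" using inj_comb[OF g e(1) f(1)] by (rule inj_on_subset[rotated])
  then have card: "card (sphere t) = card (?A \<union> ?B)" unfolding sph by (rule card_image)
  have fin: "finite ?A" "finite ?B" using finU finT by auto
  show ?thesis
  proof (cases "t \<in> Units R")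
    case True
    have "?B \<subseteq> ?A"
    proof (rule subrelI)
      fix x y assume "(x, y) \<in> ?B"
      then have xy: "x \<in> carrier R" "y \<in> carrier R" "circ x \<otimes> y \<oplus> circ y \<otimes> x = t"
        using Bmem[of x y] by auto
      then show "(x, y) \<in> ?A" using tu[OF xy] True by simp
    qed
    then have "?A \<union> ?B = ?A" by (rule Un_absorb2)
    then show ?thesis using card cA True by simp
  next
    case False
    have "?A \<inter> ?B = {}"
    proof (rule equals0I)
      fix p assume p: "p \<in> ?A \<inter> ?B"
      obtain x y where xy: "p = (x, y)" by force
      have A: "x \<in> Units R" "y \<in> carrier R" "circ x \<otimes> y \<oplus> circ y \<otimes> x = t" and B: "(x, y) \<in> ?B"
        using p unfolding xy by blast+
      have "y \<in> Units R" using Bmem[of x y] B by simp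
      then show False using tu[OF Units_closed[OF A(1)] A(2,3)] A(1) False by simp
    qed
    then show ?thesis using card card_Un_disjoint[OF fin] cA cB False by simp
  qed
qed

text \<open>In an orthogonal basis \<open>(u, v)\<close> with \<open>h v v = h u u d\<close> the norm is \<open>h u u\<close> times the norm form with
parameter \<open>d\<close>, so the sphere is a fibre of that form.\<close>

lemma card_sphere_anisotropic:
  assumes an: "\<not> isotropic R M h" and u: "unimodular u" and t: "t \<in> fixed_units"
  shows "card fixed_units * card (sphere t) + card nonunits * card nonunits = card (carrier R) * card (carrier R)"
proof -
  have uc: "u \<in> carrier M" using u by (simp add: unimodular_def)
  have unit_norm: "h w w \<in> Units R" if "unimodular w" for w using that an isotropic_iff by blast
  let ?s = "h u u" and ?D = "gram e1 e2"
  have s: "?s \<in> fixed_units" "?s \<in> carrier R" "circ ?s = ?s"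
    using unit_norm[OF u] form_fixed[OF uc] form_closed[OF uc uc] form_swap[OF uc uc] by simp_all
  have D: "?D \<in> fixed" "?D \<in> Units R" "?D \<in> carrier R"
    using gram_fixed[OF e_closed] e_gram gram_closed[OF e_closed] by (simp_all add: gram_def)
  obtain v where v: "v \<in> carrier M" "h u v = \<zero>" "h v v = ?s \<otimes> ?D" using orthogonal_partner[OF uc] .
  have vu: "h v u = \<zero>" using form_swap[OF uc v(1)] v(2) by simp
  have "gram u v = ?s \<otimes> (?s \<otimes> ?D) \<ominus> \<zero> \<otimes> \<zero>" by (simp only: gram_def v vu)
  also have "\<dots> = ?s \<otimes> (?s \<otimes> ?D)" using s(2) D(3) by algebra
  finally have g: "gram u v \<in> Units R" using s D by simp
  have norm: "h (comb u v x y) (comb u v x y) = ?s \<otimes> nrm ?D x y" if xy: "x \<in> carrier R" "y \<in> carrier R" for x y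
  proof -
    have "h (comb u v x y) (comb u v x y) = x \<otimes> (circ x \<otimes> ?s) \<oplus> y \<otimes> (circ y \<otimes> (?s \<otimes> ?D))"
      using xy uc v vu s D by (simp add: form_comb_left form_comb_right)
    also have "\<dots> = ?s \<otimes> nrm ?D x y"
      unfolding nrm_def using xy circ_closed[OF xy(1)] circ_closed[OF xy(2)] s(2) D(3) by algebra
    finally show ?thesis .
  qed
  have um: "unimodular (comb u v x y) \<longleftrightarrow> x \<in> Units R \<or> y \<in> Units R"
    if xy: "x \<in> carrier R" "y \<in> carrier R" for x y
  proof
    assume a: "x \<in> Units R \<or> y \<in> Units R"
    have "h (comb u v x y) u = circ x \<otimes> ?s" "h (comb u v x y) v = circ y \<otimes> (?s \<otimes> ?D)"
      using xy uc v vu s D by (simp_all add: form_comb_left)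
    then show "unimodular (comb u v x y)"
      using a unimodularI[of "comb u v x y" u] unimodularI[of "comb u v x y" v] circ_unit xy uc v s D by auto
  qed (rule unimodular_comb_imp[OF uc v(1) xy])
  have aniso: "nrm ?D x y \<in> Units R" if "x \<in> carrier R" "y \<in> carrier R" "x \<in> Units R \<or> y \<in> Units R" for x y
    using unit_norm[of "comb u v x y"] um[OF that(1,2)] that norm[OF that(1,2)] nrm_closed[OF D(3) that(1,2)] s(2)
    by (metis m_comm unit_factor)
  let ?r = "inv ?s \<otimes> t"
  have tc: "t \<in> carrier R" "t \<in> fixed" "t \<in> Units R" using t fixedD by auto
  have r: "?r \<in> fixed_units" using fixed_units_mult[OF _ t, of "inv ?s"] fixed_inv s(1) by simp
  have norm_eq: "?s \<otimes> z = t \<longleftrightarrow> z = ?r" if "z \<in> carrier R" for z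
  proof -
    have "?s \<otimes> ?r = t" using s tc by (simp add: m_assoc[symmetric])
    then show ?thesis using unit_cancel[of ?s z ?r] s tc that by auto
  qed
  have sph: "sphere t = (\<lambda>(x, y). comb u v x y) ` nrm_fibre ?D ?r" (is "_ = ?p ` _")
  proof (intro equalityI subsetI)
    fix w assume w: "w \<in> sphere t"
    then have wc: "w \<in> carrier M" by (simp add: sphere_def unimodular_def)
    obtain x y where xy: "x \<in> carrier R" "y \<in> carrier R" "w = comb u v x y"
      using comb_cases[OF g uc v(1) wc] .
    have "?s \<otimes> nrm ?D x y = t" using w norm[OF xy(1,2)] unfolding sphere_def xy(3) by simp
    then have "(x, y) \<in> nrm_fibre ?D ?r" using norm_eq[of "nrm ?D x y"] xy D by (simp add: nrm_fibre_def)
    then show "w \<in> ?p ` nrm_fibre ?D ?r" using xy(3) by force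
  next
    fix w assume "w \<in> ?p ` nrm_fibre ?D ?r"
    then obtain x y where xy: "(x, y) \<in> nrm_fibre ?D ?r" "w = comb u v x y" by force
    then have c: "x \<in> carrier R" "y \<in> carrier R" "nrm ?D x y = ?r" by (auto simp: nrm_fibre_def)
    have "nrm ?D x y \<in> Units R" using c r by simp
    then have "x \<in> Units R \<or> y \<in> Units R" using nrm_nonunit[OF D(3), of x y] c by blast
    moreover have "h (comb u v x y) (comb u v x y) = t"
      using norm[OF c(1,2)] norm_eq[of ?r] c(3) r by (simp add: fixedD)
    ultimately show "w \<in> sphere t" unfolding xy(2) sphere_def using um[OF c(1,2)] by simp
  qed
  have "nrm_fibre ?D ?r \<subseteq> carrier R \<times> carrier R" by (auto simp: nrm_fibre_def)
  then have "inj_on ?p (nrm_fibre ?D ?r)" using inj_comb[OF g uc v(1)] by (rule inj_on_subset[rotated])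
  then have "card (sphere t) = card (nrm_fibre ?D ?r)" unfolding sph by (rule card_image)
  then show ?thesis using card_nrm_fibre[OF D(1) aniso r] by simp
qed

text \<open>It remains to express the cardinalities of the units, of the fixed units and of the skew elements
as powers of \<open>q\<close>, using that the fixed ring and the skew elements split both \<open>R\<close> and its maximal
ideal.\<close>

theorem unitary_index:
  assumes card_R: "card (carrier R) = q ^ l" and card_m: "card nonunits = q ^ (l - 1)"
    and card_F: "card fixed = q ^ f" and l: "l \<ge> 1"
    and u: "primitive R M u"
  shows "\<not> isotropic R M h \<Longrightarrow> h u u \<in> Units R"
    and "\<not> isotropic R M h \<Longrightarrow> stab_index u = q ^ (2 * l - f - 1) * (q + 1)"
    and "isotropic R M h \<Longrightarrow> stab_index u
           = (if h u u \<in> Units R then 1 else 2) * (q ^ (2 * l - f - 1) * (q - 1))"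
proof -
  have um: "unimodular u" using u by (rule primitive_imp_unimodular)
  have uc: "u \<in> carrier M" using um by (simp add: unimodular_def)
  have index: "stab_index u = card (sphere (h u u))"
    using stabilizer_index[OF um] by (simp add: sphere_def)
  have U: "Units R \<subseteq> carrier R" by auto
  have card_lt: "card nonunits < card (carrier R)"
    using finite_carrier Units_one_closed U by (intro psubset_card_mono) auto
  have "q \<noteq> 0" using card_R finite_carrier l by (metis R.one_closed card_eq_0_iff empty_iff power_0_left not_one_le_zero)
  moreover have "q \<noteq> 1" using card_R card_m card_lt by auto
  ultimately have q: "q \<ge> 2" by simp
  have ql: "q ^ l = q * q ^ (l - 1)" using l by (metis le_add_diff_inverse power_add power_one_right)
  have card_U: "card (Units R) = q ^ (l - 1) * (q - 1)"
  proof -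
    have "card (Units R) + card nonunits = card (carrier R)"
      using finite_carrier U card_Diff_subset[of "Units R" "carrier R"] finite_subset[OF U] card_mono[OF finite_carrier U] by simp
    then show ?thesis unfolding card_R card_m ql by (simp add: algebra_simps)
  qed
  have FS: "q ^ f * card skew = q ^ l" using card_fixed_skew card_R card_F by simp
  have NS: "card (fixed \<inter> nonunits) * card skew = q ^ (l - 1)" using card_nonunits_skew card_m by simp
  have S0: "card skew > 0" using FS q by (metis gr0I mult_0_right not_numeral_le_zero power_not_zero)
  have qN: "q ^ f = q * card (fixed \<inter> nonunits)"
  proof -
    have "q ^ f * card skew = (q * card (fixed \<inter> nonunits)) * card skew" using FS NS ql by simp
    then show ?thesis using S0 by simp
  qed
  have f1: "f \<ge> 1"
  proof (rule ccontr)
    assume "\<not> ?thesis"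
    then have "q * card (fixed \<inter> nonunits) = 1" using qN by (simp add: not_le)
    then show False using q by simp
  qed
  have fl: "f \<le> l"
  proof -
    have "q ^ f \<le> q ^ l" using FS S0 by (metis mult.right_neutral mult_le_mono2 Suc_leI One_nat_def)
    then show ?thesis using q by (simp add: power_increasing_iff)
  qed
  have qf: "q ^ f = q * q ^ (f - 1)" using f1 by (metis le_add_diff_inverse power_add power_one_right)
  have N: "card (fixed \<inter> nonunits) = q ^ (f - 1)" using qN qf q by simp
  have S: "card skew = q ^ (l - f)"
  proof -
    have "q ^ f * card skew = q ^ f * q ^ (l - f)" using FS fl by (simp add: power_add[symmetric])
    then show ?thesis using q by simp
  qed
  have card_FU: "card fixed_units = q ^ (f - 1) * (q - 1)"
  proof -
    have "fixed = fixed_units \<union> (fixed \<inter> nonunits)" using fixedD by auto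
    then have "card fixed = card fixed_units + card (fixed \<inter> nonunits)"
      using finite_fixed card_Un_disjoint[of fixed_units "fixed \<inter> nonunits"] by auto
    then show ?thesis unfolding card_F N qf by (simp add: algebra_simps)
  qed
  show unit: "h u u \<in> Units R" if "\<not> isotropic R M h"
    using that isotropic_iff um by blast
  show "stab_index u = q ^ (2 * l - f - 1) * (q + 1)" if an: "\<not> isotropic R M h"
  proof -
    have "h u u \<in> fixed_units" using unit[OF an] form_fixed[OF uc] by simp
    from card_sphere_anisotropic[OF an um this]
    have eq: "q ^ (f - 1) * (q - 1) * card (sphere (h u u)) + q ^ (l - 1) * q ^ (l - 1) = q ^ l * q ^ l"
      unfolding card_FU card_m card_R .
    \<comment> \<open>Writing \<open>q = r + 1\<close> avoids truncated subtraction when the factor \<open>q\<^sup>2 - 1 = r (q + 1)\<close> is cancelled.\<close>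
    obtain r where r: "q = Suc r" "r > 0" using q by (cases q) auto
    have e: "q ^ (l - 1) * q ^ (l - 1) = q ^ (f - 1) * q ^ (2 * l - f - 1)"
      unfolding power_add[symmetric] using fl f1 by (intro arg_cong[of _ _ "power q"]) simp
    have "q ^ l * q ^ l = q ^ (l - 1) * q ^ (l - 1) + q ^ (l - 1) * q ^ (l - 1) * (r * (q + 1))"
      unfolding ql by (simp add: r algebra_simps)
    then have "q ^ (f - 1) * r * card (sphere (h u u)) = q ^ (f - 1) * r * (q ^ (2 * l - f - 1) * (q + 1))"
      using eq unfolding e by (simp add: r(1) algebra_simps)
    then show ?thesis unfolding index using q r(2) by simp
  qed
  show "stab_index u
           = (if h u u \<in> Units R then 1 else 2) * (q ^ (2 * l - f - 1) * (q - 1))" if iso: "isotropic R M h"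
  proof -
    have "q ^ (l - 1) * q ^ (l - f) = q ^ (2 * l - f - 1)"
      unfolding power_add[symmetric] using fl f1 by (intro arg_cong[of _ _ "power q"]) simp
    then have "card (Units R) * card skew = q ^ (2 * l - f - 1) * (q - 1)"
      unfolding card_U S by (metis mult.assoc mult.commute)
    then show ?thesis unfolding index card_sphere_isotropic[OF iso form_fixed[OF uc]] by simp
  qed
qed

end

section \<open>Reduction of a hermitian form modulo an ideal\<close>

lemma (in ideal) image_coset:
  assumes s: "s \<in> ring_hom R R" "s ` I = I" and x: "x \<in> carrier R"
  shows "s ` (I +> x) = I +> s x"
proof -
  have "s ` (I +> x) = (\<Union>i\<in>I. {s (i \<oplus> x)})" unfolding a_r_coset_def' by blast
  also have "\<dots> = (\<Union>i\<in>I. {s i \<oplus> s x})"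
    using ring_hom_add[OF s(1) Icarr x] by simp
  also have "\<dots> = (\<Union>i\<in>s ` I. {i \<oplus> s x})" by blast
  finally show ?thesis by (simp add: s(2) a_r_coset_def')
qed

lemma (in ideal) quotient_cases:
  assumes "C \<in> carrier (R Quot I)" obtains x where "x \<in> carrier R" "C = I +> x"
  using assms unfolding FactRing_def A_RCOSETS_def' by auto

lemma (in ideal) coset_in_quotient [simp, intro]: "x \<in> carrier R \<Longrightarrow> I +> x \<in> carrier (R Quot I)"
  using rcos_ring_hom by (rule ring_hom_closed)

lemma (in ideal) coset_add: "\<lbrakk>x \<in> carrier R; y \<in> carrier R\<rbrakk> \<Longrightarrow> (I +> x) \<oplus>\<^bsub>R Quot I\<^esub> (I +> y) = I +> (x \<oplus> y)"
  and coset_mult: "\<lbrakk>x \<in> carrier R; y \<in> carrier R\<rbrakk> \<Longrightarrow> (I +> x) \<otimes>\<^bsub>R Quot I\<^esub> (I +> y) = I +> (x \<otimes> y)"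
  and coset_one: "\<one>\<^bsub>R Quot I\<^esub> = I +> \<one>"
  using ring_hom_add[OF rcos_ring_hom] ring_hom_mult[OF rcos_ring_hom] ring_hom_one[OF rcos_ring_hom] by auto

lemma (in ideal) coset_minus:
  assumes "x \<in> carrier R" "y \<in> carrier R"
  shows "(I +> x) \<ominus>\<^bsub>R Quot I\<^esub> (I +> y) = I +> (x \<ominus> y)"
proof -
  interpret q: ring_hom_ring R "R Quot I" "(+>) I" by (rule rcos_ring_hom_ring)
  show ?thesis using assms by (simp add: a_minus_def)
qed

lemma (in ideal) coset_eq_iff:
  "\<lbrakk>x \<in> carrier R; y \<in> carrier R\<rbrakk> \<Longrightarrow> I +> x = I +> y \<longleftrightarrow> x \<ominus> y \<in> I"
  using quotient_eq_iff_same_a_r_cos[OF is_ideal] by simp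

lemma (in ideal) coset_unit: "x \<in> Units R \<Longrightarrow> I +> x \<in> Units (R Quot I)"
proof -
  assume x: "x \<in> Units R"
  then have c: "x \<in> carrier R" "inv x \<in> carrier R" "x \<otimes> inv x = \<one>" "inv x \<otimes> x = \<one>" by auto
  then show ?thesis unfolding Units_def
    by (auto simp: coset_one coset_mult intro!: bexI[of _ "I +> inv x"])
qed

lemma (in ideal) quot_involution_hom:
  assumes s: "s \<in> ring_hom R R" "s ` I = I"
  shows "quot_involution s \<in> ring_hom (R Quot I) (R Quot I)"
proof (rule ring_hom_memI)
  fix C assume "C \<in> carrier (R Quot I)"
  then obtain x where x: "x \<in> carrier R" "C = I +> x" by (rule quotient_cases)
  have sx: "s x \<in> carrier R" using ring_hom_closed[OF s(1) x(1)] .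
  show "s ` C \<in> carrier (R Quot I)" using image_coset[OF s x(1)] sx x(2) by simp
  fix D assume "D \<in> carrier (R Quot I)"
  then obtain y where y: "y \<in> carrier R" "D = I +> y" by (rule quotient_cases)
  have sy: "s y \<in> carrier R" using ring_hom_closed[OF s(1) y(1)] .
  show "s ` (C \<otimes>\<^bsub>R Quot I\<^esub> D) = s ` C \<otimes>\<^bsub>R Quot I\<^esub> s ` D"
    unfolding x(2) y(2) using image_coset[OF s] x(1) y(1) sx sy
    by (simp add: coset_mult ring_hom_mult[OF s(1)])
  show "s ` (C \<oplus>\<^bsub>R Quot I\<^esub> D) = s ` C \<oplus>\<^bsub>R Quot I\<^esub> s ` D"
    unfolding x(2) y(2) using image_coset[OF s] x(1) y(1) sx sy
    by (simp add: coset_add ring_hom_add[OF s(1)])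
next
  show "s ` \<one>\<^bsub>R Quot I\<^esub> = \<one>\<^bsub>R Quot I\<^esub>"
    using image_coset[OF s] ring_hom_one[OF s(1)] by (simp add: coset_one)
qed

lemma (in cring) ideal_power_principal:
  assumes a: "a \<in> carrier R"
  shows "ideal_power R (PIdl a) n = PIdl (a [^] n)"
proof (induction n)
  case 0
  have "PIdl \<one> = carrier R" using cgenideal_eq_genideal genideal_one by simp
  then show ?case by (simp add: ideals_set_def)
next
  case (Suc n)
  have "ideal_power R (PIdl a) (Suc n) = (PIdl (a [^] n)) \<cdot> (PIdl a)"
    using Suc by (simp add: ideals_set_def)
  also have "\<dots> = Idl ((PIdl (a [^] n)) <#> (PIdl a))"
    using a by (intro ideal_prod_eq_genideal cgenideal_ideal) auto
  also have "\<dots> = Idl (PIdl (a [^] n \<otimes> a))" using a by (simp add: cgenideal_prod)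
  also have "\<dots> = PIdl (a [^] n \<otimes> a)"
  proof -
    have i: "ideal (PIdl (a [^] n \<otimes> a)) R" using a by (intro cgenideal_ideal) auto
    then show ?thesis
      using genideal_minimal[OF i subset_refl] genideal_self[OF additive_subgroup.a_subset[OF ideal.axioms(1)[OF i]]] by blast
  qed
  finally show ?case by simp
qed

text \<open>A basis of two elements in the sense of unique coefficient functions, as a bijection from pairs of
coefficients.\<close>

lemma (in module) basis_pair:
  assumes "free_of_rank R M 2"
  obtains e1 e2 where "e1 \<in> carrier M" "e2 \<in> carrier M"
    "bij_betw (\<lambda>(a, b). a \<odot>\<^bsub>M\<^esub> e1 \<oplus>\<^bsub>M\<^esub> b \<odot>\<^bsub>M\<^esub> e2) (carrier R \<times> carrier R) (carrier M)"
proof -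
  obtain S where S: "finite_basis R M S" "card S = 2" using assms unfolding free_of_rank_def by blast
  obtain e1 e2 where e: "S = {e1, e2}" "e1 \<noteq> e2" using S(2) by (auto simp: card_2_iff)
  have ec: "e1 \<in> carrier M" "e2 \<in> carrier M" using S(1) e(1) by (auto simp: finite_basis_def)
  have ex1: "\<And>x. x \<in> carrier M \<Longrightarrow> \<exists>!c. c \<in> {e1, e2} \<rightarrow>\<^sub>E carrier R \<and> x = (\<Oplus>\<^bsub>M\<^esub> s\<in>{e1, e2}. c s \<odot>\<^bsub>M\<^esub> s)"
    using S(1) e(1) unfolding finite_basis_def by auto
  have fs: "(\<Oplus>\<^bsub>M\<^esub> s\<in>{e1, e2}. c s \<odot>\<^bsub>M\<^esub> s) = c e1 \<odot>\<^bsub>M\<^esub> e1 \<oplus>\<^bsub>M\<^esub> c e2 \<odot>\<^bsub>M\<^esub> e2"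
    if "c \<in> {e1, e2} \<rightarrow>\<^sub>E carrier R" for c
  proof -
    have c: "c e1 \<in> carrier R" "c e2 \<in> carrier R" using that by auto
    show ?thesis using e(2) ec c by (simp add: M.finsum_insert)
  qed
  let ?p = "\<lambda>(a, b). a \<odot>\<^bsub>M\<^esub> e1 \<oplus>\<^bsub>M\<^esub> b \<odot>\<^bsub>M\<^esub> e2"
  have "inj_on ?p (carrier R \<times> carrier R)"
  proof (rule inj_onI)
    fix r s assume rs: "r \<in> carrier R \<times> carrier R" "s \<in> carrier R \<times> carrier R" "?p r = ?p s"
    let ?c = "\<lambda>r. \<lambda>s\<in>{e1, e2}. if s = e1 then fst r else snd r"
    have c: "?c t \<in> {e1, e2} \<rightarrow>\<^sub>E carrier R \<and> ?p t = (\<Oplus>\<^bsub>M\<^esub> s\<in>{e1, e2}. ?c t s \<odot>\<^bsub>M\<^esub> s)"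
      if "t \<in> carrier R \<times> carrier R" for t
    proof -
      have 1: "?c t \<in> {e1, e2} \<rightarrow>\<^sub>E carrier R" using that by auto
      show ?thesis using 1 fs[OF 1] e(2) by (auto simp: case_prod_beta)
    qed
    have "?p r \<in> carrier M" using rs(1) ec by auto
    note unique = the1_equality[OF ex1[OF this]]
    have eq: "?c r = ?c s"
      by (rule trans[OF unique[OF c[OF rs(1)], symmetric] unique[OF c[OF rs(2), folded rs(3)]]])
    have "fst r = fst s" using fun_cong[OF eq, of e1] by simp
    moreover have "snd r = snd s" using fun_cong[OF eq, of e2] e(2) by simp
    ultimately show "r = s" by (rule prod_eqI)
  qed
  moreover have "?p ` (carrier R \<times> carrier R) = carrier M"
  proof (intro equalityI subsetI)
    fix x assume "x \<in> ?p ` (carrier R \<times> carrier R)" then show "x \<in> carrier M" using ec by auto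
  next
    fix x assume "x \<in> carrier M"
    then obtain c where c: "c \<in> {e1, e2} \<rightarrow>\<^sub>E carrier R" "x = (\<Oplus>\<^bsub>M\<^esub> s\<in>{e1, e2}. c s \<odot>\<^bsub>M\<^esub> s)"
      using ex1 by blast
    then have "x = ?p (c e1, c e2)" "(c e1, c e2) \<in> carrier R \<times> carrier R" using fs by auto
    then show "x \<in> ?p ` (carrier R \<times> carrier R)" by (rule image_eqI)
  qed
  ultimately show thesis using that ec by (simp add: bij_betw_def)
qed

locale involutive_hermitian_form = hermitian_form R M star h
  for R :: "('a, 'm) ring_scheme" (structure) and M :: "('a, 'v, 'n) module_scheme" (structure) and star h +
  assumes star_hom: "star \<in> ring_hom R R"
begin

lemma star_closed: "a \<in> carrier R \<Longrightarrow> star a \<in> carrier R"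
  using star_hom by (rule ring_hom_closed)

lemma form_smult_left:
  assumes "a \<in> carrier R" "x \<in> carrier M" "y \<in> carrier M"
  shows "h (a \<odot>\<^bsub>M\<^esub> x) y = star a \<otimes> h x y"
proof -
  have "h (a \<odot>\<^bsub>M\<^esub> x) y = star (h y (a \<odot>\<^bsub>M\<^esub> x))" using assms by (intro form_hermitian) auto
  also have "\<dots> = star a \<otimes> star (h y x)"
    using assms by (simp add: form_smult_right form_closed ring_hom_mult[OF star_hom])
  also have "star (h y x) = h x y" using assms by (intro form_hermitian[symmetric])
  finally show ?thesis .
qed

text \<open>By non-degeneracy the two coordinate functionals are of the form \<open>h x\<close>.  The coordinates of the two
vectors \<open>x\<close> form, up to \<open>star\<close>, a left inverse of the Gram matrix, so its determinant is a unit.\<close>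

lemma gram_unit:
  assumes nd: "nondegenerate R M h" and e: "e1 \<in> carrier M" "e2 \<in> carrier M"
    and bij: "bij_betw (\<lambda>(a, b). a \<odot>\<^bsub>M\<^esub> e1 \<oplus>\<^bsub>M\<^esub> b \<odot>\<^bsub>M\<^esub> e2) (carrier R \<times> carrier R) (carrier M)"
  shows "h e1 e1 \<otimes> h e2 e2 \<ominus> h e1 e2 \<otimes> h e2 e1 \<in> Units R"
proof -
  let ?p = "\<lambda>(a, b). a \<odot>\<^bsub>M\<^esub> e1 \<oplus>\<^bsub>M\<^esub> b \<odot>\<^bsub>M\<^esub> e2" and ?C = "carrier R \<times> carrier R"
  define k where "k = inv_into ?C ?p"
  have kp: "k (a \<odot>\<^bsub>M\<^esub> e1 \<oplus>\<^bsub>M\<^esub> b \<odot>\<^bsub>M\<^esub> e2) = (a, b)" if "a \<in> carrier R" "b \<in> carrier R" for a b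
    using bij_betw_inv_into_left[OF bij, of "(a, b)"] that by (simp add: k_def)
  have span: "\<exists>a\<in>carrier R. \<exists>b\<in>carrier R. x = a \<odot>\<^bsub>M\<^esub> e1 \<oplus>\<^bsub>M\<^esub> b \<odot>\<^bsub>M\<^esub> e2" if "x \<in> carrier M" for x
  proof -
    have "x \<in> ?p ` ?C" using bij that by (simp add: bij_betw_def)
    then show ?thesis by auto
  qed
  have kadd: "k (x \<oplus>\<^bsub>M\<^esub> y) = (fst (k x) \<oplus> fst (k y), snd (k x) \<oplus> snd (k y))"
    if xy: "x \<in> carrier M" "y \<in> carrier M" for x y
  proof -
    obtain a b where ab: "a \<in> carrier R" "b \<in> carrier R" "x = a \<odot>\<^bsub>M\<^esub> e1 \<oplus>\<^bsub>M\<^esub> b \<odot>\<^bsub>M\<^esub> e2" using span[OF xy(1)] by blast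
    obtain c d where cd: "c \<in> carrier R" "d \<in> carrier R" "y = c \<odot>\<^bsub>M\<^esub> e1 \<oplus>\<^bsub>M\<^esub> d \<odot>\<^bsub>M\<^esub> e2" using span[OF xy(2)] by blast
    have "x \<oplus>\<^bsub>M\<^esub> y = (a \<oplus> c) \<odot>\<^bsub>M\<^esub> e1 \<oplus>\<^bsub>M\<^esub> (b \<oplus> d) \<odot>\<^bsub>M\<^esub> e2"
      unfolding ab(3) cd(3) using ab(1,2) cd(1,2) e by (simp add: smult_l_distr M.a_ac)
    then have "k (x \<oplus>\<^bsub>M\<^esub> y) = (a \<oplus> c, b \<oplus> d)" using kp ab(1,2) cd(1,2) by simp
    moreover have "k x = (a, b)" "k y = (c, d)" unfolding ab(3) cd(3) using kp ab(1,2) cd(1,2) by simp_all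
    ultimately show ?thesis by simp
  qed
  have ksm: "k (r \<odot>\<^bsub>M\<^esub> x) = (r \<otimes> fst (k x), r \<otimes> snd (k x))" if x: "x \<in> carrier M" and r: "r \<in> carrier R" for r x
  proof -
    obtain a b where ab: "a \<in> carrier R" "b \<in> carrier R" "x = a \<odot>\<^bsub>M\<^esub> e1 \<oplus>\<^bsub>M\<^esub> b \<odot>\<^bsub>M\<^esub> e2" using span[OF x] by blast
    have "r \<odot>\<^bsub>M\<^esub> x = (r \<otimes> a) \<odot>\<^bsub>M\<^esub> e1 \<oplus>\<^bsub>M\<^esub> (r \<otimes> b) \<odot>\<^bsub>M\<^esub> e2"
      unfolding ab(3) using ab(1,2) e r by (simp add: smult_r_distr smult_assoc1)
    then have "k (r \<odot>\<^bsub>M\<^esub> x) = (r \<otimes> a, r \<otimes> b)" using kp ab(1,2) r by simp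
    moreover have "k x = (a, b)" unfolding ab(3) using kp ab(1,2) by simp
    ultimately show ?thesis by simp
  qed
  have kcl: "fst (k x) \<in> carrier R" "snd (k x) \<in> carrier R" if "x \<in> carrier M" for x
    using span[OF that] kp by auto
  have k1: "k e1 = (\<one>, \<zero>)" and k2: "k e2 = (\<zero>, \<one>)"
    using kp[of \<one> \<zero>] kp[of \<zero> \<one>] e by simp_all
  have dual: "\<exists>a\<in>carrier R. \<exists>b\<in>carrier R. a \<otimes> h e1 e1 \<oplus> b \<otimes> h e2 e1 = F (k e1) \<and> a \<otimes> h e1 e2 \<oplus> b \<otimes> h e2 e2 = F (k e2)"
    if F: "F = fst \<or> F = snd" for F
  proof -
    let ?f = "\<lambda>x\<in>carrier M. F (k x)"
    have "?f \<in> linear_maps R M (regular_module R)"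
      unfolding linear_maps_def regular_module_def using F kadd ksm kcl by auto
    then have "?f \<in> (\<lambda>x. \<lambda>y\<in>carrier M. h x y) ` carrier M" using nd by (simp add: nondegenerate_def bij_betw_def)
    then obtain x where x: "x \<in> carrier M" "?f = (\<lambda>y\<in>carrier M. h x y)" by blast
    obtain a b where ab: "a \<in> carrier R" "b \<in> carrier R" "x = a \<odot>\<^bsub>M\<^esub> e1 \<oplus>\<^bsub>M\<^esub> b \<odot>\<^bsub>M\<^esub> e2" using span[OF x(1)] by blast
    have "h x y = F (k y)" if "y \<in> carrier M" for y using fun_cong[OF x(2), of y] that by simp
    moreover have "h x y = star a \<otimes> h e1 y \<oplus> star b \<otimes> h e2 y" if "y \<in> carrier M" for y
      unfolding ab(3) using ab(1,2) e that by (simp add: form_add_left form_smult_left)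
    ultimately show ?thesis using e star_closed ab(1,2) by metis
  qed
  obtain p q where pq: "p \<in> carrier R" "q \<in> carrier R" "p \<otimes> h e1 e1 \<oplus> q \<otimes> h e2 e1 = \<one>" "p \<otimes> h e1 e2 \<oplus> q \<otimes> h e2 e2 = \<zero>"
    using dual[of fst] k1 k2 by auto
  obtain r s where rs: "r \<in> carrier R" "s \<in> carrier R" "r \<otimes> h e1 e1 \<oplus> s \<otimes> h e2 e1 = \<zero>" "r \<otimes> h e1 e2 \<oplus> s \<otimes> h e2 e2 = \<one>"
    using dual[of snd] k1 k2 by auto
  let ?G = "h e1 e1 \<otimes> h e2 e2 \<ominus> h e1 e2 \<otimes> h e2 e1"
  have hc: "h e1 e1 \<in> carrier R" "h e1 e2 \<in> carrier R" "h e2 e1 \<in> carrier R" "h e2 e2 \<in> carrier R"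
    using e form_closed by auto
  have "?G \<otimes> (p \<otimes> s \<ominus> q \<otimes> r) = (p \<otimes> h e1 e1 \<oplus> q \<otimes> h e2 e1) \<otimes> (r \<otimes> h e1 e2 \<oplus> s \<otimes> h e2 e2)
        \<ominus> (p \<otimes> h e1 e2 \<oplus> q \<otimes> h e2 e2) \<otimes> (r \<otimes> h e1 e1 \<oplus> s \<otimes> h e2 e1)"
    using pq(1,2) rs(1,2) hc by algebra
  also have "\<dots> = \<one> \<otimes> \<one> \<ominus> \<zero> \<otimes> \<zero>" unfolding pq(3,4) rs(3,4) ..
  also have "\<dots> = \<one>" by algebra
  finally have "?G \<otimes> (p \<otimes> s \<ominus> q \<otimes> r) \<in> Units R" by simp
  then show ?thesis using R.unit_factor[of ?G "p \<otimes> s \<ominus> q \<otimes> r"] hc pq(1,2) rs(1,2) by simp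
qed

end

locale hermitian_reduction = involutive_hermitian_form R M star h + I?: ideal I R
  for R :: "('a, 'm) ring_scheme" (structure) and M :: "('a, 'v, 'n) module_scheme" (structure) and star h and I +
  assumes star_ideal: "star ` I = I"
begin

abbreviation N where "N \<equiv> ideal_smult I M"
abbreviation Rq where "Rq \<equiv> R Quot I"
abbreviation Mq where "Mq \<equiv> quot_module M I"
abbreviation hq where "hq \<equiv> quot_form R I h"

lemma smult_in_N: "\<lbrakk>i \<in> I; x \<in> carrier M\<rbrakk> \<Longrightarrow> i \<odot>\<^bsub>M\<^esub> x \<in> N"
  unfolding ideal_smult_def by (rule generate.incl) blast

lemma N_subgroup: "subgroup N (add_monoid M)"
  unfolding ideal_smult_def using Icarr by (intro M.add.generate_is_subgroup) auto

sublocale N: abelian_subgroup N M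
  by (rule abelian_subgroupI2[OF M.a_comm_group N_subgroup])

lemma N_smult:
  assumes a: "a \<in> carrier R" and n: "n \<in> N" shows "a \<odot>\<^bsub>M\<^esub> n \<in> N"
  using n unfolding ideal_smult_def
proof (induction n rule: generate.induct)
  case one
  show ?case using a generate.one[of "add_monoid M"] by simp
next
  case (incl n)
  then obtain i x where n: "i \<in> I" "x \<in> carrier M" "n = i \<odot>\<^bsub>M\<^esub> x" by blast
  have "a \<odot>\<^bsub>M\<^esub> n = (a \<otimes> i) \<odot>\<^bsub>M\<^esub> x" using n a Icarr by (simp add: smult_assoc1)
  then show ?case using n a I_l_closed by (intro generate.incl) blast
next
  case (inv n)
  then obtain i x where n: "i \<in> I" "x \<in> carrier M" "n = i \<odot>\<^bsub>M\<^esub> x" by blast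
  have "a \<odot>\<^bsub>M\<^esub> (\<ominus>\<^bsub>M\<^esub> n) = \<ominus>\<^bsub>M\<^esub> ((a \<otimes> i) \<odot>\<^bsub>M\<^esub> x)"
    using n a Icarr by (simp add: smult_assoc1 smult_r_minus)
  then show ?case unfolding a_inv_def[symmetric] using n a I_l_closed
    by (simp add: a_inv_def) (intro generate.inv, blast)
next
  case (eng m n)
  have "m \<in> carrier M" "n \<in> carrier M"
    using eng(1,2) N.a_Hcarr unfolding ideal_smult_def by auto
  then have "a \<odot>\<^bsub>M\<^esub> (m \<oplus>\<^bsub>M\<^esub> n) = a \<odot>\<^bsub>M\<^esub> m \<oplus>\<^bsub>M\<^esub> a \<odot>\<^bsub>M\<^esub> n" using a by (simp add: smult_r_distr)
  then show ?case using generate.eng[OF eng(3,4)] by simp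
qed

lemma form_N_right:
  assumes y: "y \<in> carrier M" and n: "n \<in> N" shows "h y n \<in> I"
  using n unfolding ideal_smult_def
proof (induction n rule: generate.induct)
  case one
  have "h y \<zero>\<^bsub>M\<^esub> = \<zero>" using form_smult_right[of \<zero> y "\<zero>\<^bsub>M\<^esub>"] y form_closed by simp
  then show ?case by simp
next
  case (incl n)
  then obtain i x where n: "i \<in> I" "x \<in> carrier M" "n = i \<odot>\<^bsub>M\<^esub> x" by blast
  then show ?case using y Icarr form_closed I_r_closed by (simp add: form_smult_right)
next
  case (inv n)
  then obtain i x where n: "i \<in> I" "x \<in> carrier M" "n = i \<odot>\<^bsub>M\<^esub> x" by blast
  have "\<ominus>\<^bsub>M\<^esub> n = (\<ominus> i) \<odot>\<^bsub>M\<^esub> x" using n Icarr by (simp add: smult_l_minus)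
  then show ?case unfolding a_inv_def[symmetric] using n y Icarr form_closed I_r_closed
    by (simp add: form_smult_right)
next
  case (eng m n)
  have "m \<in> carrier M" "n \<in> carrier M"
    using eng(1,2) N.a_Hcarr unfolding ideal_smult_def by auto
  then show ?case using eng(3,4) y by (simp add: form_add_right)
qed

lemma form_N_left: "\<lbrakk>y \<in> carrier M; n \<in> N\<rbrakk> \<Longrightarrow> h n y \<in> I"
  using form_N_right[of y n] form_hermitian[of y n] N.a_Hcarr star_ideal by auto

abbreviation vcls where "vcls x \<equiv> N +>\<^bsub>M\<^esub> x"

lemma vcls_eqI: "\<lbrakk>x' \<in> vcls x; x \<in> carrier M\<rbrakk> \<Longrightarrow> vcls x' = vcls x"
  using N.a_repr_independence' by metis

lemma vcls_memE:
  assumes "x' \<in> vcls x" obtains n where "n \<in> N" "x' = n \<oplus>\<^bsub>M\<^esub> x"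
  using assms unfolding a_r_coset_def' by auto

lemma ring_co_memE:
  assumes "x' \<in> I +> x" obtains i where "i \<in> I" "x' = i \<oplus> x"
  using assms unfolding a_r_coset_def' by auto

lemma Mq_carrier: "carrier Mq = vcls ` carrier M"
  unfolding quot_module_def A_RCOSETS_def' by auto

lemma Mq_add: "\<lbrakk>x \<in> carrier M; y \<in> carrier M\<rbrakk> \<Longrightarrow> vcls x \<oplus>\<^bsub>Mq\<^esub> vcls y = vcls (x \<oplus>\<^bsub>M\<^esub> y)"
  by (simp add: quot_module_def N.a_rcos_sum)

text \<open>Changing \<open>a\<close> by an element of \<open>I\<close> or \<open>x\<close> by one of \<open>I M\<close> changes \<open>a x\<close> within \<open>I M\<close>.\<close>

lemma Mq_smult:
  assumes a: "a \<in> carrier R" and x: "x \<in> carrier M"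
  shows "(I +> a) \<odot>\<^bsub>Mq\<^esub> vcls x = vcls (a \<odot>\<^bsub>M\<^esub> x)"
proof -
  have eq: "vcls (a' \<odot>\<^bsub>M\<^esub> x') = vcls (a \<odot>\<^bsub>M\<^esub> x)" if m: "a' \<in> I +> a" "x' \<in> vcls x" for a' x'
  proof -
    obtain i where i: "i \<in> I" "a' = i \<oplus> a" using ring_co_memE[OF m(1)] .
    obtain n where n: "n \<in> N" "x' = n \<oplus>\<^bsub>M\<^esub> x" using vcls_memE[OF m(2)] .
    have c: "i \<in> carrier R" "n \<in> carrier M" using i n Icarr N.a_Hcarr by auto
    have "a' \<odot>\<^bsub>M\<^esub> x' = (i \<odot>\<^bsub>M\<^esub> (n \<oplus>\<^bsub>M\<^esub> x) \<oplus>\<^bsub>M\<^esub> a \<odot>\<^bsub>M\<^esub> n) \<oplus>\<^bsub>M\<^esub> a \<odot>\<^bsub>M\<^esub> x"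
      using i n c a x by (simp add: smult_l_distr smult_r_distr M.a_ac)
    moreover have "i \<odot>\<^bsub>M\<^esub> (n \<oplus>\<^bsub>M\<^esub> x) \<oplus>\<^bsub>M\<^esub> a \<odot>\<^bsub>M\<^esub> n \<in> N"
      using smult_in_N N_smult i n a c x by simp
    ultimately have "a' \<odot>\<^bsub>M\<^esub> x' \<in> vcls (a \<odot>\<^bsub>M\<^esub> x)" unfolding a_r_coset_def' by blast
    then show ?thesis using vcls_eqI a x by simp
  qed
  have "(I +> a) \<odot>\<^bsub>Mq\<^esub> vcls x = (\<Union>a'\<in>I +> a. \<Union>x'\<in>vcls x. vcls (a' \<odot>\<^bsub>M\<^esub> x'))"
    by (simp add: quot_module_def)
  also have "\<dots> = (\<Union>a'\<in>I +> a. \<Union>x'\<in>vcls x. vcls (a \<odot>\<^bsub>M\<^esub> x))" using eq by (intro SUP_cong refl) auto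
  also have "\<dots> = vcls (a \<odot>\<^bsub>M\<^esub> x)" using a_rcos_self[OF a] N.a_rcos_self[OF x] by auto
  finally show ?thesis .
qed

text \<open>The form takes values in \<open>I\<close> as soon as one argument is in \<open>I M\<close>; the form on cosets is therefore
well defined, and the union in its definition has a single member.\<close>

lemma hq_coset:
  assumes x: "x \<in> carrier M" and y: "y \<in> carrier M"
  shows "hq (vcls x) (vcls y) = I +> h x y"
proof -
  have eq: "I +> h x' y' = I +> h x y" if m: "x' \<in> vcls x" "y' \<in> vcls y" for x' y'
  proof -
    obtain n where n: "n \<in> N" "x' = n \<oplus>\<^bsub>M\<^esub> x" using vcls_memE[OF m(1)] .
    obtain k where k: "k \<in> N" "y' = k \<oplus>\<^bsub>M\<^esub> y" using vcls_memE[OF m(2)] .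
    have c: "n \<in> carrier M" "k \<in> carrier M" using n k N.a_Hcarr by auto
    have "h x' y' = (h n (k \<oplus>\<^bsub>M\<^esub> y) \<oplus> h x k) \<oplus> h x y"
      using n k c x y form_closed by (simp add: form_add_left form_add_right R.a_ac)
    moreover have "h n (k \<oplus>\<^bsub>M\<^esub> y) \<oplus> h x k \<in> I"
      using form_N_left[of "k \<oplus>\<^bsub>M\<^esub> y" n] form_N_right[of x k] n k c x y by simp
    ultimately have "h x' y' \<in> I +> h x y" unfolding a_r_coset_def' by blast
    then show ?thesis using a_repr_independence'[of "h x' y'" "h x y"] x y form_closed by simp
  qed
  have "hq (vcls x) (vcls y) = (\<Union>x'\<in>vcls x. \<Union>y'\<in>vcls y. I +> h x y)"
    unfolding quot_form_def using eq by (intro SUP_cong refl) auto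
  also have "\<dots> = I +> h x y" using N.a_rcos_self[OF x] N.a_rcos_self[OF y] by auto
  finally show ?thesis .
qed

lemma quotient_hermitian_form: "hermitian_form Rq Mq (quot_involution star) hq"
proof -
  have Mq: "x \<in> carrier Mq \<Longrightarrow> \<exists>y\<in>carrier M. x = vcls y" for x using Mq_carrier by auto
  have Rq: "x \<in> carrier Rq \<Longrightarrow> \<exists>y\<in>carrier R. x = I +> y" for x using quotient_cases by blast
  have coc: "x \<in> carrier M \<Longrightarrow> vcls x \<in> carrier Mq" for x using Mq_carrier by auto
  have ab: "abelian_group Mq"
  proof (rule abelian_groupI)
    show "\<zero>\<^bsub>Mq\<^esub> \<in> carrier Mq"
      using N.a_subgroup_in_rcosets by (simp add: quot_module_def)
  next
    fix x y assume "x \<in> carrier Mq" "y \<in> carrier Mq"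
    then obtain x' y' where c: "x' \<in> carrier M" "x = vcls x'" "y' \<in> carrier M" "y = vcls y'" using Mq by meson
    show "x \<oplus>\<^bsub>Mq\<^esub> y \<in> carrier Mq" using c coc by (simp add: Mq_add)
    show "x \<oplus>\<^bsub>Mq\<^esub> y = y \<oplus>\<^bsub>Mq\<^esub> x" using c by (simp add: Mq_add M.a_comm)
    fix z assume "z \<in> carrier Mq"
    then obtain z' where d: "z' \<in> carrier M" "z = vcls z'" using Mq by meson
    show "x \<oplus>\<^bsub>Mq\<^esub> y \<oplus>\<^bsub>Mq\<^esub> z = x \<oplus>\<^bsub>Mq\<^esub> (y \<oplus>\<^bsub>Mq\<^esub> z)" using c d by (simp add: Mq_add M.a_assoc)
  next
    have z: "\<zero>\<^bsub>Mq\<^esub> = vcls \<zero>\<^bsub>M\<^esub>" 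
      using N.a_rcos_const[OF N.zero_closed] by (simp add: quot_module_def)
    fix x assume "x \<in> carrier Mq"
    then obtain x' where c: "x' \<in> carrier M" "x = vcls x'" using Mq by meson
    show "\<zero>\<^bsub>Mq\<^esub> \<oplus>\<^bsub>Mq\<^esub> x = x" unfolding z using c by (simp add: Mq_add)
    have "vcls (\<ominus>\<^bsub>M\<^esub> x') \<oplus>\<^bsub>Mq\<^esub> x = \<zero>\<^bsub>Mq\<^esub>" unfolding z using c by (simp add: Mq_add M.l_neg)
    then show "\<exists>y\<in>carrier Mq. y \<oplus>\<^bsub>Mq\<^esub> x = \<zero>\<^bsub>Mq\<^esub>" using c coc by (meson M.a_inv_closed)
  qed
  have "module Rq Mq"
  proof (rule moduleI)
    show "cring Rq" by (rule quotient_is_cring[OF R.is_cring])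
    show "abelian_group Mq" by (rule ab)
  next
    fix a x assume "a \<in> carrier Rq" "x \<in> carrier Mq"
    then obtain r y where r: "r \<in> carrier R" "a = I +> r" and y: "y \<in> carrier M" "x = vcls y" using Rq Mq by blast
    then show "a \<odot>\<^bsub>Mq\<^esub> x \<in> carrier Mq" using coc by (simp add: Mq_smult)
  next
    fix a b x assume "a \<in> carrier Rq" "b \<in> carrier Rq" "x \<in> carrier Mq"
    then obtain r s y where r: "r \<in> carrier R" "a = I +> r" and s: "s \<in> carrier R" "b = I +> s"
      and y: "y \<in> carrier M" "x = vcls y" using Rq Mq by meson
    show "(a \<oplus>\<^bsub>Rq\<^esub> b) \<odot>\<^bsub>Mq\<^esub> x = a \<odot>\<^bsub>Mq\<^esub> x \<oplus>\<^bsub>Mq\<^esub> b \<odot>\<^bsub>Mq\<^esub> x"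
      using r s y by (simp add: coset_add Mq_smult Mq_add smult_l_distr)
    show "(a \<otimes>\<^bsub>Rq\<^esub> b) \<odot>\<^bsub>Mq\<^esub> x = a \<odot>\<^bsub>Mq\<^esub> (b \<odot>\<^bsub>Mq\<^esub> x)"
      using r s y by (simp add: coset_mult Mq_smult smult_assoc1)
  next
    fix a x y assume "a \<in> carrier Rq" "x \<in> carrier Mq" "y \<in> carrier Mq"
    then obtain r z w where r: "r \<in> carrier R" "a = I +> r" and z: "z \<in> carrier M" "x = vcls z"
      and w: "w \<in> carrier M" "y = vcls w" using Rq Mq by meson
    then show "a \<odot>\<^bsub>Mq\<^esub> (x \<oplus>\<^bsub>Mq\<^esub> y) = a \<odot>\<^bsub>Mq\<^esub> x \<oplus>\<^bsub>Mq\<^esub> a \<odot>\<^bsub>Mq\<^esub> y"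
      by (simp add: Mq_smult Mq_add smult_r_distr)
  next
    fix x assume "x \<in> carrier Mq"
    then obtain y where y: "y \<in> carrier M" "x = vcls y" using Mq by blast
    then show "\<one>\<^bsub>Rq\<^esub> \<odot>\<^bsub>Mq\<^esub> x = x" by (simp add: coset_one Mq_smult)
  qed
  then show ?thesis
  proof (rule hermitian_form.intro, unfold_locales)
    fix x y assume "x \<in> carrier Mq" "y \<in> carrier Mq"
    then obtain x' y' where x: "x' \<in> carrier M" "x = vcls x'" and y: "y' \<in> carrier M" "y = vcls y'" using Mq by meson
    show "hq x y \<in> carrier Rq" using x y form_closed by (simp add: hq_coset)
    have "hq y x = I +> star (h x' y')" using x y form_hermitian[OF x(1) y(1)] by (simp add: hq_coset)
    then show "hq y x = star ` (hq x y)"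
      using x y image_coset[OF star_hom star_ideal form_closed[OF x(1) y(1)]] by (simp add: hq_coset)
  next
    fix x y z assume "x \<in> carrier Mq" "y \<in> carrier Mq" "z \<in> carrier Mq"
    then obtain x' y' z' where c: "x' \<in> carrier M" "x = vcls x'" "y' \<in> carrier M" "y = vcls y'" "z' \<in> carrier M" "z = vcls z'"
      using Mq by meson
    show "hq (x \<oplus>\<^bsub>Mq\<^esub> y) z = hq x z \<oplus>\<^bsub>Rq\<^esub> hq y z"
      using c form_closed by (simp add: Mq_add hq_coset coset_add form_add_left)
    show "hq x (y \<oplus>\<^bsub>Mq\<^esub> z) = hq x y \<oplus>\<^bsub>Rq\<^esub> hq x z"
      using c form_closed by (simp add: Mq_add hq_coset coset_add form_add_right)
  next
    fix a x y assume "a \<in> carrier Rq" "x \<in> carrier Mq" "y \<in> carrier Mq"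
    then obtain a' x' y' where c: "a' \<in> carrier R" "a = I +> a'" "x' \<in> carrier M" "x = vcls x'" "y' \<in> carrier M" "y = vcls y'"
      using Mq Rq by meson
    show "hq x (a \<odot>\<^bsub>Mq\<^esub> y) = a \<otimes>\<^bsub>Rq\<^esub> hq x y"
      using c form_closed by (simp add: Mq_smult hq_coset coset_mult form_smult_right)
  qed
qed

lemma quotient_basis:
  assumes nd: "nondegenerate R M h" and fr: "free_of_rank R M 2"
  obtains E1 E2 where "E1 \<in> carrier Mq" "E2 \<in> carrier Mq"
    "\<And>x. x \<in> carrier Mq \<Longrightarrow> \<exists>a\<in>carrier Rq. \<exists>b\<in>carrier Rq. x = a \<odot>\<^bsub>Mq\<^esub> E1 \<oplus>\<^bsub>Mq\<^esub> b \<odot>\<^bsub>Mq\<^esub> E2"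
    "hq E1 E1 \<otimes>\<^bsub>Rq\<^esub> hq E2 E2 \<ominus>\<^bsub>Rq\<^esub> hq E1 E2 \<otimes>\<^bsub>Rq\<^esub> hq E2 E1 \<in> Units Rq"
proof -
  obtain e1 e2 where e: "e1 \<in> carrier M" "e2 \<in> carrier M"
    and bij: "bij_betw (\<lambda>(a, b). a \<odot>\<^bsub>M\<^esub> e1 \<oplus>\<^bsub>M\<^esub> b \<odot>\<^bsub>M\<^esub> e2) (carrier R \<times> carrier R) (carrier M)"
    using basis_pair[OF fr] .
  have "\<exists>a\<in>carrier Rq. \<exists>b\<in>carrier Rq. x = a \<odot>\<^bsub>Mq\<^esub> vcls e1 \<oplus>\<^bsub>Mq\<^esub> b \<odot>\<^bsub>Mq\<^esub> vcls e2" if x: "x \<in> carrier Mq" for x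
  proof -
    obtain y where y: "y \<in> carrier M" "x = vcls y" using x Mq_carrier by auto
    have "y \<in> (\<lambda>(a, b). a \<odot>\<^bsub>M\<^esub> e1 \<oplus>\<^bsub>M\<^esub> b \<odot>\<^bsub>M\<^esub> e2) ` (carrier R \<times> carrier R)"
      using bij y by (simp add: bij_betw_def)
    then obtain a b where ab: "a \<in> carrier R" "b \<in> carrier R" "y = a \<odot>\<^bsub>M\<^esub> e1 \<oplus>\<^bsub>M\<^esub> b \<odot>\<^bsub>M\<^esub> e2" by auto
    have "x = (I +> a) \<odot>\<^bsub>Mq\<^esub> vcls e1 \<oplus>\<^bsub>Mq\<^esub> (I +> b) \<odot>\<^bsub>Mq\<^esub> vcls e2"
      unfolding y(2) ab(3) using ab(1,2) e by (simp add: Mq_smult Mq_add)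
    then show ?thesis using ab(1,2) coset_in_quotient by blast
  qed
  moreover have "hq (vcls e1) (vcls e1) \<otimes>\<^bsub>Rq\<^esub> hq (vcls e2) (vcls e2) \<ominus>\<^bsub>Rq\<^esub> hq (vcls e1) (vcls e2) \<otimes>\<^bsub>Rq\<^esub> hq (vcls e2) (vcls e1)
      = I +> (h e1 e1 \<otimes> h e2 e2 \<ominus> h e1 e2 \<otimes> h e2 e1)"
    using e form_closed by (simp add: hq_coset coset_mult coset_minus)
  ultimately show thesis
    using that[of "vcls e1" "vcls e2"] coset_unit[OF gram_unit[OF nd e bij]] e Mq_carrier by auto
qed

end

section \<open>Quotients of a domain by powers of a prime element\<close>

text \<open>The set \<open>T\<close> of representatives fixes the size \<open>q\<close> of the residue ring in a form that can be lifted
to all powers of \<open>\<rho>\<close>.\<close>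

locale uniformized_domain = R?: domain R for R (structure) +
  fixes \<rho> \<sigma> and q :: nat
  assumes rho: "\<rho> \<in> carrier R" "\<rho> \<noteq> \<zero>"
    and max: "maximalideal (PIdl \<rho>) R"
    and transversal: "\<exists>T\<subseteq>carrier R. finite T \<and> card T = q \<and> (\<forall>x\<in>carrier R. \<exists>!t. t \<in> T \<and> x \<ominus> t \<in> PIdl \<rho>)"
    and sigma_hom: "\<sigma> \<in> ring_hom R R"
    and sigma_sigma: "x \<in> carrier R \<Longrightarrow> \<sigma> (\<sigma> x) = x"
    and sigma_rho: "\<sigma> \<rho> = \<ominus> \<rho>"
    and sigma_residue: "x \<in> carrier R \<Longrightarrow> x \<ominus> \<sigma> x \<in> PIdl \<rho>"
    and two: "\<one> \<oplus> \<one> \<notin> PIdl \<rho>"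
begin

abbreviation Pw where "Pw n \<equiv> PIdl (\<rho> [^] (n::nat))"

lemma Pw_ideal: "ideal (Pw n) R"
  using rho by (intro cgenideal_ideal) simp

lemma Pw_iff: "x \<in> Pw n \<longleftrightarrow> (\<exists>z\<in>carrier R. x = z \<otimes> \<rho> [^] n)"
  unfolding cgenideal_def by blast

lemma Pw_carrier: "x \<in> Pw n \<Longrightarrow> x \<in> carrier R"
  using rho unfolding Pw_iff by auto

lemma Pw_1: "Pw 1 = PIdl \<rho>" using rho by simp

lemma pow_nonzero: "\<rho> [^] (n::nat) \<noteq> \<zero>"
  using rho by (induction n) (auto simp: integral_iff)

lemma Pw_antimono: assumes "m \<le> n" shows "Pw n \<subseteq> Pw m"
proof
  fix x assume "x \<in> Pw n"
  then obtain z where z: "z \<in> carrier R" "x = z \<otimes> \<rho> [^] n" unfolding Pw_iff by blast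
  have "\<rho> [^] n = \<rho> [^] (n - m) \<otimes> \<rho> [^] m" using rho assms by (simp add: nat_pow_mult)
  then have "x = (z \<otimes> \<rho> [^] (n - m)) \<otimes> \<rho> [^] m" using z rho by (simp add: m_assoc)
  then show "x \<in> Pw m" unfolding Pw_iff using z rho by blast
qed

lemma one_notin: "\<one> \<notin> PIdl \<rho>"
  using maximalideal.I_notcarr[OF max] ideal.one_imp_carrier[OF maximalideal.axioms(1)[OF max]] by blast

lemma one_notin_Pw: "n \<ge> 1 \<Longrightarrow> \<one> \<notin> Pw n"
  using one_notin Pw_antimono[of 1 n] Pw_1 by blast

lemma sigma_closed [simp, intro]: "x \<in> carrier R \<Longrightarrow> \<sigma> x \<in> carrier R"
  using sigma_hom by (rule ring_hom_closed)

lemma sigma_pow: "\<sigma> (\<rho> [^] n) \<in> Pw n"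
proof (induction n)
  case 0
  show ?case unfolding Pw_iff using ring_hom_one[OF sigma_hom] by auto
next
  case (Suc n)
  then obtain z where z: "z \<in> carrier R" "\<sigma> (\<rho> [^] n) = z \<otimes> \<rho> [^] n" unfolding Pw_iff by blast
  have "\<sigma> (\<rho> [^] Suc n) = (z \<otimes> \<rho> [^] n) \<otimes> (\<ominus> \<rho>)"
    using ring_hom_mult[OF sigma_hom] rho z by (simp add: sigma_rho)
  also have "\<dots> = (\<ominus> z) \<otimes> (\<rho> [^] n \<otimes> \<rho>)" 
    using z(1) rho(1) nat_pow_closed[OF rho(1), of n] by algebra
  also have "\<dots> = (\<ominus> z) \<otimes> \<rho> [^] Suc n" by simp
  finally show ?case unfolding Pw_iff using z(1) by blast
qed

lemma sigma_Pw: "\<sigma> ` Pw n = Pw n"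
proof -
  have sub: "\<sigma> x \<in> Pw n" if x: "x \<in> Pw n" for x
  proof -
    obtain z where z: "z \<in> carrier R" "x = z \<otimes> \<rho> [^] n" using x unfolding Pw_iff by blast
    then have "\<sigma> x = \<sigma> z \<otimes> \<sigma> (\<rho> [^] n)" using ring_hom_mult[OF sigma_hom] rho by simp
    then show ?thesis using ideal.I_l_closed[OF Pw_ideal sigma_pow] z by simp
  qed
  show ?thesis
  proof (intro equalityI subsetI)
    fix x assume x: "x \<in> Pw n"
    have "x = \<sigma> (\<sigma> x)" by (rule sigma_sigma[OF Pw_carrier[OF x], symmetric])
    then show "x \<in> \<sigma> ` Pw n" using sub[OF x] by (rule image_eqI)
  qed (use sub in auto)
qed

lemma Pw_Suc_cancel:
  assumes x: "x \<in> carrier R" and m: "x \<otimes> \<rho> \<in> Pw (Suc n)" shows "x \<in> Pw n"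
proof -
  obtain z where z: "z \<in> carrier R" "x \<otimes> \<rho> = z \<otimes> \<rho> [^] Suc n" using m unfolding Pw_iff by blast
  then have "x \<otimes> \<rho> = (z \<otimes> \<rho> [^] n) \<otimes> \<rho>" using rho by (simp add: m_assoc)
  moreover have "z \<otimes> \<rho> [^] n \<in> carrier R" using z rho by simp
  ultimately have "x = z \<otimes> \<rho> [^] n" using m_rcancel[OF rho(2,1) x] by blast
  then show ?thesis unfolding Pw_iff using z by blast
qed

lemma Pw_Suc_mult: assumes m: "x \<in> Pw n" shows "x \<otimes> \<rho> \<in> Pw (Suc n)"
proof -
  obtain z where z: "z \<in> carrier R" "x = z \<otimes> \<rho> [^] n" using m unfolding Pw_iff by blast
  then have "x \<otimes> \<rho> = z \<otimes> \<rho> [^] Suc n" using rho by (simp add: m_assoc)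
  then show ?thesis unfolding Pw_iff using z by blast
qed

lemma diff_self: "x \<in> carrier R \<Longrightarrow> x \<ominus> x \<in> Pw n"
  using rho unfolding Pw_iff by (auto intro!: bexI[of _ \<zero>] simp: r_right_minus_eq)

lemma diff_mem_trans:
  assumes I: "ideal I R" and c: "x \<in> carrier R" "y \<in> carrier R" "z \<in> carrier R" "x \<ominus> y \<in> I" "x \<ominus> z \<in> I"
  shows "y \<ominus> z \<in> I"
proof -
  have "(x \<ominus> z) \<ominus> (x \<ominus> y) = y \<ominus> z" using c(1-3) by algebra
  moreover have "(x \<ominus> z) \<ominus> (x \<ominus> y) \<in> I"
    unfolding a_minus_def[of R "x \<ominus> z"]
    using c(4,5) additive_subgroup.a_closed[OF ideal.axioms(1)[OF I]]
      additive_subgroup.a_inv_closed[OF ideal.axioms(1)[OF I]] by blast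
  ultimately show ?thesis by simp
qed

text \<open>Expansion in powers of \<open>\<rho>\<close>: representatives modulo \<open>\<rho> ^ (n + 1)\<close> are the elements \<open>s + t \<rho>\<close> with \<open>s\<close>
a representative modulo \<open>\<rho>\<close> and \<open>t\<close> one modulo \<open>\<rho> ^ n\<close>.\<close>

lemma transversal_power:
  "\<exists>T\<subseteq>carrier R. finite T \<and> card T = q ^ n \<and> (\<forall>x\<in>carrier R. \<exists>!t. t \<in> T \<and> x \<ominus> t \<in> Pw n)"
proof (induction n)
  case 0
  have "x \<ominus> \<zero> \<in> Pw 0" if "x \<in> carrier R" for x
    using that unfolding Pw_iff by (auto simp: a_minus_def)
  then show ?case by (intro exI[of _ "{\<zero>}"]) auto
next
  case (Suc n)
  then obtain T where T: "T \<subseteq> carrier R" "finite T" "card T = q ^ n"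
    "\<forall>x\<in>carrier R. \<exists>!t. t \<in> T \<and> x \<ominus> t \<in> Pw n" by (elim exE conjE)
  note T = T(1-3) bspec[OF T(4)]
  obtain T1 where T1: "T1 \<subseteq> carrier R" "finite T1" "card T1 = q"
    "\<forall>x\<in>carrier R. \<exists>!t. t \<in> T1 \<and> x \<ominus> t \<in> PIdl \<rho>" using transversal by (elim exE conjE)
  note T1 = T1(1-3) bspec[OF T1(4)]
  let ?f = "\<lambda>(s, t). s \<oplus> t \<otimes> \<rho>"
  have uniq: "s = s' \<and> t = t'"
    if c: "s \<in> T1" "s' \<in> T1" "t \<in> T" "t' \<in> T" and m: "(s \<oplus> t \<otimes> \<rho>) \<ominus> (s' \<oplus> t' \<otimes> \<rho>) \<in> Pw (Suc n)" for s s' t t'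
  proof -
    have cc: "s \<in> carrier R" "s' \<in> carrier R" "t \<in> carrier R" "t' \<in> carrier R" using c T T1 by auto
    obtain z where z: "z \<in> PIdl \<rho>" "(s \<oplus> t \<otimes> \<rho>) \<ominus> (s' \<oplus> t' \<otimes> \<rho>) = z"
      using m Pw_antimono[of 1 "Suc n"] Pw_1 by auto
    obtain w where w: "w \<in> carrier R" "z = w \<otimes> \<rho>" using z(1) unfolding cgenideal_def by blast
    have "s \<ominus> s' = ((s \<oplus> t \<otimes> \<rho>) \<ominus> (s' \<oplus> t' \<otimes> \<rho>)) \<oplus> (t' \<ominus> t) \<otimes> \<rho>" using cc rho by algebra
    also have "\<dots> = (w \<oplus> (t' \<ominus> t)) \<otimes> \<rho>" unfolding z(2) w(2) using w(1) cc rho by algebra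
    finally have "s \<ominus> s' \<in> PIdl \<rho>" unfolding cgenideal_def using w(1) cc by blast
    moreover have "s \<ominus> s \<in> PIdl \<rho>" using diff_self[OF cc(1), of 1] Pw_1 by simp
    ultimately have ss: "s = s'" using T1(4)[OF cc(1)] c by blast
    have "(t \<ominus> t') \<otimes> \<rho> = (s \<oplus> t \<otimes> \<rho>) \<ominus> (s \<oplus> t' \<otimes> \<rho>)" using cc rho by algebra
    then have "(t \<ominus> t') \<otimes> \<rho> \<in> Pw (Suc n)" using m ss by simp
    then have "t \<ominus> t' \<in> Pw n" using Pw_Suc_cancel cc by simp
    then show ?thesis using diff_self[OF cc(3)] T(4)[OF cc(3)] c ss by blast
  qed
  have inj: "inj_on ?f (T1 \<times> T)"
  proof (rule inj_onI)
    fix a b assume ab: "a \<in> T1 \<times> T" "b \<in> T1 \<times> T" "?f a = ?f b"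
    obtain s t where a: "a = (s, t)" by force
    obtain s' t' where b: "b = (s', t')" by force
    have c: "s \<oplus> t \<otimes> \<rho> \<in> carrier R" using ab(1) T(1) T1(1) rho unfolding a by auto
    have "(s \<oplus> t \<otimes> \<rho>) \<ominus> (s' \<oplus> t' \<otimes> \<rho>) \<in> Pw (Suc n)" using diff_self[OF c, of "Suc n"] ab(3) unfolding a b by simp
    then show "a = b" using uniq[of s s' t t'] ab(1,2) unfolding a b by simp
  qed
  let ?S = "?f ` (T1 \<times> T)"
  have "\<exists>!t. t \<in> ?S \<and> x \<ominus> t \<in> Pw (Suc n)" if x: "x \<in> carrier R" for x
  proof -
    obtain s where s: "s \<in> T1" "x \<ominus> s \<in> PIdl \<rho>" using T1(4)[OF x] by blast
    obtain y where y: "y \<in> carrier R" "x \<ominus> s = y \<otimes> \<rho>" using s(2) unfolding cgenideal_def by blast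
    obtain t where t: "t \<in> T" "y \<ominus> t \<in> Pw n" using T(4)[OF y(1)] by blast
    have c: "s \<in> carrier R" "t \<in> carrier R" using s t T T1 by auto
    have "x \<ominus> (s \<oplus> t \<otimes> \<rho>) = (x \<ominus> s) \<ominus> t \<otimes> \<rho>" using x c rho by algebra
    also have "\<dots> = (y \<ominus> t) \<otimes> \<rho>" unfolding y(2) using y(1) c rho by algebra
    finally have m: "x \<ominus> (s \<oplus> t \<otimes> \<rho>) \<in> Pw (Suc n)" using Pw_Suc_mult[OF t(2)] by simp
    show ?thesis
    proof (rule ex1I[of _ "s \<oplus> t \<otimes> \<rho>"])
      show "s \<oplus> t \<otimes> \<rho> \<in> ?S \<and> x \<ominus> (s \<oplus> t \<otimes> \<rho>) \<in> Pw (Suc n)" using m s t by force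
    next
      fix r assume r: "r \<in> ?S \<and> x \<ominus> r \<in> Pw (Suc n)"
      then obtain s' t' where r': "s' \<in> T1" "t' \<in> T" "r = s' \<oplus> t' \<otimes> \<rho>" by auto
      have c': "s' \<in> carrier R" "t' \<in> carrier R" using r' T T1 by auto
      have "(s \<oplus> t \<otimes> \<rho>) \<ominus> (s' \<oplus> t' \<otimes> \<rho>) \<in> Pw (Suc n)"
        by (rule diff_mem_trans[OF Pw_ideal x _ _ m]) (use r r' c c' rho in auto)
      then show "r = s \<oplus> t \<otimes> \<rho>" using uniq s t r' by blast
    qed
  qed
  moreover have "card ?S = q ^ Suc n" using card_image[OF inj] T T1 by simp
  moreover have "?S \<subseteq> carrier R" using T(1) T1(1) rho by auto
  ultimately show ?case using T(2) T1(2) by (intro exI[of _ ?S]) simp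
qed

text \<open>An inverse of \<open>x\<close> modulo \<open>\<rho>\<close> exists in the residue field.  If \<open>1 - x w\<close> is divisible by \<open>\<rho> ^ n\<close> and
\<open>1 - x y\<close> by \<open>\<rho>\<close>, their product has the form \<open>1 - x w'\<close> and is divisible by \<open>\<rho> ^ (n + 1)\<close>.\<close>

lemma unit_mod_Pw:
  assumes x: "x \<in> carrier R" "x \<notin> PIdl \<rho>"
  shows "\<exists>w\<in>carrier R. \<one> \<ominus> x \<otimes> w \<in> Pw n"
proof -
  interpret P: maximalideal "PIdl \<rho>" R by (rule max)
  interpret Q: field "R Quot PIdl \<rho>" by (rule P.quotient_is_field[OF R.is_cring])
  have ne: "PIdl \<rho> +> x \<noteq> \<zero>\<^bsub>R Quot PIdl \<rho>\<^esub>"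
    using x P.rcos_const_imp_mem by (auto simp: FactRing_def)
  then have "PIdl \<rho> +> x \<in> Units (R Quot PIdl \<rho>)"
    using x P.coset_in_quotient by (simp add: Q.field_Units)
  then obtain D where D: "D \<in> carrier (R Quot PIdl \<rho>)" "(PIdl \<rho> +> x) \<otimes>\<^bsub>R Quot PIdl \<rho>\<^esub> D = \<one>\<^bsub>R Quot PIdl \<rho>\<^esub>"
    using Q.Units_r_inv_ex by blast
  obtain y where y: "y \<in> carrier R" "D = PIdl \<rho> +> y" using D(1) by (rule P.quotient_cases)
  have "PIdl \<rho> +> \<one> = PIdl \<rho> +> (x \<otimes> y)" using D(2) x y by (simp add: P.coset_mult P.coset_one)
  then have "\<one> \<ominus> x \<otimes> y \<in> PIdl \<rho>" using P.coset_eq_iff x y by simp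
  then obtain z where z: "z \<in> carrier R" "\<one> \<ominus> x \<otimes> y = z \<otimes> \<rho>" unfolding cgenideal_def by blast
  show ?thesis
  proof (induction n)
    case 0
    have "\<one> \<ominus> x \<otimes> \<zero> = \<one> \<otimes> \<rho> [^] (0::nat)" using x by (simp add: a_minus_def)
    then show ?case unfolding Pw_iff by blast
  next
    case (Suc n)
    then obtain w where w: "w \<in> carrier R" "\<one> \<ominus> x \<otimes> w \<in> Pw n" by blast
    have "\<one> \<ominus> x \<otimes> ((w \<oplus> y) \<ominus> x \<otimes> w \<otimes> y) = (\<one> \<ominus> x \<otimes> w) \<otimes> (\<one> \<ominus> x \<otimes> y)"
      using w(1) y(1) x(1) by algebra
    also have "\<dots> = z \<otimes> ((\<one> \<ominus> x \<otimes> w) \<otimes> \<rho>)" unfolding z(2) using z(1) w(1) x(1) rho(1) by algebra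
    also have "\<dots> \<in> Pw (Suc n)" using ideal.I_l_closed[OF Pw_ideal Pw_Suc_mult[OF w(2)] z(1)] .
    finally show ?case using w(1) y(1) x(1) by blast
  qed
qed

text \<open>Any ring \<open>B\<close> that is isomorphic to the quotient by \<open>\<rho> ^ l\<close>, presented by a surjective homomorphism.
Its nonunits are the images of the multiples of \<open>\<rho>\<close>, and the image of \<open>\<rho> ^ (l - 1)\<close> spans the socle.\<close>

lemma involutive_local_quotient:
  assumes B: "cring B" and hom: "\<phi> \<in> ring_hom R B" and surj: "\<phi> ` carrier R = carrier B"
    and ker: "\<And>x y. \<lbrakk>x \<in> carrier R; y \<in> carrier R\<rbrakk> \<Longrightarrow> \<phi> x = \<phi> y \<longleftrightarrow> x \<ominus> y \<in> Pw l"
    and circ: "\<And>x. x \<in> carrier R \<Longrightarrow> circ (\<phi> x) = \<phi> (\<sigma> x)" and l: "l \<ge> 1"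
  shows "involutive_local_ring B circ" and "card (carrier B) = q ^ l"
    and "card (carrier B - Units B) = q ^ (l - 1)"
proof -
  interpret B: cring B by (rule B)
  have cl: "\<phi> x \<in> carrier B" if "x \<in> carrier R" for x using ring_hom_closed[OF hom that] .
  have ml: "\<phi> (x \<otimes> y) = \<phi> x \<otimes>\<^bsub>B\<^esub> \<phi> y" if "x \<in> carrier R" "y \<in> carrier R" for x y using ring_hom_mult[OF hom that] .
  have ad: "\<phi> (x \<oplus> y) = \<phi> x \<oplus>\<^bsub>B\<^esub> \<phi> y" if "x \<in> carrier R" "y \<in> carrier R" for x y using ring_hom_add[OF hom that] .
  have one: "\<phi> \<one> = \<one>\<^bsub>B\<^esub>" using ring_hom_one[OF hom] .
  interpret hr: ring_hom_ring R B \<phi> using hom by (intro ring_hom_ringI2 R.ring_axioms B.ring_axioms)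
  have zero: "\<phi> \<zero> = \<zero>\<^bsub>B\<^esub>" by simp
  have mi: "\<phi> (x \<ominus> y) = \<phi> x \<ominus>\<^bsub>B\<^esub> \<phi> y" if "x \<in> carrier R" "y \<in> carrier R" for x y
    using that by (simp add: a_minus_def)
  have ex: "\<exists>x\<in>carrier R. b = \<phi> x" if "b \<in> carrier B" for b using surj that by auto
  have Pw_sub: "Pw l \<subseteq> PIdl \<rho>" using Pw_antimono[OF l] Pw_1 by simp
  have ker0: "\<phi> x = \<zero>\<^bsub>B\<^esub> \<longleftrightarrow> x \<in> Pw l" if "x \<in> carrier R" for x
    using ker[OF that R.zero_closed] zero that by (simp add: a_minus_def)
  have Pid: "ideal (PIdl \<rho>) R" using rho by (intro cgenideal_ideal)
  have unit: "\<phi> x \<in> Units B \<longleftrightarrow> x \<notin> PIdl \<rho>" if x: "x \<in> carrier R" for x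
  proof
    assume "\<phi> x \<in> Units B"
    then obtain b where "b \<in> carrier B" "\<phi> x \<otimes>\<^bsub>B\<^esub> b = \<one>\<^bsub>B\<^esub>" using B.Units_r_inv_ex by blast
    then obtain y where y: "y \<in> carrier R" "\<phi> (x \<otimes> y) = \<phi> \<one>" using ex ml[OF x] one by metis
    then have m: "x \<otimes> y \<ominus> \<one> \<in> PIdl \<rho>" using ker[of "x \<otimes> y" \<one>] x Pw_sub by auto
    show "x \<notin> PIdl \<rho>"
    proof
      assume "x \<in> PIdl \<rho>"
      then have "x \<otimes> y \<in> PIdl \<rho>" using ideal.I_r_closed[OF Pid] y by blast
      moreover have "(x \<otimes> y) \<ominus> \<zero> = x \<otimes> y" using x y by (simp add: a_minus_def)
      ultimately have "\<one> \<ominus> \<zero> \<in> PIdl \<rho>" using diff_mem_trans[OF Pid _ _ _ m, of \<zero>] x y by simp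
      then show False using one_notin by (simp add: a_minus_def)
    qed
  next
    assume "x \<notin> PIdl \<rho>"
    then obtain w where w: "w \<in> carrier R" "\<one> \<ominus> x \<otimes> w \<in> Pw l" using unit_mod_Pw[OF x] by blast
    then have "\<phi> \<one> = \<phi> (x \<otimes> w)" by (intro iffD2[OF ker]) (use x in auto)
    then have "\<phi> x \<otimes>\<^bsub>B\<^esub> \<phi> w = \<one>\<^bsub>B\<^esub>" using ml[OF x w(1)] one by simp
    then show "\<phi> x \<in> Units B" using cl[OF x] cl[OF w(1)] B.unit_factor[of "\<phi> x" "\<phi> w"] by simp
  qed
  have count: "card (carrier B) = q ^ l \<and> finite (carrier B)"
  proof -
    obtain T where T: "T \<subseteq> carrier R" "finite T" "card T = q ^ l"
      "\<forall>x\<in>carrier R. \<exists>!t. t \<in> T \<and> x \<ominus> t \<in> Pw l" using transversal_power[of l] by (elim exE conjE)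
    note T = T(1-3) bspec[OF T(4)]
    have "bij_betw \<phi> T (carrier B)" unfolding bij_betw_def
    proof
      show "inj_on \<phi> T"
      proof (rule inj_onI)
        fix s t assume "s \<in> T" "t \<in> T" "\<phi> s = \<phi> t"
        then show "s = t" using T(4)[of s] ker[of s s] ker[of s t] T(1) by blast
      qed
      show "\<phi> ` T = carrier B"
      proof (intro equalityI subsetI)
        fix b assume "b \<in> carrier B"
        then obtain x where x: "x \<in> carrier R" "b = \<phi> x" using ex by blast
        obtain t where t: "t \<in> T" "x \<ominus> t \<in> Pw l" using T(4)[OF x(1)] by blast
        then have "b = \<phi> t" using ker[of x t] x T(1) by auto
        then show "b \<in> \<phi> ` T" using t by blast
      qed (use cl T(1) in auto)
    qed
    then show ?thesis using bij_betw_same_card bij_betw_finite T by metis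
  qed
  then show "card (carrier B) = q ^ l" by simp
  show "card (carrier B - Units B) = q ^ (l - 1)"
  proof -
    obtain k where k: "l = Suc k" using l by (cases l) auto
    obtain T where T: "T \<subseteq> carrier R" "finite T" "card T = q ^ k"
      "\<forall>x\<in>carrier R. \<exists>!t. t \<in> T \<and> x \<ominus> t \<in> Pw k" using transversal_power[of k] by (elim exE conjE)
    note T = T(1-3) bspec[OF T(4)]
    \<comment> \<open>Multiplication by \<open>\<rho>\<close> identifies the classes modulo \<open>\<rho> ^ (l - 1)\<close> with the nonunits modulo \<open>\<rho> ^ l\<close>.\<close>
    have "bij_betw (\<lambda>t. \<phi> (t \<otimes> \<rho>)) T (carrier B - Units B)" unfolding bij_betw_def
    proof
      show "inj_on (\<lambda>t. \<phi> (t \<otimes> \<rho>)) T"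
      proof (rule inj_onI)
        fix s t assume st: "s \<in> T" "t \<in> T" "\<phi> (s \<otimes> \<rho>) = \<phi> (t \<otimes> \<rho>)"
        have c: "s \<in> carrier R" "t \<in> carrier R" using st T(1) by auto
        have "s \<otimes> \<rho> \<ominus> t \<otimes> \<rho> \<in> Pw (Suc k)" using ker[of "s \<otimes> \<rho>" "t \<otimes> \<rho>"] st(3) c rho k by simp
        moreover have "s \<otimes> \<rho> \<ominus> t \<otimes> \<rho> = (s \<ominus> t) \<otimes> \<rho>" using c rho by algebra
        ultimately have "s \<ominus> t \<in> Pw k" using Pw_Suc_cancel[of "s \<ominus> t" k] c by simp
        then show "s = t" using T(4)[OF c(1)] diff_self[OF c(1)] st(1,2) by blast
      qed
      show "(\<lambda>t. \<phi> (t \<otimes> \<rho>)) ` T = carrier B - Units B"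
      proof (intro equalityI subsetI)
        fix b assume "b \<in> (\<lambda>t. \<phi> (t \<otimes> \<rho>)) ` T"
        then obtain t where t: "t \<in> carrier R" "b = \<phi> (t \<otimes> \<rho>)" using T(1) by auto
        then have "t \<otimes> \<rho> \<in> PIdl \<rho>" unfolding cgenideal_def by blast
        then show "b \<in> carrier B - Units B" using unit[of "t \<otimes> \<rho>"] t cl rho by simp
      next
        fix b assume b: "b \<in> carrier B - Units B"
        then obtain x where x: "x \<in> carrier R" "b = \<phi> x" using ex by blast
        then have "x \<in> PIdl \<rho>" using unit b by blast
        then obtain y where y: "y \<in> carrier R" "x = y \<otimes> \<rho>" unfolding cgenideal_def by blast
        obtain t where t: "t \<in> T" "y \<ominus> t \<in> Pw k" using T(4)[OF y(1)] by blast
        have tc: "t \<in> carrier R" using t T(1) by auto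
        have "x \<ominus> t \<otimes> \<rho> = (y \<ominus> t) \<otimes> \<rho>" unfolding y(2) using y(1) tc rho by algebra
        then have "x \<ominus> t \<otimes> \<rho> \<in> Pw l" using Pw_Suc_mult[OF t(2)] k by simp
        then have "b = \<phi> (t \<otimes> \<rho>)" using ker[of x "t \<otimes> \<rho>"] x tc rho by simp
        then show "b \<in> (\<lambda>t. \<phi> (t \<otimes> \<rho>)) ` T" using t by blast
      qed
    qed
    then show ?thesis using bij_betw_same_card[of _ T "carrier B - Units B"] T k by fastforce
  qed
  have padd: "x \<oplus> y \<in> PIdl \<rho>" if "x \<in> PIdl \<rho>" "y \<in> PIdl \<rho>" for x y
    using that additive_subgroup.a_closed[OF ideal.axioms(1)[OF Pid]] by blast
  show "involutive_local_ring B circ"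
  proof (unfold_locales)
    show "finite (carrier B)" using count by simp
    show "\<one>\<^bsub>B\<^esub> \<noteq> \<zero>\<^bsub>B\<^esub>" using ker0[of \<one>] one one_notin_Pw[OF l] by auto
    show "\<one>\<^bsub>B\<^esub> \<oplus>\<^bsub>B\<^esub> \<one>\<^bsub>B\<^esub> \<in> Units B" using unit[of "\<one> \<oplus> \<one>"] two ad[of \<one> \<one>] one by simp
  next
    fix a b assume "a \<in> carrier B - Units B" "b \<in> carrier B - Units B"
    then obtain x y where "x \<in> carrier R" "a = \<phi> x" "x \<in> PIdl \<rho>" "y \<in> carrier R" "b = \<phi> y" "y \<in> PIdl \<rho>"
      using ex unit by (metis DiffE)
    then show "a \<oplus>\<^bsub>B\<^esub> b \<notin> Units B" using padd unit[of "x \<oplus> y"] ad[of x y] by simp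
  next
    obtain k where k: "l = Suc k" using l by (cases l) auto
    show "\<exists>z\<in>carrier B. z \<noteq> \<zero>\<^bsub>B\<^esub> \<and> (\<forall>x\<in>carrier B - Units B. z \<otimes>\<^bsub>B\<^esub> x = \<zero>\<^bsub>B\<^esub>)"
    proof (intro bexI conjI ballI)
      show "\<phi> (\<rho> [^] k) \<in> carrier B" using cl rho by simp
      show "\<phi> (\<rho> [^] k) \<noteq> \<zero>\<^bsub>B\<^esub>"
      proof
        assume "\<phi> (\<rho> [^] k) = \<zero>\<^bsub>B\<^esub>"
        then obtain w where w: "w \<in> carrier R" "\<rho> [^] k = w \<otimes> \<rho> [^] l"
          using ker0[of "\<rho> [^] k"] rho unfolding Pw_iff by auto
        have "\<one> \<otimes> \<rho> [^] k = (w \<otimes> \<rho>) \<otimes> \<rho> [^] k" using w rho unfolding k by (simp add: m_ac)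
        then have "\<one> = w \<otimes> \<rho>" using m_rcancel[OF pow_nonzero, of k \<one> "w \<otimes> \<rho>"] w rho by simp
        then show False using one_notin w unfolding cgenideal_def by blast
      qed
      fix b assume "b \<in> carrier B - Units B"
      then obtain x where x: "x \<in> carrier R" "b = \<phi> x" "x \<in> PIdl \<rho>" using ex unit by blast
      then obtain y where y: "y \<in> carrier R" "x = y \<otimes> \<rho>" unfolding cgenideal_def by blast
      have "\<rho> [^] k \<otimes> x = y \<otimes> \<rho> [^] l" unfolding k y(2) using y(1) rho by (simp add: m_ac)
      then have "\<rho> [^] k \<otimes> x \<in> Pw l" unfolding Pw_iff using y(1) by blast
      then show "\<phi> (\<rho> [^] k) \<otimes>\<^bsub>B\<^esub> b = \<zero>\<^bsub>B\<^esub>"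
        using ker0[of "\<rho> [^] k \<otimes> x"] ml[of "\<rho> [^] k" x] x rho by simp
    qed
  next
    show "circ \<in> ring_hom B B"
    proof (rule ring_hom_memI)
      fix a assume "a \<in> carrier B"
      then obtain x where x: "x \<in> carrier R" "a = \<phi> x" using ex by blast
      then show "circ a \<in> carrier B" using circ cl by simp
      fix b assume "b \<in> carrier B"
      then obtain y where y: "y \<in> carrier R" "b = \<phi> y" using ex by blast
      show "circ (a \<otimes>\<^bsub>B\<^esub> b) = circ a \<otimes>\<^bsub>B\<^esub> circ b"
        using x y circ[of "x \<otimes> y"] circ ml ring_hom_mult[OF sigma_hom x(1) y(1)] by simp
      show "circ (a \<oplus>\<^bsub>B\<^esub> b) = circ a \<oplus>\<^bsub>B\<^esub> circ b"
        using x y circ[of "x \<oplus> y"] circ ad ring_hom_add[OF sigma_hom x(1) y(1)] by simp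
    next
      show "circ \<one>\<^bsub>B\<^esub> = \<one>\<^bsub>B\<^esub>" using circ[of \<one>] one ring_hom_one[OF sigma_hom] by simp
    qed
  next
    fix a assume "a \<in> carrier B"
    then obtain x where x: "x \<in> carrier R" "a = \<phi> x" using ex by blast
    then show "circ (circ a) = a" using circ sigma_sigma by simp
    show "a \<ominus>\<^bsub>B\<^esub> circ a \<notin> Units B"
      using x circ[OF x(1)] mi[of x "\<sigma> x"] unit[of "x \<ominus> \<sigma> x"] sigma_residue by simp
  qed
qed

end

section \<open>Successive quotients by powers of the maximal ideal\<close>

context uniformized_domain
begin

context
  fixes l :: nat and A \<rr>
  assumes l: "l \<ge> 1" and A: "A = R Quot Pw (2 * l)" and rr: "maximalideal \<rr> A"
begin

abbreviation cls where "cls x \<equiv> Pw (2 * l) +> x"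

interpretation P2: ideal "Pw (2 * l)" R by (rule Pw_ideal)

interpretation A: cring A
  unfolding A by (rule P2.quotient_is_cring[OF R.is_cring])

lemma cls_hom: "cls \<in> ring_hom R A"
  unfolding A by (rule P2.rcos_ring_hom)

lemma cls_closed: "x \<in> carrier R \<Longrightarrow> cls x \<in> carrier A"
  using ring_hom_closed[OF cls_hom] .

lemma cls_cases: assumes "b \<in> carrier A" obtains x where "x \<in> carrier R" "b = cls x"
  using assms P2.quotient_cases unfolding A by metis

lemma cls_mult: "\<lbrakk>x \<in> carrier R; y \<in> carrier R\<rbrakk> \<Longrightarrow> cls (x \<otimes> y) = cls x \<otimes>\<^bsub>A\<^esub> cls y"
  using ring_hom_mult[OF cls_hom] .

lemma cls_pow: "cls (\<rho> [^] n) = cls \<rho> [^]\<^bsub>A\<^esub> (n::nat)"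
  using rho by (induction n) (simp_all add: ring_hom_one[OF cls_hom] cls_mult)

lemma cls_eq_iff: "\<lbrakk>x \<in> carrier R; y \<in> carrier R\<rbrakk> \<Longrightarrow> cls x = cls y \<longleftrightarrow> x \<ominus> y \<in> Pw (2 * l)"
  by (rule P2.coset_eq_iff)

lemma cls_zero: "cls \<zero> = \<zero>\<^bsub>A\<^esub>"
  using ring_hom_zero[OF cls_hom R.ring_axioms A.ring_axioms] .

text \<open>The class of \<open>\<rho>\<close> is nilpotent, so it lies in every maximal ideal, and elements prime to \<open>\<rho>\<close> are
units; hence the maximal ideal is generated by the class of \<open>\<rho>\<close>.\<close>

lemma rr_principal: "\<rr> = PIdl\<^bsub>A\<^esub> (cls \<rho>)"
proof
  interpret rr: maximalideal \<rr> A by (rule rr)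
  interpret pr: primeideal \<rr> A by (rule A.maximalideal_prime[OF rr])
  have nilp: "cls \<rho> \<in> \<rr>" if "cls \<rho> [^]\<^bsub>A\<^esub> n \<in> \<rr>" for n :: nat
    using that
  proof (induction n)
    case 0
    then show ?case using rr.one_imp_carrier cls_closed[OF rho(1)] by simp
  next
    case (Suc n)
    then show ?case using pr.I_prime[of "cls \<rho> [^]\<^bsub>A\<^esub> n" "cls \<rho>"] cls_closed[OF rho(1)] by auto
  qed
  have "\<rho> [^] (2 * l) \<in> Pw (2 * l)" using rho by (intro cgenideal_self) simp
  then have "cls \<rho> [^]\<^bsub>A\<^esub> (2 * l) = \<zero>\<^bsub>A\<^esub>"
    using cls_eq_iff[of "\<rho> [^] (2 * l)" \<zero>] rho cls_pow[of "2 * l"] cls_zero by (simp add: a_minus_def)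
  then show "PIdl\<^bsub>A\<^esub> (cls \<rho>) \<subseteq> \<rr>"
    using nilp[of "2 * l"] A.cgenideal_minimal[OF rr.is_ideal] by simp
  show "\<rr> \<subseteq> PIdl\<^bsub>A\<^esub> (cls \<rho>)"
  proof
    fix b assume b: "b \<in> \<rr>"
    obtain y where y: "y \<in> carrier R" "b = cls y" using cls_cases[OF rr.Icarr[OF b]] .
    have "y \<in> PIdl \<rho>"
    proof (rule ccontr)
      assume "y \<notin> PIdl \<rho>"
      then obtain w where w: "w \<in> carrier R" "\<one> \<ominus> y \<otimes> w \<in> Pw (2 * l)" using unit_mod_Pw[OF y(1)] by blast
      have "cls \<one> = cls (y \<otimes> w)" using iffD2[OF cls_eq_iff w(2)] y(1) w(1) by simp
      then have "b \<otimes>\<^bsub>A\<^esub> cls w = \<one>\<^bsub>A\<^esub>" using cls_mult y w ring_hom_one[OF cls_hom] by simp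
      then have "\<one>\<^bsub>A\<^esub> \<in> \<rr>" using rr.I_r_closed[OF b cls_closed[OF w(1)]] by simp
      then show False using rr.one_imp_carrier rr.I_notcarr by simp
    qed
    then obtain z where z: "z \<in> carrier R" "y = z \<otimes> \<rho>" unfolding cgenideal_def by blast
    have "b = cls z \<otimes>\<^bsub>A\<^esub> cls \<rho>" unfolding y(2) z(2) using z(1) rho by (simp add: cls_mult)
    then show "b \<in> PIdl\<^bsub>A\<^esub> (cls \<rho>)" unfolding cgenideal_def[of A] using cls_closed[OF z(1)] by blast
  qed
qed

lemma rr_power: "ideal_power A \<rr> l = cls ` Pw l"
proof -
  have "ideal_power A \<rr> l = PIdl\<^bsub>A\<^esub> (cls (\<rho> [^] l))"
    unfolding rr_principal using A.ideal_power_principal[OF cls_closed[OF rho(1)]] by (simp add: cls_pow)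
  also have "\<dots> = cls ` Pw l"
  proof (intro equalityI subsetI)
    fix b assume "b \<in> PIdl\<^bsub>A\<^esub> (cls (\<rho> [^] l))"
    then obtain c where c: "c \<in> carrier A" "b = c \<otimes>\<^bsub>A\<^esub> cls (\<rho> [^] l)" unfolding cgenideal_def[of A] by blast
    obtain z where z: "z \<in> carrier R" "c = cls z" using cls_cases[OF c(1)] .
    have "b = cls (z \<otimes> \<rho> [^] l)" using c z rho by (simp add: cls_mult)
    moreover have "z \<otimes> \<rho> [^] l \<in> Pw l" unfolding Pw_iff using z(1) by blast
    ultimately show "b \<in> cls ` Pw l" by (rule image_eqI)
  next
    fix b assume "b \<in> cls ` Pw l"
    then obtain p where p: "p \<in> Pw l" "b = cls p" by blast
    obtain z where z: "z \<in> carrier R" "b = cls (z \<otimes> \<rho> [^] l)" using p(1) unfolding p(2) Pw_iff by blast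
    have "b = cls z \<otimes>\<^bsub>A\<^esub> cls (\<rho> [^] l)" using z rho by (simp add: cls_mult)
    then show "b \<in> PIdl\<^bsub>A\<^esub> (cls (\<rho> [^] l))" unfolding cgenideal_def[of A] using cls_closed[OF z(1)] by blast
  qed
  finally show ?thesis .
qed

lemma star_hom: "quot_involution \<sigma> \<in> ring_hom A A"
  unfolding A by (rule P2.quot_involution_hom[OF sigma_hom sigma_Pw])

lemma star_al: "x \<in> carrier R \<Longrightarrow> \<sigma> ` cls x = cls (\<sigma> x)"
  by (rule P2.image_coset[OF sigma_hom sigma_Pw])

lemma star_rr_power: "quot_involution \<sigma> ` ideal_power A \<rr> l = ideal_power A \<rr> l"
proof -
  have "quot_involution \<sigma> ` (cls ` Pw l) = (\<lambda>x. cls (\<sigma> x)) ` Pw l"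
    unfolding image_image using star_al Pw_carrier by (intro image_cong refl) blast
  also have "\<dots> = cls ` (\<sigma> ` Pw l)" by (simp only: image_image)
  finally show ?thesis unfolding rr_power sigma_Pw .
qed

lemma rr_power_ideal: "ideal (ideal_power A \<rr> l) A"
proof -
  have "ideal_power A \<rr> l = PIdl\<^bsub>A\<^esub> (cls \<rho> [^]\<^bsub>A\<^esub> l)"
    unfolding rr_principal by (rule A.ideal_power_principal[OF cls_closed[OF rho(1)]])
  then show ?thesis using cls_closed[OF rho(1)] by (simp add: A.cgenideal_ideal)
qed

text \<open>Reducing modulo \<open>\<rho> ^ (2 l)\<close> and then modulo the \<open>l\<close>-th power of the maximal ideal is the same as
reducing modulo \<open>\<rho> ^ l\<close>, compatibly with the involutions.\<close>

lemma involutive_local_double_quotient: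
  shows "involutive_local_ring (A Quot ideal_power A \<rr> l) (quot_involution (quot_involution \<sigma>))"
    and "card (carrier (A Quot ideal_power A \<rr> l)) = q ^ l"
    and "card (carrier (A Quot ideal_power A \<rr> l) - Units (A Quot ideal_power A \<rr> l)) = q ^ (l - 1)"
proof -
  let ?J = "ideal_power A \<rr> l"
  interpret J: ideal ?J A by (rule rr_power_ideal)
  let ?f = "\<lambda>x. ?J +>\<^bsub>A\<^esub> cls x"
  have B: "cring (A Quot ?J)" by (rule J.quotient_is_cring[OF A.is_cring])
  have hom: "?f \<in> ring_hom R (A Quot ?J)"
    using ring_hom_trans[OF cls_hom J.rcos_ring_hom] by (simp add: comp_def)
  have surj: "?f ` carrier R = carrier (A Quot ?J)"
  proof (intro equalityI subsetI)
    fix b assume "b \<in> carrier (A Quot ?J)"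
    then obtain c where c: "c \<in> carrier A" "b = ?J +>\<^bsub>A\<^esub> c" by (rule J.quotient_cases)
    obtain x where "x \<in> carrier R" "c = cls x" using cls_cases[OF c(1)] .
    then show "b \<in> ?f ` carrier R" using c(2) by blast
  qed (use ring_hom_closed[OF hom] in auto)
  have ker: "?f x = ?f y \<longleftrightarrow> x \<ominus> y \<in> Pw l" if xy: "x \<in> carrier R" "y \<in> carrier R" for x y
  proof -
    have "?f x = ?f y \<longleftrightarrow> cls x \<ominus>\<^bsub>A\<^esub> cls y \<in> cls ` Pw l"
      using J.coset_eq_iff[OF cls_closed[OF xy(1)] cls_closed[OF xy(2)]] by (simp only: rr_power)
    also have "cls x \<ominus>\<^bsub>A\<^esub> cls y = cls (x \<ominus> y)" unfolding A using xy by (rule P2.coset_minus)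
    also have "cls (x \<ominus> y) \<in> cls ` Pw l \<longleftrightarrow> x \<ominus> y \<in> Pw l"
    proof
      assume "cls (x \<ominus> y) \<in> cls ` Pw l"
      then obtain p where p: "p \<in> Pw l" "cls (x \<ominus> y) = cls p" by blast
      then have "(x \<ominus> y) \<ominus> p \<in> Pw (2 * l)" using cls_eq_iff xy Pw_carrier by simp
      then have "(x \<ominus> y) \<ominus> p \<in> Pw l" using Pw_antimono[of l "2 * l"] by auto
      then have "((x \<ominus> y) \<ominus> p) \<oplus> p \<in> Pw l"
        using additive_subgroup.a_closed[OF ideal.axioms(1)[OF Pw_ideal]] p(1) by blast
      moreover have "((x \<ominus> y) \<ominus> p) \<oplus> p = x \<ominus> y" using xy Pw_carrier[OF p(1)] by algebra
      ultimately show "x \<ominus> y \<in> Pw l" by simp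
    qed blast
    finally show ?thesis .
  qed
  have circ: "quot_involution (quot_involution \<sigma>) (?f x) = ?f (\<sigma> x)" if x: "x \<in> carrier R" for x
    using J.image_coset[OF star_hom star_rr_power cls_closed[OF x]] star_al[OF x] by simp
  show "involutive_local_ring (A Quot ?J) (quot_involution (quot_involution \<sigma>))"
    "card (carrier (A Quot ?J)) = q ^ l" "card (carrier (A Quot ?J) - Units (A Quot ?J)) = q ^ (l - 1)"
    using involutive_local_quotient[OF B hom surj ker circ l] by auto
qed

end
end

section \<open>Ramified quadratic extensions\<close>

text \<open>Elements of valuation zero are the units of the valuation ring; this is what makes the valuation
ideal maximal.\<close>

lemma val_ring_basics:
  fixes F (structure)
  assumes "field F" and sub: "subfield K F" and nl: "nonarch_local_field (F\<lparr>carrier := K\<rparr>) v"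
  shows "subring (val_ring (F\<lparr>carrier := K\<rparr>) v) F"
    and "val_ideal (F\<lparr>carrier := K\<rparr>) v \<subseteq> val_ring (F\<lparr>carrier := K\<rparr>) v"
    and "ideal (val_ideal (F\<lparr>carrier := K\<rparr>) v) (F\<lparr>carrier := val_ring (F\<lparr>carrier := K\<rparr>) v\<rparr>)"
    and "\<one> \<notin> val_ideal (F\<lparr>carrier := K\<rparr>) v"
    and "\<And>x. x \<in> val_ring (F\<lparr>carrier := K\<rparr>) v - val_ideal (F\<lparr>carrier := K\<rparr>) v \<Longrightarrow>
           \<exists>y\<in>val_ring (F\<lparr>carrier := K\<rparr>) v. y \<otimes> x = \<one>"
proof -
  interpret F: field F by fact
  let ?O = "val_ring (F\<lparr>carrier := K\<rparr>) v" and ?p = "val_ideal (F\<lparr>carrier := K\<rparr>) v"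
  interpret K: nonarch_local_field "F\<lparr>carrier := K\<rparr>" v by (rule nl)
  have KF: "K \<subseteq> carrier F" using sub by (rule subfieldE(3))
  have Kr: "subring K F" using subfieldE(1)[OF sub] subcring.axioms(1) by blast
  have Oiff: "x \<in> ?O \<longleftrightarrow> x \<in> K \<and> (x = \<zero> \<or> v x \<ge> 0)" for x by (simp add: val_ring_def)
  have piff: "x \<in> ?p \<longleftrightarrow> x \<in> K \<and> (x = \<zero> \<or> v x > 0)" for x by (simp add: val_ideal_def)
  have vm: "v (x \<otimes> y) = v x + v y" if "x \<in> K" "y \<in> K" "x \<noteq> \<zero>" "y \<noteq> \<zero>" for x y
    using K.val_mult[of x y] that by simp
  have va: "v (x \<oplus> y) \<ge> min (v x) (v y)" if "x \<in> K" "y \<in> K" "x \<noteq> \<zero>" "y \<noteq> \<zero>" "x \<oplus> y \<noteq> \<zero>" for x y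
    using K.val_add[of x y] that by simp
  have one: "\<one> \<in> K" "\<one> \<noteq> \<zero>" using subringE(3)[OF Kr] by auto
  have v1: "v \<one> = 0" using vm[OF one(1) one(1) one(2) one(2)] by simp
  have mone: "\<ominus> \<one> \<in> K" "\<ominus> \<one> \<noteq> \<zero>" using subringE(5)[OF Kr one(1)] by auto
  have "(\<ominus> \<one>) \<otimes> (\<ominus> \<one>) = \<one>" by (simp add: F.l_minus F.r_minus)
  then have vm1: "v (\<ominus> \<one>) = 0" using vm[OF mone(1) mone(1) mone(2) mone(2)] v1 by simp
  have vneg: "v (\<ominus> x) = v x" if "x \<in> K" "x \<noteq> \<zero>" for x
  proof -
    have "\<ominus> x = (\<ominus> \<one>) \<otimes> x" using that KF by (auto simp: F.l_minus)
    then show ?thesis using vm[OF mone(1) that(1) mone(2) that(2)] vm1 by simp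
  qed
  have Kcl: "x \<oplus> y \<in> K" "x \<otimes> y \<in> K" "\<ominus> x \<in> K" if "x \<in> K" "y \<in> K" for x y
    using that subringE(5-7)[OF Kr] by auto
  have Kcar: "x \<in> carrier F" if "x \<in> K" for x using that KF by auto
  have addO: "x \<oplus> y \<in> ?O" if "x \<in> ?O" "y \<in> ?O" for x y
    using that va[of x y] Kcl(1)[of x y] Kcar unfolding Oiff
    by (cases "x = \<zero>"; cases "y = \<zero>") auto
  have addp: "x \<oplus> y \<in> ?p" if "x \<in> ?p" "y \<in> ?p" for x y
    using that va[of x y] Kcl(1)[of x y] Kcar unfolding piff
    by (cases "x \<oplus> y = \<zero>"; cases "x = \<zero>"; cases "y = \<zero>") (auto simp: min_le_iff_disj)
  have multO: "x \<otimes> y \<in> ?O" if "x \<in> ?O" "y \<in> ?O" for x y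
    using that vm[of x y] Kcl(2)[of x y] Kcar unfolding Oiff
    by (cases "x = \<zero>"; cases "y = \<zero>") auto
  have multp: "x \<otimes> y \<in> ?p" if "x \<in> ?O" "y \<in> ?p" for x y
    using that vm[of x y] Kcl(2)[of x y] Kcar unfolding Oiff piff
    by (cases "x = \<zero>"; cases "y = \<zero>") auto
  have negO: "\<ominus> x \<in> ?O" if "x \<in> ?O" for x
    using that vneg[of x] Kcl(3)[of x x] unfolding Oiff by (cases "x = \<zero>") auto
  have negp: "\<ominus> x \<in> ?p" if "x \<in> ?p" for x
    using that vneg[of x] Kcl(3)[of x x] unfolding piff by (cases "x = \<zero>") auto
  show subO: "subring ?O F"
  proof (rule F.subringI)
    show "?O \<subseteq> carrier F" using Kcar unfolding Oiff subset_iff by blast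
    show "\<one> \<in> ?O" using one v1 by (simp add: Oiff)
  qed (use addO multO negO in auto)
  show pO: "?p \<subseteq> ?O" unfolding subset_iff Oiff piff by auto
  interpret O: ring "F\<lparr>carrier := ?O\<rparr>" by (rule F.subring_is_ring[OF subO])
  show "ideal ?p (F\<lparr>carrier := ?O\<rparr>)"
  proof (rule idealI[OF O.ring_axioms])
    show "subgroup ?p (add_monoid (F\<lparr>carrier := ?O\<rparr>))"
    proof (rule O.add.subgroupI)
      show "?p \<subseteq> carrier (F\<lparr>carrier := ?O\<rparr>)" using pO by simp
      have "\<zero> \<in> ?p" using subringE(2)[OF Kr] by (simp add: piff)
      then show "?p \<noteq> {}" by blast
    next
      fix a assume a: "a \<in> ?p"
      have aO: "a \<in> ?O" using a pO by blast
      have "a \<in> carrier F" using a Kcar by (simp add: piff)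
      then have "\<ominus>\<^bsub>F\<lparr>carrier := ?O\<rparr>\<^esub> a = \<ominus> a"
        using negO[OF aO] aO by (intro O.minus_equality) (simp_all add: F.l_neg)
      then show "\<ominus>\<^bsub>F\<lparr>carrier := ?O\<rparr>\<^esub> a \<in> ?p" using negp[OF a] by simp
    next
      fix a b assume "a \<in> ?p" "b \<in> ?p"
      then show "a \<oplus>\<^bsub>F\<lparr>carrier := ?O\<rparr>\<^esub> b \<in> ?p" using addp by simp
    qed
  next
    fix a x assume ax: "a \<in> ?p" "x \<in> carrier (F\<lparr>carrier := ?O\<rparr>)"
    then show "x \<otimes>\<^bsub>F\<lparr>carrier := ?O\<rparr>\<^esub> a \<in> ?p" using multp by simp
    moreover have "x \<in> carrier F" "a \<in> carrier F" using ax Kcar by (auto simp: Oiff piff)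
    ultimately show "a \<otimes>\<^bsub>F\<lparr>carrier := ?O\<rparr>\<^esub> x \<in> ?p" by (simp add: F.m_comm)
  qed
  show "\<one> \<notin> ?p" using one v1 by (simp add: piff)
  fix x assume x: "x \<in> ?O - ?p"
  then have xk: "x \<in> K" "x \<noteq> \<zero>" "v x = 0" by (auto simp: Oiff piff)
  have i: "inv x \<in> K - {\<zero>}" using F.subfield_m_inv(1)[OF sub] xk by blast
  have e: "inv x \<otimes> x = \<one>" using F.subfield_m_inv(3)[OF sub] xk by blast
  have "v (inv x) = 0" using vm[of "inv x" x] i xk e v1 by simp
  then show "\<exists>y\<in>?O. y \<otimes> x = \<one>" using i e by (intro bexI[of _ "inv x"]) (auto simp: Oiff)
qed

text \<open>Every element of \<open>\<R>\<close> is \<open>a + b \<rho>\<close> with \<open>a, b \<in> \<O>\<close>, because \<open>\<rho>\<^sup>2\<close> lies in \<open>\<O>\<close>.  So the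
inclusion of \<open>\<O>\<close> induces an isomorphism of residue fields, its kernel \<open>\<O> \<inter> \<P>\<close> being the maximal
ideal \<open>\<pp>\<close>, and \<open>a + b \<rho> \<mapsto> a - b \<rho>\<close> is trivial modulo \<open>\<rho>\<close>.\<close>

lemma ramified_uniformized_domain:
  fixes F (structure)
  assumes fld: "field F" and subK: "subfield K F"
    and local: "nonarch_local_field (F\<lparr>carrier := K\<rparr>) v"
    and O: "\<O> = val_ring (F\<lparr>carrier := K\<rparr>) v"
    and p: "\<pp> = val_ideal (F\<lparr>carrier := K\<rparr>) v"
    and q: "q = card (carrier (F\<lparr>carrier := \<O>\<rparr> Quot \<pp>))"
    and odd: "odd (ring_char (F\<lparr>carrier := \<O>\<rparr> Quot \<pp>))"
    and rho: "\<rho> \<in> carrier F" "\<rho> \<otimes> \<rho> = \<pi>" and pi: "\<pi> \<in> \<O>" "\<pi> \<noteq> \<zero>"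
    and R: "\<R> = ring.simple_extension F \<O> \<rho>"
    and max: "maximalideal \<P> (F\<lparr>carrier := \<R>\<rparr>)"
    and P: "\<P> = PIdl\<^bsub>F\<lparr>carrier := \<R>\<rparr>\<^esub> \<rho>"
    and pP: "\<pp> \<subseteq> \<P>"
    and sigma: "\<sigma> \<in> ring_hom (F\<lparr>carrier := \<R>\<rparr>) (F\<lparr>carrier := \<R>\<rparr>)"
    and sigmaO: "\<forall>x\<in>\<O>. \<sigma> x = x" and sigma_rho: "\<sigma> \<rho> = \<ominus> \<rho>"
  shows "uniformized_domain (F\<lparr>carrier := \<R>\<rparr>) \<rho> \<sigma> q"
proof -
  interpret F: field F by (rule fld)
  note val = val_ring_basics[OF fld subK local, folded O p]
  let ?X = "F\<lparr>carrier := \<R>\<rparr>"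
  have subR: "subring \<R> F" unfolding R by (rule F.simple_extension_is_subring[OF val(1) rho(1)])
  interpret X: domain ?X by (rule F.subring_is_domain[OF subR])
  interpret Or: ring "F\<lparr>carrier := \<O>\<rparr>" by (rule F.subring_is_ring[OF val(1)])
  interpret p: ideal \<pp> "F\<lparr>carrier := \<O>\<rparr>" by (rule val(3))
  interpret P: maximalideal \<P> ?X by (rule max)
  have OR: "\<O> \<subseteq> \<R>" unfolding R by (rule F.simple_extension_incl[OF subringE(1)[OF val(1)] rho(1)])
  have rR: "\<rho> \<in> \<R>" unfolding R by (rule F.simple_extension_mem[OF val(1) rho(1)])
  have OF: "x \<in> carrier F" if "x \<in> \<O>" for x using subringE(1)[OF val(1)] that by blast
  have r0: "\<rho> \<noteq> \<zero>" using rho pi(2) by auto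
  have Oadd: "x \<oplus> y \<in> \<O>" and Omult: "x \<otimes> y \<in> \<O>" if "x \<in> \<O>" "y \<in> \<O>" for x y
    using subringE(6,7)[OF val(1)] that by auto
  have repr: "\<exists>a\<in>\<O>. \<exists>b\<in>\<O>. x = a \<oplus> b \<otimes> \<rho>" if "x \<in> \<R>" for x
    using that unfolding R
  proof (induction x rule: F.simple_extension.induct)
    case zero
    show ?case using subringE(2)[OF val(1)] rho by (intro bexI[of _ "\<zero>"]) auto
  next
    case (lin k1 k2)
    then obtain a b where ab: "a \<in> \<O>" "b \<in> \<O>" "k1 = a \<oplus> b \<otimes> \<rho>" by blast
    have c: "a \<in> carrier F" "b \<in> carrier F" "k2 \<in> carrier F" using OF ab lin by auto
    have "k1 \<otimes> \<rho> \<oplus> k2 = (k2 \<oplus> b \<otimes> (\<rho> \<otimes> \<rho>)) \<oplus> a \<otimes> \<rho>"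
      unfolding ab(3) using c rho(1) by (simp add: F.l_distr F.m_assoc F.a_ac)
    moreover have "k2 \<oplus> b \<otimes> (\<rho> \<otimes> \<rho>) \<in> \<O>" unfolding rho(2) using ab lin pi Oadd Omult by simp
    ultimately show ?case using ab(1) by blast
  qed
  have OP: "x \<in> \<pp>" if x: "x \<in> \<O>" "x \<in> \<P>" for x
  proof (rule ccontr)
    assume "x \<notin> \<pp>"
    then obtain y where y: "y \<in> \<O>" "y \<otimes> x = \<one>" using val(5) x by blast
    then have "\<one> \<in> \<P>" using P.I_l_closed[OF x(2), of y] OR by auto
    then show False using P.one_imp_carrier P.I_notcarr by simp
  qed
  have brP: "b \<otimes> \<rho> \<in> \<P>" if "b \<in> \<O>" for b
    unfolding P cgenideal_def using that OR by auto
  have minus: "x \<ominus>\<^bsub>?X\<^esub> y = x \<ominus> y" if "x \<in> \<R>" "y \<in> \<R>" for x y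
  proof -
    have "\<ominus> y \<in> \<R>" "y \<in> carrier F" using subringE(1,5)[OF subR] that by auto
    then have "\<ominus>\<^bsub>?X\<^esub> y = \<ominus> y" using that by (intro X.minus_equality) (auto simp: F.l_neg)
    then show ?thesis by (simp add: a_minus_def)
  qed
  have Ominus: "x \<ominus>\<^bsub>F\<lparr>carrier := \<O>\<rparr>\<^esub> y = x \<ominus> y" "x \<ominus> y \<in> \<O>" if "x \<in> \<O>" "y \<in> \<O>" for x y
  proof -
    have n: "\<ominus> y \<in> \<O>" "y \<in> carrier F" using subringE(1,5)[OF val(1)] that by auto
    then have "\<ominus>\<^bsub>F\<lparr>carrier := \<O>\<rparr>\<^esub> y = \<ominus> y" using that by (intro Or.minus_equality) (auto simp: F.l_neg)
    then show "x \<ominus>\<^bsub>F\<lparr>carrier := \<O>\<rparr>\<^esub> y = x \<ominus> y" by (simp add: a_minus_def)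
    show "x \<ominus> y \<in> \<O>" using n that Oadd by (simp add: a_minus_def)
  qed
  show ?thesis
  proof (rule uniformized_domain.intro[OF X.domain_axioms], rule uniformized_domain_axioms.intro)
    show "\<rho> \<in> carrier ?X" "\<rho> \<noteq> \<zero>\<^bsub>?X\<^esub>" using rR r0 by auto
    show "maximalideal (PIdl\<^bsub>?X\<^esub> \<rho>) ?X" using max P by simp
    show "\<sigma> \<in> ring_hom ?X ?X" by (rule sigma)
  next
    let ?Q = "F\<lparr>carrier := \<O>\<rparr> Quot \<pp>"
    have fin: "finite (carrier ?Q)"
      using nonarch_local_field.finite_residue[OF local] O p by simp
    define rep where "rep C = (SOME x. x \<in> \<O> \<and> C = \<pp> +>\<^bsub>F\<lparr>carrier := \<O>\<rparr>\<^esub> x)" for C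
    have rep: "rep C \<in> \<O> \<and> C = \<pp> +>\<^bsub>F\<lparr>carrier := \<O>\<rparr>\<^esub> rep C" if "C \<in> carrier ?Q" for C
      unfolding rep_def by (rule someI_ex) (use p.quotient_cases[OF that] in auto)
    have inj: "inj_on rep (carrier ?Q)" by (rule inj_onI) (metis rep)
    let ?T = "rep ` carrier ?Q"
    have coset: "\<pp> +>\<^bsub>F\<lparr>carrier := \<O>\<rparr>\<^esub> a = \<pp> +>\<^bsub>F\<lparr>carrier := \<O>\<rparr>\<^esub> b \<longleftrightarrow> a \<ominus> b \<in> \<pp>" if "a \<in> \<O>" "b \<in> \<O>" for a b
      using p.coset_eq_iff[of a b] that Ominus by simp
    have "\<exists>!t. t \<in> ?T \<and> x \<ominus>\<^bsub>?X\<^esub> t \<in> \<P>" if x: "x \<in> \<R>" for x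
    proof -
      obtain a b where ab: "a \<in> \<O>" "b \<in> \<O>" "x = a \<oplus> b \<otimes> \<rho>" using repr[OF x] by blast
      let ?C = "\<pp> +>\<^bsub>F\<lparr>carrier := \<O>\<rparr>\<^esub> a"
      have C: "?C \<in> carrier ?Q" using ab by (intro p.coset_in_quotient) simp
      have r: "rep ?C \<in> \<O>" "a \<ominus> rep ?C \<in> \<pp>" using rep[OF C] coset[OF ab(1)] by auto
      show ?thesis
      proof (rule ex1I[of _ "rep ?C"])
        have "x \<ominus>\<^bsub>?X\<^esub> rep ?C = x \<ominus> rep ?C" using minus x r(1) OR by blast
        also have "\<dots> = (a \<ominus> rep ?C) \<oplus> b \<otimes> \<rho>"
          unfolding ab(3) a_minus_def using OF[OF ab(1)] OF[OF ab(2)] OF[OF r(1)] rho(1) by (simp add: F.a_ac)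
        also have "\<dots> \<in> \<P>" using P.a_closed[of "a \<ominus> rep ?C" "b \<otimes> \<rho>"] r(2) pP brP[OF ab(2)] by auto
        finally show "rep ?C \<in> ?T \<and> x \<ominus>\<^bsub>?X\<^esub> rep ?C \<in> \<P>" using C by blast
      next
        fix t assume t: "t \<in> ?T \<and> x \<ominus>\<^bsub>?X\<^esub> t \<in> \<P>"
        then obtain D where D: "D \<in> carrier ?Q" "t = rep D" by blast
        have tO: "t \<in> \<O>" using rep[OF D(1)] D(2) by simp
        have e: "x \<ominus>\<^bsub>?X\<^esub> t = (a \<ominus> t) \<oplus> b \<otimes> \<rho>"
        proof -
          have "x \<ominus>\<^bsub>?X\<^esub> t = x \<ominus> t" using minus x tO OR by blast
          also have "\<dots> = (a \<ominus> t) \<oplus> b \<otimes> \<rho>"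
            unfolding ab(3) a_minus_def using OF[OF ab(1)] OF[OF ab(2)] OF[OF tO] rho(1) by (simp add: F.a_ac)
          finally show ?thesis .
        qed
        have at: "a \<ominus> t \<in> \<O>" using Ominus(2) ab tO by blast
        have nb: "\<ominus> b \<in> \<O>" using subringE(5)[OF val(1)] ab by blast
        have "(x \<ominus>\<^bsub>?X\<^esub> t) \<oplus> (\<ominus> b) \<otimes> \<rho> \<in> \<P>"
          using P.a_closed[of "x \<ominus>\<^bsub>?X\<^esub> t" "(\<ominus> b) \<otimes> \<rho>"] t brP[OF nb] by simp
        also have "(x \<ominus>\<^bsub>?X\<^esub> t) \<oplus> (\<ominus> b) \<otimes> \<rho> = a \<ominus> t"
          unfolding e using OF[OF at] OF[OF ab(2)] rho(1) by (simp add: F.a_assoc F.l_minus F.r_neg)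
        finally have "a \<ominus> t \<in> \<pp>" using OP at by blast
        then have "?C = D" using coset[OF ab(1) tO] rep[OF D(1)] D(2) by simp
        then show "t = rep ?C" using D(2) by simp
      qed
    qed
    moreover have "?T \<subseteq> \<R>" using rep OR by blast
    moreover have "card ?T = q" using card_image[OF inj] q by simp
    ultimately show "\<exists>T\<subseteq>carrier ?X. finite T \<and> card T = q \<and>
        (\<forall>x\<in>carrier ?X. \<exists>!t. t \<in> T \<and> x \<ominus>\<^bsub>?X\<^esub> t \<in> PIdl\<^bsub>?X\<^esub> \<rho>)"
      unfolding P[symmetric] using fin by (intro exI[of _ ?T]) simp
  next
    have neg: "\<ominus>\<^bsub>?X\<^esub> \<rho> = \<ominus> \<rho>"
      using rR subringE(5)[OF subR rR] rho by (intro X.minus_equality) (auto simp: F.l_neg)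
    show srho: "\<sigma> \<rho> = \<ominus>\<^bsub>?X\<^esub> \<rho>" using sigma_rho neg by simp
    have nR: "\<ominus> \<rho> \<in> \<R>" using subringE(5)[OF subR rR] .
    have sab: "\<sigma> (a \<oplus> b \<otimes> \<rho>) = a \<oplus> b \<otimes> (\<ominus> \<rho>)"
      if ab: "a \<in> \<O>" "b \<in> \<O>" for a b
    proof -
      have c: "a \<in> carrier ?X" "b \<in> carrier ?X" "\<rho> \<in> carrier ?X" "b \<otimes>\<^bsub>?X\<^esub> \<rho> \<in> carrier ?X"
        using ab OR rR X.m_closed[of b \<rho>] by auto
      show ?thesis
        using ring_hom_add[OF sigma c(1,4)] ring_hom_mult[OF sigma c(2,3)] sigmaO ab sigma_rho by simp
    qed
    fix x assume "x \<in> carrier ?X"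
    then have xR: "x \<in> \<R>" by simp
    obtain a b where ab: "a \<in> \<O>" "b \<in> \<O>" "x = a \<oplus> b \<otimes> \<rho>" using repr[OF xR] by blast
    have c: "a \<in> carrier F" "b \<in> carrier F" using OF ab by auto
    have nb: "\<ominus> b \<in> \<O>" using subringE(5)[OF val(1)] ab by blast
    have sx: "\<sigma> x = a \<oplus> (\<ominus> b) \<otimes> \<rho>"
      unfolding ab(3) sab[OF ab(1,2)] using c rho(1) by (simp add: F.l_minus F.r_minus)
    show "\<sigma> (\<sigma> x) = x"
      unfolding sx sab[OF ab(1) nb] unfolding ab(3) using c rho(1) by (simp add: F.l_minus F.r_minus)
    have sxR: "\<sigma> x \<in> \<R>" using ring_hom_closed[OF sigma] xR by simp
    have "x \<ominus>\<^bsub>?X\<^esub> \<sigma> x = x \<ominus> \<sigma> x" using minus xR sxR by blast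
    also have "\<dots> = (b \<oplus> b) \<otimes> \<rho>" unfolding sx unfolding ab(3) using c rho(1) by algebra
    also have "\<dots> \<in> \<P>" using brP[OF Oadd[OF ab(2) ab(2)]] .
    finally show "x \<ominus>\<^bsub>?X\<^esub> \<sigma> x \<in> PIdl\<^bsub>?X\<^esub> \<rho>" unfolding P .
  next
    show "\<one>\<^bsub>?X\<^esub> \<oplus>\<^bsub>?X\<^esub> \<one>\<^bsub>?X\<^esub> \<notin> PIdl\<^bsub>?X\<^esub> \<rho>"
    proof
      let ?Q = "F\<lparr>carrier := \<O>\<rparr> Quot \<pp>"
      assume "\<one>\<^bsub>?X\<^esub> \<oplus>\<^bsub>?X\<^esub> \<one>\<^bsub>?X\<^esub> \<in> PIdl\<^bsub>?X\<^esub> \<rho>"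
      then have "\<one> \<oplus> \<one> \<in> \<P>" unfolding P by simp
      moreover have oneO: "\<one> \<in> \<O>" using subringE(3)[OF val(1)] .
      ultimately have tp: "\<one> \<oplus> \<one> \<in> \<pp>" using OP Oadd by blast
      interpret Q: ring ?Q by (rule p.quotient_is_ring)
      have "\<one>\<^bsub>?Q\<^esub> \<oplus>\<^bsub>?Q\<^esub> \<one>\<^bsub>?Q\<^esub> = \<pp> +>\<^bsub>F\<lparr>carrier := \<O>\<rparr>\<^esub> (\<one> \<oplus> \<one>)"
        unfolding p.coset_one using p.coset_add[of "\<one>" "\<one>"] oneO by simp
      also have "\<dots> = \<zero>\<^bsub>?Q\<^esub>" using p.a_rcos_const[OF tp] by (simp add: FactRing_def)
      finally have "[(2::nat)] \<cdot>\<^bsub>?Q\<^esub> \<one>\<^bsub>?Q\<^esub> = \<zero>\<^bsub>?Q\<^esub>" by (simp add: numeral_2_eq_2)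
      \<comment> \<open>If \<open>2\<close> were in \<open>\<P>\<close> it would vanish in the residue field of \<open>\<O>\<close>, whose characteristic is odd.\<close>
      then have "ring_char ?Q dvd 2"
        unfolding ring_char_def using Q.add.pow_eq_id[of "\<one>\<^bsub>?Q\<^esub>" 2] by simp
      then have "ring_char ?Q = 1" using odd by (metis dvd_refl even_numeral odd_one prime_nat_iff two_is_prime_nat)
      then have "\<one>\<^bsub>?Q\<^esub> = \<zero>\<^bsub>?Q\<^esub>"
        unfolding ring_char_def using Q.add.ord_eq_1[of "\<one>\<^bsub>?Q\<^esub>"] by simp
      then have "\<pp> +>\<^bsub>F\<lparr>carrier := \<O>\<rparr>\<^esub> \<one> = \<pp>" by (simp add: FactRing_def)
      then have "\<one> \<in> \<pp>" using p.rcos_const_imp_mem[of "\<one>"] oneO by simp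
      then show False using val(4) by simp
    qed
  qed
qed

section \<open>The index of the stabilizer of a primitive vector\<close>

theorem proposition8p1:
  fixes F :: "'a ring" and K \<O> \<pp> \<R> \<P> :: "'a set" and v :: "'a \<Rightarrow> int"
    and \<rho> \<pi> :: 'a and \<sigma> :: "'a \<Rightarrow> 'a" and q l f :: nat
    and A :: "'a set ring" and \<rr> :: "'a set set" and star :: "'a set \<Rightarrow> 'a set"
    and B :: "'a set set ring" and circ :: "'a set set \<Rightarrow> 'a set set"
    and V :: "('a set, 'v) module" and h :: "'v \<Rightarrow> 'v \<Rightarrow> 'a set"
    and V' :: "('a set set, 'v set) module" and h' :: "'v set \<Rightarrow> 'v set \<Rightarrow> 'a set set"
    and U :: "('v set \<Rightarrow> 'v set) monoid" and S :: "('v set \<Rightarrow> 'v set) set"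
    and u :: "'v set" and t :: "'a set set"
  \<comment> \<open>the local field \<open>K\<close>\<close>
  assumes "field F" and "subfield K F"
    and "nonarch_local_field (F\<lparr>carrier := K\<rparr>) v"
    and "\<O> = val_ring (F\<lparr>carrier := K\<rparr>) v"
    and "\<pp> = val_ideal (F\<lparr>carrier := K\<rparr>) v"
    and "q = card (carrier (F\<lparr>carrier := \<O>\<rparr> Quot \<pp>))"
    and "odd (ring_char (F\<lparr>carrier := \<O>\<rparr> Quot \<pp>))"
  \<comment> \<open>the ramified quadratic extension \<open>F\<close>\<close>
    and "ring.dimension F 2 K (carrier F)"
    and "\<R> = integral_closure_in F \<O>"
    and "\<rho> \<in> carrier F" and "\<rho> \<otimes>\<^bsub>F\<^esub> \<rho> = \<pi>"
    and "\<pi> \<in> \<O>" and "ring_prime\<^bsub>F\<lparr>carrier := \<O>\<rparr>\<^esub> \<pi>"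
    and "\<R> = ring.simple_extension F \<O> \<rho>"
    and "maximalideal \<P> (F\<lparr>carrier := \<R>\<rparr>)"
    and "\<P> = PIdl\<^bsub>F\<lparr>carrier := \<R>\<rparr>\<^esub> \<rho>"
    and "Idl\<^bsub>F\<lparr>carrier := \<R>\<rparr>\<^esub> \<pp> = ideal_power (F\<lparr>carrier := \<R>\<rparr>) \<P> 2"
    and "\<sigma> \<in> ring_hom (F\<lparr>carrier := \<R>\<rparr>) (F\<lparr>carrier := \<R>\<rparr>)"
    and "\<forall>x\<in>\<O>. \<sigma> x = x" and "\<sigma> \<rho> = \<ominus>\<^bsub>F\<^esub> \<rho>"
  \<comment> \<open>the finite rings \<open>A\<close> and \<open>B\<close>\<close>
    and "l \<ge> 1"
    and "A = F\<lparr>carrier := \<R>\<rparr> Quot ideal_power (F\<lparr>carrier := \<R>\<rparr>) \<P> (2 * l)"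
    and "star = quot_involution \<sigma>"
    and "maximalideal \<rr> A"
    and "B = A Quot ideal_power A \<rr> l"
    and "circ = quot_involution star"
    and "card (fixed_ring B circ) = q ^ f"
    and "even l \<longrightarrow> l = 2 * f" and "odd l \<longrightarrow> l = 2 * f - 1"
  \<comment> \<open>the hermitian spaces over \<open>A\<close> and \<open>B\<close>\<close>
    and "hermitian_form A V star h" and "free_of_rank A V 2" and "nondegenerate A V h"
    and "V' = quot_module V (ideal_power A \<rr> l)"
    and "h' = quot_form A (ideal_power A \<rr> l) h"
    and "U = unitary_group B V' h'"
    and "primitive B V' u" and "t = h' u u"
    and "S = stabilizer U (\<lambda>g. g) u"
  shows "(\<not> isotropic B V' h' \<longrightarrow>
            t \<in> Units B \<and> card (rcosets\<^bsub>U\<^esub> S) = q ^ (2 * l - f - 1) * (q + 1)) \<and>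
         (isotropic B V' h' \<longrightarrow>
            (t \<in> Units B \<longrightarrow> card (rcosets\<^bsub>U\<^esub> S) = q ^ (2 * l - f - 1) * (q - 1)) \<and>
            (t \<notin> Units B \<longrightarrow> card (rcosets\<^bsub>U\<^esub> S) = 2 * q ^ (2 * l - f - 1) * (q - 1)))"
proof -
  interpret F: field F by fact
  note O = val_ring_basics(1)[OF \<open>field F\<close> \<open>subfield K F\<close> \<open>nonarch_local_field (F\<lparr>carrier := K\<rparr>) v\<close>,
      folded \<open>\<O> = val_ring (F\<lparr>carrier := K\<rparr>) v\<close>]
  let ?X = "F\<lparr>carrier := \<R>\<rparr>"
  interpret X: domain ?X
    unfolding \<open>\<R> = ring.simple_extension F \<O> \<rho>\<close>
    by (intro F.subring_is_domain F.simple_extension_is_subring O \<open>\<rho> \<in> carrier F\<close>)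
  have rX: "\<rho> \<in> carrier ?X"
    unfolding \<open>\<R> = ring.simple_extension F \<O> \<rho>\<close> using F.simple_extension_mem[OF O \<open>\<rho> \<in> carrier F\<close>] by simp
  have OX: "\<O> \<subseteq> carrier ?X"
    unfolding \<open>\<R> = ring.simple_extension F \<O> \<rho>\<close>
    using F.simple_extension_incl[OF subringE(1)[OF O] \<open>\<rho> \<in> carrier F\<close>] by simp
  have pX: "\<pp> \<subseteq> carrier ?X"
    using OX val_ring_basics(2)[OF \<open>field F\<close> \<open>subfield K F\<close> \<open>nonarch_local_field (F\<lparr>carrier := K\<rparr>) v\<close>]
    unfolding \<open>\<O> = val_ring (F\<lparr>carrier := K\<rparr>) v\<close> \<open>\<pp> = val_ideal (F\<lparr>carrier := K\<rparr>) v\<close> by blast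
  have power: "ideal_power ?X \<P> n = PIdl\<^bsub>?X\<^esub> (\<rho> [^]\<^bsub>?X\<^esub> n)" for n
    unfolding \<open>\<P> = PIdl\<^bsub>?X\<^esub> \<rho>\<close> by (rule X.ideal_power_principal[OF rX])
  \<comment> \<open>The ideal \<open>\<pp>\<close> generates \<open>\<P>\<^sup>2\<close>.\<close>
  have pP: "\<pp> \<subseteq> \<P>"
  proof
    fix x assume "x \<in> \<pp>"
    then have "x \<in> PIdl\<^bsub>?X\<^esub> (\<rho> [^]\<^bsub>?X\<^esub> (2::nat))"
      using X.genideal_self[OF pX] \<open>Idl\<^bsub>?X\<^esub> \<pp> = ideal_power ?X \<P> 2\<close> power by auto
    then obtain z where z: "z \<in> carrier ?X" "x = z \<otimes>\<^bsub>?X\<^esub> \<rho> [^]\<^bsub>?X\<^esub> (2::nat)" unfolding cgenideal_def by blast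
    have "x = (z \<otimes>\<^bsub>?X\<^esub> \<rho>) \<otimes>\<^bsub>?X\<^esub> \<rho>"
      unfolding z(2) using X.m_assoc[OF z(1) rX rX] X.l_one[OF rX] by (simp add: numeral_2_eq_2)
    then show "x \<in> \<P>" unfolding \<open>\<P> = PIdl\<^bsub>?X\<^esub> \<rho>\<close> cgenideal_def using X.m_closed[OF z(1) rX] by blast
  qed
  have "\<pi> \<noteq> \<zero>\<^bsub>F\<^esub>" using \<open>ring_prime\<^bsub>F\<lparr>carrier := \<O>\<rparr>\<^esub> \<pi>\<close> by (simp add: ring_prime_def)
  interpret ud: uniformized_domain ?X \<rho> \<sigma> q
    by (rule ramified_uniformized_domain[where K = K and v = v and \<O> = \<O> and \<pp> = \<pp> and \<P> = \<P> and \<pi> = \<pi>]) fact+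
  have A: "A = ?X Quot PIdl\<^bsub>?X\<^esub> (\<rho> [^]\<^bsub>?X\<^esub> (2 * l))"
    using \<open>A = ?X Quot ideal_power ?X \<P> (2 * l)\<close> power by simp
  note chain = \<open>l \<ge> 1\<close> A \<open>maximalideal \<rr> A\<close>
  have B: "B = A Quot ideal_power A \<rr> l" and circ: "circ = quot_involution (quot_involution \<sigma>)"
    by (simp_all only: \<open>B = A Quot ideal_power A \<rr> l\<close> \<open>circ = quot_involution star\<close> \<open>star = quot_involution \<sigma>\<close>)
  note ring_facts = ud.involutive_local_double_quotient[OF chain, folded B circ]
  interpret red: hermitian_reduction A V star h "ideal_power A \<rr> l"
    unfolding \<open>star = quot_involution \<sigma>\<close>
    using \<open>hermitian_form A V star h\<close>[unfolded \<open>star = quot_involution \<sigma>\<close>]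
      ud.star_hom[OF chain] ud.rr_power_ideal[OF chain] ud.star_rr_power[OF chain]
    by (intro hermitian_reduction.intro involutive_hermitian_form.intro
        involutive_hermitian_form_axioms.intro hermitian_reduction_axioms.intro)
  note V' = \<open>V' = quot_module V (ideal_power A \<rr> l)\<close> and h' = \<open>h' = quot_form A (ideal_power A \<rr> l) h\<close>
  have form: "hermitian_form B V' circ h'"
    using red.quotient_hermitian_form unfolding B V' h' \<open>circ = quot_involution star\<close> .
  obtain E1 E2 where E: "E1 \<in> carrier V'" "E2 \<in> carrier V'"
    "\<And>x. x \<in> carrier V' \<Longrightarrow> \<exists>a\<in>carrier B. \<exists>b\<in>carrier B. x = a \<odot>\<^bsub>V'\<^esub> E1 \<oplus>\<^bsub>V'\<^esub> b \<odot>\<^bsub>V'\<^esub> E2"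
    "h' E1 E1 \<otimes>\<^bsub>B\<^esub> h' E2 E2 \<ominus>\<^bsub>B\<^esub> h' E1 E2 \<otimes>\<^bsub>B\<^esub> h' E2 E1 \<in> Units B"
    using red.quotient_basis[OF \<open>nondegenerate A V h\<close> \<open>free_of_rank A V 2\<close>] unfolding B V' h' by blast
  interpret plane: hermitian_plane B circ V' h' E1 E2
    using ring_facts(1) form E by (intro hermitian_plane.intro hermitian_plane_axioms.intro)
  note index = plane.unitary_index[OF ring_facts(2,3) \<open>card (fixed_ring B circ) = q ^ f\<close> \<open>l \<ge> 1\<close> \<open>primitive B V' u\<close>]
  show ?thesis
    unfolding \<open>S = stabilizer U (\<lambda>g. g) u\<close> \<open>U = unitary_group B V' h'\<close> \<open>t = h' u u\<close>
    using index by auto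
qed

end
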